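(* For each odd prime number $p$ with $p<2^5$ and $p\notin\{13,29\}$, there exists a Dehn $p$-colorable knot $K$ with $\mathrm{mincol}^{\mathrm{Dehn}}_p(K)=\lfloor\log_2 p\rfloor+2$.
   Context: $\mathbb Z_p=\mathbb Z/p\mathbb Z$. Let $D$ be a diagram of a knot $K$, and let $\mathcal R(D)$ be the set of regions of $D$ (connected components of the complement of the underlying immersed curve). At each crossing the four surrounding regions are named $x_1,x_2,x_3,x_4$ (not necessarily distinct) so that $x_2$ is adjacent to $x_1$ across an under-arc, $x_3$ is adjacent to $x_1$ across the over-arc, and $x_4$ is opposite to $x_1$. A Dehn $p$-coloring of $D$ is a map $C:\mathcal R(D)\to\mathbb Z_p$ such that $C(x_1)+C(x_3)=C(x_2)+C(x_4)$ at each crossing. A crossing is trivially colored by $C$ if $C(x_1)=C(x_4)$ and $C(x_3)=C(x_2)$ there. $C$ is trivial if every crossing is trivially colored, and nontrivial otherwise. A nontrivially Dehn $p$-colored diagram is a pair $(D,C)$ with $C$ a nontrivial Dehn $p$-coloring of $D$, and $\mathcal C(D,C)=\mathrm{Im}\,C\subset\mathbb Z_p$. A knot $K$ is Dehn $p$-colorable if some diagram of $K$ has a nontrivial Dehn $p$-coloring. For such $K$, $\mathrm{mincol}^{\mathrm{Dehn}}_p(K)$ is the minimum of $\#\mathcal C(D,C)$ over all nontrivially Dehn $p$-colored diagrams $(D,C)$ of $K$. *)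

theory Defs
  imports "HOL-Analysis.Analysis" "HOL-Number_Theory.Cong"
    "HOL-Computational_Algebra.Primes"
begin

text \<open>
  Knots are tame knots in Euclidean 3-space up to ambient isotopy, and diagrams are taken in the
  piecewise-linear category.  Writing 3-space as \<open>plane \<times> real\<close>, the projection of a diagram
  is \<open>fst\<close> and the height is \<open>snd\<close>.
\<close>

type_synonym plane = "real \<times> real"
type_synonym space = "plane \<times> real"


text \<open>
  A list \<open>P\<close> of vertices stands for the closed polygon through them, parametrised by
  \<open>{0..<length P}\<close>; the parameter runs through edge number \<open>i\<close>, from vertex \<open>i\<close> to
  vertex \<open>i + 1\<close> (cyclically), on \<open>{i..<i + 1}\<close>.
\<close>

definition vertex :: "space list \<Rightarrow> nat \<Rightarrow> space" where
  "vertex P i = P ! (i mod length P)"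

definition params :: "space list \<Rightarrow> real set" where
  "params P = {0..<real (length P)}"

definition point :: "space list \<Rightarrow> real \<Rightarrow> space" where
  "point P t = (1 - frac t) *\<^sub>R vertex P (nat \<lfloor>t\<rfloor>) + frac t *\<^sub>R vertex P (Suc (nat \<lfloor>t\<rfloor>))"

definition curve :: "space list \<Rightarrow> space set" where
  "curve P = point P ` params P"

definition polygonal_knot :: "space list \<Rightarrow> bool" where
  "polygonal_knot P \<longleftrightarrow> 3 \<le> length P \<and> inj_on (point P) (params P)"

definition ambient_isotopic :: "space set \<Rightarrow> space set \<Rightarrow> bool" where
  "ambient_isotopic K L \<longleftrightarrow>
     (\<exists>H :: real \<Rightarrow> space \<Rightarrow> space.
        continuous_on ({0..1} \<times> UNIV) (\<lambda>(t, x). H t x) \<and>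
        (\<forall>t\<in>{0..1}. \<exists>g. homeomorphism UNIV UNIV (H t) g) \<and>
        (\<forall>x. H 0 x = x) \<and> H 1 ` K = L)"

definition knot :: "space set \<Rightarrow> bool" where
  "knot K \<longleftrightarrow> (\<exists>P. polygonal_knot P \<and> ambient_isotopic (curve P) K)"


definition proj :: "space list \<Rightarrow> real \<Rightarrow> plane" where
  "proj P t = fst (point P t)"

definition direction :: "space list \<Rightarrow> real \<Rightarrow> plane" where
  "direction P t = fst (vertex P (Suc (nat \<lfloor>t\<rfloor>))) - fst (vertex P (nat \<lfloor>t\<rfloor>))"

text \<open>
  A diagram is a polygonal knot in regular position: the only multiple points of its projection
  are transverse double points interior to edges.  Transversality also rules out
  edges projecting to a point and overlapping edges, so there are only finitely many double
  points.  The over/under information is carried by the heights.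
\<close>

definition diagram :: "space list \<Rightarrow> bool" where
  "diagram D \<longleftrightarrow> polygonal_knot D \<and>
     (\<forall>s\<in>params D. \<forall>t\<in>params D. s \<noteq> t \<and> proj D s = proj D t \<longrightarrow>
        s \<notin> \<int> \<and> t \<notin> \<int> \<and>
        fst (direction D s) * snd (direction D t) \<noteq> snd (direction D s) * fst (direction D t)) \<and>
     (\<forall>r\<in>params D. \<forall>s\<in>params D. \<forall>t\<in>params D.
        proj D r = proj D s \<and> proj D s = proj D t \<longrightarrow> r = s \<or> s = t \<or> r = t)"

definition diagram_of :: "space list \<Rightarrow> space set \<Rightarrow> bool" where
  "diagram_of D K \<longleftrightarrow> diagram D \<and> ambient_isotopic (curve D) K"

definition regions :: "space list \<Rightarrow> plane set set" where
  "regions D = components (- (proj D ` params D))"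

text \<open>A crossing is given by the parameters \<open>(s, t)\<close> of its over-point and its under-point.\<close>

definition crossings :: "space list \<Rightarrow> (real \<times> real) set" where
  "crossings D = {(s, t). s \<in> params D \<and> t \<in> params D \<and> proj D s = proj D t \<and>
     snd (point D s) > snd (point D t)}"

text \<open>
  With \<open>u\<close> the direction of the over-arc and \<open>v\<close> that of the under-arc, one passes from
  \<open>u + v\<close> to \<open>- u + v\<close> across the under-arc and from \<open>u + v\<close> to \<open>u - v\<close> across the
  over-arc.  Starting from another of the four regions as \<open>x1\<close> changes neither the colouring
  condition nor triviality below.
\<close>

definition surrounding ::
    "space list \<Rightarrow> real \<times> real \<Rightarrow> plane set \<Rightarrow> plane set \<Rightarrow> plane set \<Rightarrow> plane set \<Rightarrow> bool" where
  "surrounding D c x1 x2 x3 x4 \<longleftrightarrow>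
     (let q = proj D (fst c); u = direction D (fst c); v = direction D (snd c) in
        {x1, x2, x3, x4} \<subseteq> regions D \<and>
        (\<forall>\<^sub>F e in at_right (0::real).
           q + e *\<^sub>R (u + v) \<in> x1 \<and> q + e *\<^sub>R (- u + v) \<in> x2 \<and>
           q + e *\<^sub>R (u - v) \<in> x3 \<and> q + e *\<^sub>R (- u - v) \<in> x4))"


text \<open>Residue classes modulo \<open>p\<close> are represented by the integers \<open>0, \<dots>, p - 1\<close>.\<close>

definition dehn_coloring :: "nat \<Rightarrow> space list \<Rightarrow> (plane set \<Rightarrow> int) \<Rightarrow> bool" where
  "dehn_coloring p D C \<longleftrightarrow> C ` regions D \<subseteq> {0..<int p} \<and>
     (\<forall>c\<in>crossings D. \<forall>x1 x2 x3 x4. surrounding D c x1 x2 x3 x4 \<longrightarrow>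
        [C x1 + C x3 = C x2 + C x4] (mod int p))"

definition trivially_colored ::
    "space list \<Rightarrow> (plane set \<Rightarrow> int) \<Rightarrow> real \<times> real \<Rightarrow> bool" where
  "trivially_colored D C c \<longleftrightarrow>
     (\<forall>x1 x2 x3 x4. surrounding D c x1 x2 x3 x4 \<longrightarrow> C x1 = C x4 \<and> C x3 = C x2)"

definition trivial_coloring :: "space list \<Rightarrow> (plane set \<Rightarrow> int) \<Rightarrow> bool" where
  "trivial_coloring D C \<longleftrightarrow> (\<forall>c\<in>crossings D. trivially_colored D C c)"

definition nontrivially_colored_diagram ::
    "nat \<Rightarrow> space list \<Rightarrow> (plane set \<Rightarrow> int) \<Rightarrow> bool" where
  "nontrivially_colored_diagram p D C \<longleftrightarrow>
     diagram D \<and> dehn_coloring p D C \<and> \<not> trivial_coloring D C"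

definition colors :: "space list \<Rightarrow> (plane set \<Rightarrow> int) \<Rightarrow> int set" where
  "colors D C = C ` regions D"

definition dehn_colorable :: "nat \<Rightarrow> space set \<Rightarrow> bool" where
  "dehn_colorable p K \<longleftrightarrow>
     (\<exists>D C. diagram_of D K \<and> nontrivially_colored_diagram p D C)"

definition mincol_dehn :: "nat \<Rightarrow> space set \<Rightarrow> nat" where
  "mincol_dehn p K =
     (LEAST n. \<exists>D C. diagram_of D K \<and> nontrivially_colored_diagram p D C \<and>
        card (colors D C) = n)"

end

theory Submission
  imports Defs "HOL-Library.Z2" "HOL-Library.Numeral_Type"
begin

text \<open>
  Lower bound.  The colours of a nontrivial colouring satisfy the relations
  \<open>x1 - x2 + x3 - x4 = 0\<close> modulo \<open>p\<close>.  Modulo 2 such relations say that the jump of a function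
  across the curve does not change along the curve, so on a knot the only solutions are the
  constants and possibly a checkerboard colouring.  Hence some \<open>n - 1\<close> relations on the \<open>n\<close> colours,
  with one colour normalised to \<open>0\<close>, have an odd determinant (in the checkerboard case \<open>n - 2\<close>
  relations, with two colours normalised).  It is a multiple of \<open>p\<close>, because the colours give a
  kernel vector modulo \<open>p\<close>, and splitting each row into two differences of unit vectors bounds it
  by \<open>2 ^ (n - 1)\<close>.

  Upper bound.  For each prime the braid relation \<open>r_i := r_i + (r_(i-1) - r_(i+1))\<close> or
  \<open>r_i := r_i - (r_(i-1) - r_(i+1))\<close> for region colours was searched for a closed braid of at most
  four strands whose closure is a knot and whose region colours stay in a set of the required
  size.  The resulting diagrams are drawn as axis-parallel lattice polygons, coloured by unit cells.
\<close>

section \<open>Odd minors of relation matrices\<close>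

text \<open>The lower bound concerns an arbitrary nontrivially coloured diagram and never its knot
  type. Hence no invariance under isotopy enters: one coloured polygon per prime suffices,
  \<open>K\<close> is the curve of that polygon, and every other diagram of \<open>K\<close> obeys
  the same bound. From \<open>2 ^ m < p\<close> and \<open>p \<le> 2 ^ (n - 1)\<close> one gets
  \<open>n \<ge> m + 2\<close>, which explains the summand 2. A relation row has four nonzero
  entries but costs only a factor 2: after splitting, the rows are unit vectors or differences of
  two unit vectors, so the matrix is a network matrix, with determinant 0, 1 or -1. The laborious
  point is the parity statement. That the jump does not change has to be seen at every kind of point
  of a polygonal curve: inside an edge, at a corner, at a vertex between collinear edges, at a
  crossing. It spreads over the whole curve because a knot has a single component; on a link the
  jump could differ between components, and there would be more solutions modulo 2.\<close>

definition rel_row :: "'n \<Rightarrow> 'n \<Rightarrow> 'n \<Rightarrow> 'n \<Rightarrow> 'a::comm_ring_1 ^ 'n" where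
  "rel_row a b c d = axis a 1 - axis b 1 + (axis c 1 - axis d 1)"

lemma det_Ints:
  fixes A :: "real^'n^'n"
  assumes "\<And>i j. A $ i $ j \<in> \<int>"
  shows "det A \<in> \<int>"
  unfolding det_def by (intro Ints_sum Ints_mult Ints_prod) (auto simp: assms)

text \<open>An inverse of such a matrix is integral: a column \<open>x\<close> of it has integral differences
  along the rows, so the indicator of its non-integral entries lies in the kernel.\<close>

lemma det_network:
  fixes A :: "real^'n^'n"
  assumes rows: "\<And>i. (\<exists>a b. A $ i = axis a 1 - axis b 1) \<or> (\<exists>a. A $ i = axis a 1)"
  shows "\<bar>det A\<bar> \<le> 1"
proof (cases "det A = 0")
  case False
  then have "invertible A"
    by (simp add: invertible_det_nz)
  then obtain B where AB: "A ** B = mat 1" and BA: "B ** A = mat 1"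
    by (auto simp: invertible_def)
  have ker: "x = 0" if "A *v x = 0" for x
    using that BA by (metis matrix_left_invertible_ker)
  have row: "(A *v x) $ i = A $ i \<bullet> x" for x i
    by (simp add: matrix_vector_mult_def inner_vec_def)
  have "B $ k $ j \<in> \<int>" for k j
  proof -
    define x where "x = column j B"
    define g :: "real^'n" where "g = (\<chi> i. if x $ i \<in> \<int> then 0 else 1)"
    have Ax: "A *v x = axis j 1"
    proof -
      have "(A *v x) $ i = (A ** B) $ i $ j" for i
        by (simp add: x_def matrix_vector_mult_def matrix_matrix_mult_def column_def)
      then show ?thesis
        by (auto simp: AB vec_eq_iff mat_def axis_def)
    qed
    have "(A *v g) $ i = 0" for i
    proof -
      have xi: "A $ i \<bullet> x \<in> \<int>"
        by (simp add: axis_def Ax flip: row)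
      consider a b where "A $ i = axis a 1 - axis b 1" | a where "A $ i = axis a 1"
        using rows by blast
      then show ?thesis
      proof cases
        case 1
        then have "x $ a - x $ b \<in> \<int>"
          using xi by (simp add: inner_diff_left inner_axis')
        then have "x $ a \<in> \<int> \<longleftrightarrow> x $ b \<in> \<int>"
          by (metis Ints_add Ints_diff diff_add_cancel diff_diff_eq2 add_diff_cancel_left')
        then show ?thesis
          unfolding row 1 by (simp add: inner_diff_left inner_axis' g_def)
      next
        case 2
        then show ?thesis
          using xi unfolding row 2 by (simp add: inner_axis' g_def)
      qed
    qed
    then have "g = 0"
      using ker[of g] by (simp add: vec_eq_iff)
    then have "g $ k = 0"
      by simp
    then show ?thesis
      by (simp add: g_def x_def column_def split: if_splits)
  qed
  then have detB: "det B \<in> \<int>"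
    by (rule det_Ints)
  have "A $ i $ j \<in> \<int>" for i j
    using rows[of i] by (auto simp: axis_def)
  then have detA: "det A \<in> \<int>"
    by (rule det_Ints)
  from detA detB obtain k l where kl: "det A = of_int k" "det B = of_int l"
    by (auto elim!: Ints_cases)
  have "det A * det B = 1"
    using AB by (metis det_mul det_I)
  then have "k * l = 1"
    using kl by (metis of_int_eq_1_iff of_int_mult)
  then have "\<bar>k\<bar> = 1"
    by (metis zdvd1_eq dvdI)
  then show ?thesis
    using kl by simp
qed simp

text \<open>Multilinearity in one row of \<open>I\<close> turns the determinant into a sum of two,
  in each of which that row is a difference of unit vectors; so every row of \<open>I\<close>
  doubles the bound. \<open>A\<close> is generalised in the induction because both summands belong
  to new matrices.\<close>

lemma det_rel_rows:
  fixes A :: "real^'n^'n"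
  assumes "\<And>i. i \<in> I \<Longrightarrow> \<exists>a b c d. A $ i = rel_row a b c d"
    and "\<And>i. i \<notin> I \<Longrightarrow> (\<exists>a b. A $ i = axis a 1 - axis b 1) \<or> (\<exists>a. A $ i = axis a 1)"
  shows "\<bar>det A\<bar> \<le> 2 ^ card I"
proof -
  have "finite I"
    by simp
  then show ?thesis
    using assms
  proof (induction I arbitrary: A rule: finite_induct)
    case empty
    then show ?case
      using det_network[of A] by simp
  next
    case (insert k I)
    obtain a b c d where k: "A $ k = rel_row a b c d"
      using insert.prems(1) by blast
    define M where "M v = (\<chi> i. if i = k then v else A $ i)" for v
    have "A = M (axis a 1 - axis b 1 + (axis c 1 - axis d 1))"
      using k by (simp add: M_def vec_eq_iff rel_row_def)
    then have "det A = det (M (axis a 1 - axis b 1)) + det (M (axis c 1 - axis d 1))"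
      unfolding M_def using det_row_add[of k "\<lambda>_. axis a 1 - axis b 1" "\<lambda>_. axis c 1 - axis d 1" "\<lambda>i. A $ i"]
      by simp
    moreover have part: "\<bar>det (M (axis a 1 - axis b 1))\<bar> \<le> 2 ^ card I" for a b
      by (rule insert.IH) (use insert.prems insert.hyps in \<open>auto simp: M_def\<close>)
    ultimately have "\<bar>det A\<bar> \<le> 2 ^ card I + 2 ^ card I"
      using part[of a b] part[of c d] by linarith
    then show ?case
      using insert.hyps by simp
  qed
qed


section \<open>Integer relation matrices, read modulo 2 and modulo p\<close>

lemma det_of_int:
  fixes M :: "int^'n^'n"
  shows "det ((\<chi> i j. of_int (M $ i $ j)) :: 'a::comm_ring_1^'n^'n) = of_int (det M)"
  unfolding det_def by (simp add: of_int_sum of_int_prod)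

lemma axis_sum:
  fixes f :: "'n::finite \<Rightarrow> 'a::comm_ring_1"
  shows "(\<Sum>j\<in>UNIV. axis a 1 $ j * f j) = f a"
  by (simp add: axis_def if_distrib[of "\<lambda>c. c * _"] cong: if_cong)

lemma rel_row_sum:
  fixes f :: "'n::finite \<Rightarrow> 'a::comm_ring_1"
  shows "(\<Sum>j\<in>UNIV. rel_row a b c d $ j * f j) = f a - f b + f c - f d"
  by (simp add: rel_row_def distrib_right left_diff_distrib sum.distrib sum_subtractf axis_sum)

text \<open>One integer row is read in two rings: over the reals, where the determinant is bounded,
  and over Z/2, where it is seen to be odd.\<close>

lemma of_int_rel_row: "of_int (rel_row a b c d $ j) = (rel_row a b c d $ j :: 'a::comm_ring_1)"
  by (simp add: rel_row_def axis_def)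

lemma of_int_axis: "of_int (axis a 1 $ j) = (axis a 1 $ j :: 'a::comm_ring_1)"
  by (simp add: axis_def)

lemma subspace_annihilator:
  fixes g :: "'a::field ^ 'n"
  shows "vec.subspace {v. (\<Sum>j\<in>UNIV. v $ j * g $ j) = 0}"
  by (simp add: vec.subspace_def distrib_right sum.distrib mult.assoc flip: sum_distrib_left)

text \<open>By \<open>ker2\<close> the unit rows of \<open>U\<close> and the relation rows together
  have trivial kernel modulo 2, so they contain a basis over Z/2. Lifted to the integers it is a
  square matrix of odd determinant. Cramer's rule applied to \<open>x\<close> makes this determinant
  a multiple of \<open>p\<close>, and only the relation rows, at most \<open>card (- U)\<close> of
  them, contribute factors 2 to its size.\<close>

lemma prime_le_of_relations:
  fixes x :: "'n::finite \<Rightarrow> int" and U :: "'n set" and Rel :: "('n \<times> 'n \<times> 'n \<times> 'n) set"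
  assumes p: "prime (p::nat)"
    and ker2: "\<And>g :: 'n \<Rightarrow> bit. \<lbrakk>\<And>u. u \<in> U \<Longrightarrow> g u = 0;
        \<And>a b c d. (a, b, c, d) \<in> Rel \<Longrightarrow> g a + g b + g c + g d = 0\<rbrakk> \<Longrightarrow> g = (\<lambda>_. 0)"
    and xU: "\<And>u. u \<in> U \<Longrightarrow> x u = 0"
    and xR: "\<And>a b c d. (a, b, c, d) \<in> Rel \<Longrightarrow> int p dvd x a - x b + x c - x d"
    and x0: "\<not> int p dvd x i0"
  shows "p \<le> 2 ^ card (- U)"
proof -
  define E where "E = (\<lambda>u. axis u (1::bit)) ` U"
  define R :: "(bit^'n) set" where "R = {rel_row a b c d | a b c d. (a, b, c, d) \<in> Rel}"
  have "E \<subseteq> cart_basis"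
    by (auto simp: E_def cart_basis_def)
  then have indE: "vec.independent E"
    using independent_cart_basis vec.independent_mono by blast
  have cardE: "card E = card U"
    unfolding E_def by (rule card_image) (auto simp: inj_on_def axis_eq_axis)
  \<comment> \<open>Starting the extension from \<open>E\<close> keeps all unit rows; once
    \<open>B\<close> is known to be a basis, exactly \<open>card (- U)\<close> of its members lie
    outside \<open>E\<close>.\<close>
  obtain B where B: "E \<subseteq> B" "B \<subseteq> E \<union> R" "vec.independent B" "E \<union> R \<subseteq> vec.span B"
    using vec.maximal_independent_subset_extend[OF _ indE, of "E \<union> R"] by blast
  have finB: "finite B"
    using B(3) vec.finiteI_independent by blast
  have "card B \<le> CARD('n)"
    using vec.independent_card_le_dim[of B UNIV] B(3) vec.dim_UNIV card_cart_basis[where 'a=bit and 'i='n] by simp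
  then obtain e :: "bit^'n \<Rightarrow> 'n" where e: "inj_on e B"
    using card_le_inj[OF finB, of "UNIV :: 'n set"] by auto
  define h where "h i = (if i \<in> e ` B then inv_into B e i else 0)" for i
  have he: "h (e b) = b" if "b \<in> B" for b
    using that e by (simp add: h_def)
  have dotR: "(\<Sum>j\<in>UNIV. b $ j * g $ j) = 0" if "b \<in> B" "(\<chi> i. h i) *v g = 0" for b g
  proof -
    have "((\<chi> i. h i) *v g) $ e b = 0"
      using that(2) by simp
    then show ?thesis
      by (simp only: matrix_vector_mult_def vec_lambda_beta he[OF that(1)])
  qed
  \<comment> \<open>A vector orthogonal to \<open>B\<close> is orthogonal to its span, hence to
    every unit and relation row. Over Z/2 the signs in \<open>rel_row\<close> disappear, so
    \<open>ker2\<close> applies.\<close>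
  have ker: "g = 0" if g: "(\<chi> i. h i) *v g = 0" for g :: "bit^'n"
  proof -
    have "vec.span B \<subseteq> {v. (\<Sum>j\<in>UNIV. v $ j * g $ j) = 0}"
      using dotR[OF _ g] by (intro vec.span_minimal subspace_annihilator subsetI CollectI)
    then have dot: "(\<Sum>j\<in>UNIV. v $ j * g $ j) = 0" if "v \<in> E \<union> R" for v
      using that B(4) by blast
    have "($) g = (\<lambda>_. 0)"
    proof (rule ker2)
      show "g $ u = 0" if "u \<in> U" for u
        using dot[of "axis u 1"] that unfolding axis_sum by (auto simp: E_def)
      show "g $ a + g $ b + g $ c + g $ d = 0" if "(a, b, c, d) \<in> Rel" for a b c d
      proof -
        have "rel_row a b c d \<in> E \<union> R"
          using that by (auto simp: R_def)
        from dot[OF this] show ?thesis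
          unfolding rel_row_sum by simp
      qed
    qed
    then show ?thesis
      by (simp only: vec_eq_iff zero_index simp_thms)
  qed
  define H where "H = (\<chi> i. h i)"
  have "\<forall>g. H *v g = 0 \<longrightarrow> g = 0"
    unfolding H_def using ker by blast
  then have left: "\<exists>L. L ** H = mat 1"
    unfolding matrix_left_invertible_ker .
  have inv: "invertible H"
    unfolding invertible_left_inverse by (fact left)
  have spanrows: "vec.span (rows H) = UNIV"
    unfolding matrix_left_invertible_span_rows_gen[symmetric] by (fact left)
  have "rows H \<subseteq> insert 0 B"
    by (auto simp: H_def rows_def row_def vec_lambda_eta h_def inv_into_into)
  then have "vec.span B = UNIV"
    using spanrows by (metis vec.span_insert_0 vec.span_mono top.extremum_uniqueI)
  then have cardB: "card B = CARD('n)"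
    using vec.basis_card_eq_dim[of B UNIV] B(3) vec.dim_UNIV card_cart_basis[where 'a=bit and 'i='n] by simp
  then have "e ` B = UNIV"
    using e by (metis card_image card_subset_eq finite_code subset_UNIV)
  then have "h = inv_into B e" and hB: "h i \<in> B" for i
    by (auto simp: h_def inv_into_into)
  with \<open>e ` B = UNIV\<close> have hinj: "inj h"
    using inj_on_inv_into[of UNIV e B] by simp
  define I where "I = {i. h i \<notin> E}"
  \<comment> \<open>The lift restores the signs that are lost over Z/2; with them the rows
    annihilate \<open>x\<close> modulo \<open>p\<close>.\<close>
  have "\<exists>r :: int^'n. (\<chi> j. of_int (r $ j)) = h i \<and>
      (if i \<in> I then \<exists>a b c d. (a, b, c, d) \<in> Rel \<and> r = rel_row a b c d else \<exists>u\<in>U. r = axis u 1)" for i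
  proof (cases "i \<in> I")
    case True
    then obtain a b c d where "(a, b, c, d) \<in> Rel" "h i = rel_row a b c d"
      using hB[of i] B(2) by (auto simp: I_def R_def)
    then show ?thesis
      using True by (intro exI[of _ "rel_row a b c d"]) (auto simp: of_int_rel_row)
  next
    case False
    then obtain u where "u \<in> U" "h i = axis u 1"
      by (auto simp: I_def E_def)
    then show ?thesis
      using False by (intro exI[of _ "axis u 1"]) (auto simp: of_int_axis)
  qed
  then obtain r :: "'n \<Rightarrow> int^'n" where r1: "\<And>i. (\<chi> j. of_int (r i $ j)) = h i"
    and r2: "\<And>i. if i \<in> I then \<exists>a b c d. (a, b, c, d) \<in> Rel \<and> r i = rel_row a b c d else \<exists>u\<in>U. r i = axis u 1"
    by metis
  define M where "M = (\<chi> i. r i)"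
  define A :: "real^'n^'n" where "A = (\<chi> i j. of_int (M $ i $ j))"
  have detA: "det A = of_int (det M)"
    unfolding A_def by (rule det_of_int)
  have "((\<chi> i j. of_int (M $ i $ j)) :: bit^'n^'n) = H"
    using r1 by (simp add: M_def H_def vec_eq_iff)
  \<comment> \<open>The reduction of \<open>M\<close> modulo 2 is the invertible matrix
    \<open>H\<close>, so \<open>det M\<close> is odd and in particular not 0.\<close>
  then have "of_int (det M) \<noteq> (0 :: bit)"
    using inv det_of_int[of M, where 'a=bit] by (simp add: invertible_det_nz)
  then have nz: "det M \<noteq> 0"
    by auto
  have "card I = card (h ` I)"
    by (metis card_image hinj inj_on_subset subset_UNIV)
  also have "h ` I \<subseteq> B - E"
    using hB by (auto simp: I_def)
  then have "card (h ` I) \<le> card (B - E)"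
    using finB by (intro card_mono) auto
  also have "card (B - E) = card (- U)"
    using B(1) finB cardB cardE by (simp add: card_Diff_subset finite_subset Compl_eq_Diff_UNIV)
  finally have cardI: "card I \<le> card (- U)" .
  have bound: "\<bar>det A\<bar> \<le> 2 ^ card I"
  proof (rule det_rel_rows)
    fix i
    show "\<exists>a b c d. A $ i = rel_row a b c d" if iI: "i \<in> I"
    proof -
      obtain a b c d where "r i = rel_row a b c d"
        using r2[of i] iI by auto
      then have "A $ i = rel_row a b c d"
        by (simp add: A_def M_def of_int_rel_row)
      then show ?thesis
        by blast
    qed
    show "(\<exists>a b. A $ i = axis a 1 - axis b 1) \<or> (\<exists>a. A $ i = axis a 1)" if iI: "i \<notin> I"
    proof -
      obtain u where "r i = axis u 1"
        using r2[of i] iI by auto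
      then have "A $ i = axis u 1"
        by (simp add: A_def M_def of_int_axis)
      then show ?thesis
        by blast
    qed
  qed
  define X :: "real^'n" where "X = (\<chi> j. of_int (x j))"
  have "int p dvd (\<Sum>j\<in>UNIV. M $ i $ j * x j)" for i
  proof (cases "i \<in> I")
    case True
    then obtain a b c d where abcd: "(a, b, c, d) \<in> Rel" "r i = rel_row a b c d"
      using r2[of i] by auto
    then have "(\<Sum>j\<in>UNIV. M $ i $ j * x j) = x a - x b + x c - x d"
      by (simp add: M_def rel_row_sum)
    then show ?thesis
      using xR[OF abcd(1)] by simp
  next
    case False
    then obtain u where "u \<in> U" "r i = axis u 1"
      using r2[of i] by auto
    then show ?thesis
      by (simp add: M_def axis_sum xU)
  qed
  then obtain w where w: "\<And>i. (\<Sum>j\<in>UNIV. M $ i $ j * x j) = int p * w i"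
    unfolding dvd_def by metis
  have AX: "(A *v X) $ i = of_int (int p * w i)" for i
    unfolding w[symmetric] by (simp add: matrix_vector_mult_def A_def X_def)
  define N where "N = (\<chi> i j. if j = i0 then w i else M $ i $ j)"
  \<comment> \<open>Cramer's rule: replacing column \<open>i0\<close> of \<open>A\<close> by
    \<open>A *v X\<close> multiplies the determinant by \<open>x i0\<close>. The new column is
    \<open>p\<close> times the integer vector \<open>w\<close>, so \<open>p\<close> can be pulled
    out.\<close>
  have "real_of_int (x i0) * det A = det (\<chi> i j. if j = i0 then (A *v X) $ i else A $ i $ j)"
    by (simp add: cramer_lemma X_def)
  also have "\<dots> = det (transpose (\<chi> j. if j = i0 then of_nat p *s (\<chi> i. of_int (w i)) else column j A))"
    unfolding AX by (rule arg_cong[of _ _ det]) (auto simp: vec_eq_iff transpose_def column_def)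
  also have "\<dots> = of_nat p * det (transpose (\<chi> j. if j = i0 then (\<chi> i. of_int (w i)) else column j A))"
    unfolding det_transpose by (rule det_row_mul)
  also have "transpose (\<chi> j. if j = i0 then (\<chi> i. of_int (w i)) else column j A)
      = (\<chi> i j. of_int (N $ i $ j))"
    by (auto simp: vec_eq_iff transpose_def column_def N_def A_def)
  finally have "real_of_int (x i0 * det M) = of_int (int p * det N)"
    by (simp add: detA det_of_int)
  then have "int p dvd x i0 * det M"
    by (metis dvd_triv_left of_int_eq_iff)
  then have "int p dvd det M"
    using p x0 by (simp add: prime_dvd_mult_iff)
  then have "int p \<le> \<bar>det M\<bar>"
    using nz by (metis abs_dvd_iff abs_of_nat dvd_abs_iff dvd_imp_le_int)
  also have "\<bar>det M\<bar> \<le> 2 ^ card I"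
    using bound unfolding detA by (metis of_int_abs of_int_le_iff of_int_numeral of_int_power)
  also have "\<dots> \<le> 2 ^ card (- U)"
    using cardI by (simp add: power_increasing)
  finally show ?thesis
    by (metis of_nat_le_iff of_nat_numeral of_nat_power)
qed

text \<open>Modulo 2 the relations admit at most a constant and one nonconstant solution, so one or two
  entries can be normalised to zero.\<close>

lemma prime_le_of_coloring:
  fixes c :: "'n::finite \<Rightarrow> int" and S :: "'n set" and Rel :: "('n \<times> 'n \<times> 'n \<times> 'n) set"
  assumes p: "prime (p::nat)"
    and S: "\<And>x1 x2 x3 x4. (x1, x2, x3, x4) \<in> Rel \<Longrightarrow> {x1, x2, x3, x4} \<subseteq> S"
    and rel: "\<And>x1 x2 x3 x4. (x1, x2, x3, x4) \<in> Rel \<Longrightarrow> int p dvd c x1 - c x2 + c x3 - c x4"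
    and inj: "\<And>x y. x \<in> S \<Longrightarrow> y \<in> S \<Longrightarrow> int p dvd c x - c y \<Longrightarrow> x = y"
    and mod2: "\<And>g :: 'n \<Rightarrow> bit. (\<And>x1 x2 x3 x4. (x1, x2, x3, x4) \<in> Rel \<Longrightarrow> g x1 + g x2 + g x3 + g x4 = 0) \<Longrightarrow>
        (\<forall>x\<in>S. \<forall>y\<in>S. g x = g y) \<or>
        (\<forall>x1 x2 x3 x4. (x1, x2, x3, x4) \<in> Rel \<longrightarrow> g x1 = g x4 \<and> g x2 = g x3 \<and> g x1 \<noteq> g x3)"
    and nontrivial: "(y1, y2, y3, y4) \<in> Rel" "\<not> (y1 = y4 \<and> y3 = y2)"
  shows "p \<le> 2 ^ (card S - 1)"
proof -
  have y: "y1 \<in> S" "y2 \<in> S" "y3 \<in> S" "y4 \<in> S"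
    using S[OF nontrivial(1)] by auto
  define even where "even g \<longleftrightarrow> (\<forall>x1 x2 x3 x4. (x1, x2, x3, x4) \<in> Rel \<longrightarrow> g x1 + g x2 + g x3 + g x4 = 0)"
    for g :: "'n \<Rightarrow> bit"
  have evenD: "g x1 + g x2 + g x3 + g x4 = 0" if "even g" "(x1, x2, x3, x4) \<in> Rel" for g x1 x2 x3 x4
    using that unfolding even_def by blast
  have alt: "(\<forall>x\<in>S. \<forall>y\<in>S. g x = g y) \<or>
      (\<forall>x1 x2 x3 x4. (x1, x2, x3, x4) \<in> Rel \<longrightarrow> g x1 = g x4 \<and> g x2 = g x3 \<and> g x1 \<noteq> g x3)" if "even g" for g
    by (rule mod2) (rule evenD[OF that])
  show ?thesis
  proof (cases "\<exists>g. even g \<and> (\<exists>x\<in>S. \<exists>y\<in>S. g x \<noteq> g y)")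
    case False
    \<comment> \<open>Here every even function is constant on \<open>S\<close>, and fixing the value
      at \<open>y1\<close> kills it. Subtracting \<open>c y1\<close> preserves the relations because
      their coefficients sum to 0. Indices outside \<open>S\<close> only pad the index type and are
      fixed at 0.\<close>
    define U where "U = insert y1 (- S)"
    define x where "x i = (if i \<in> S then c i - c y1 else 0)" for i
    have "\<exists>i0. \<not> int p dvd x i0"
    proof (rule ccontr)
      assume "\<nexists>i0. \<not> int p dvd x i0"
      then have "int p dvd c i - c y1" if "i \<in> S" for i
        using that by (simp add: x_def) metis
      then have "i = y1" if "i \<in> S" for i
        using inj that y(1) by blast
      then show False
        using nontrivial(2) y by metis
    qed
    then obtain i0 where i0: "\<not> int p dvd x i0"
      by blast
    have "p \<le> 2 ^ card (- U)"
    proof (rule prime_le_of_relations[OF p, where U = U and Rel = Rel and x = x and ?i0.0 = i0])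
      fix g :: "'n \<Rightarrow> bit"
      assume U: "\<And>u. u \<in> U \<Longrightarrow> g u = 0"
        and R: "\<And>a b c d. (a, b, c, d) \<in> Rel \<Longrightarrow> g a + g b + g c + g d = 0"
      have "even g"
        unfolding even_def using R by blast
      then have "g i = g y1" if "i \<in> S" for i
        using False that y(1) by blast
      moreover have "g y1 = 0"
        using U by (simp add: U_def)
      moreover have "g i = 0" if "i \<notin> S" for i
        using U that by (simp add: U_def)
      ultimately have "g i = 0" for i
        by metis
      then show "g = (\<lambda>_. 0)"
        by (rule ext)
    next
      show "x u = 0" if "u \<in> U" for u
        using that by (auto simp: U_def x_def)
      show "int p dvd x a - x b + x e - x d" if "(a, b, e, d) \<in> Rel" for a b e d
        using rel[OF that] S[OF that] by (simp add: x_def algebra_simps)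
    qed (rule i0)
    moreover have "- U = S - {y1}"
      by (auto simp: U_def)
    ultimately show ?thesis
      using y(1) by simp
  next
    case True
    then obtain g s0 s1 where g: "even g" "s0 \<in> S" "s1 \<in> S" "g s0 = 0" "g s1 = 1"
      by (metis (full_types) bit_not_one_iff)
    have gR: "g x1 = g x4 \<and> g x2 = g x3 \<and> g x1 \<noteq> g x3" if "(x1, x2, x3, x4) \<in> Rel" for x1 x2 x3 x4
      using alt[OF g(1)] g that by (metis zero_neq_one)
    define U where "U = insert s0 (insert s1 (- S))"
    \<comment> \<open>At every relation \<open>g\<close> pairs \<open>x1\<close> with
      \<open>x4\<close> and \<open>x2\<close> with \<open>x3\<close>, and the members of a pair
      carry opposite signs. So a separate constant may be subtracted on each of the two classes, and
      \<open>x\<close> vanishes at both \<open>s0\<close> and \<open>s1\<close>.\<close>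
    define x where "x i = (if i \<in> S then c i - c (if g i = 0 then s0 else s1) else 0)" for i
    have "\<exists>i0. \<not> int p dvd x i0"
    proof (rule ccontr)
      assume "\<nexists>i0. \<not> int p dvd x i0"
      then have "int p dvd c i - c (if g i = 0 then s0 else s1)" if "i \<in> S" for i
        using that unfolding x_def by metis
      then have "i = (if g i = 0 then s0 else s1)" if "i \<in> S" for i
        using inj[of i "if g i = 0 then s0 else s1"] that g(2,3) by auto
      then have "y1 = y4 \<and> y3 = y2"
        using gR[OF nontrivial(1)] y by metis
      then show False
        using nontrivial(2) by blast
    qed
    then obtain i0 where i0: "\<not> int p dvd x i0"
      by blast
    have "p \<le> 2 ^ card (- U)"
    proof (rule prime_le_of_relations[OF p, where U = U and Rel = Rel and x = x and ?i0.0 = i0])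
      fix h :: "'n \<Rightarrow> bit"
      assume U: "\<And>u. u \<in> U \<Longrightarrow> h u = 0"
        and R: "\<And>a b c d. (a, b, c, d) \<in> Rel \<Longrightarrow> h a + h b + h c + h d = 0"
      have h: "h s0 = 0" "h s1 = 0" "\<And>i. i \<notin> S \<Longrightarrow> h i = 0"
        using U by (auto simp: U_def)
      have "even h"
        unfolding even_def using R by blast
      have "\<forall>x\<in>S. \<forall>y\<in>S. h x = h y"
      proof (rule ccontr)
        assume "\<not> (\<forall>x\<in>S. \<forall>y\<in>S. h x = h y)"
        then have hR: "h y1 \<noteq> h y3"
          using alt[OF \<open>even h\<close>] nontrivial(1) by blast
        \<comment> \<open>Both \<open>g\<close> and \<open>h\<close> differ between
          \<open>y1\<close> and \<open>y3\<close>, so their sum does not. Being no checkerboard, the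
          sum would be constant on \<open>S\<close>, against its values 0 at \<open>s0\<close> and 1
          at \<open>s1\<close>.\<close>
        have "even (\<lambda>i. g i + h i)"
          unfolding even_def
        proof (intro allI impI)
          fix x1 x2 x3 x4
          assume r: "(x1, x2, x3, x4) \<in> Rel"
          have "g x1 + h x1 + (g x2 + h x2) + (g x3 + h x3) + (g x4 + h x4)
              = (g x1 + g x2 + g x3 + g x4) + (h x1 + h x2 + h x3 + h x4)"
            by (simp only: ac_simps)
          then show "g x1 + h x1 + (g x2 + h x2) + (g x3 + h x3) + (g x4 + h x4) = 0"
            using evenD[OF g(1) r] R[OF r] by simp
        qed
        from alt[OF this] show False
        proof
          assume "\<forall>x\<in>S. \<forall>y\<in>S. g x + h x = g y + h y"
          then have "g s0 + h s0 = g s1 + h s1"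
            using g by blast
          then show False
            using g h by simp
        next
          assume "\<forall>x1 x2 x3 x4. (x1, x2, x3, x4) \<in> Rel \<longrightarrow>
            g x1 + h x1 = g x4 + h x4 \<and> g x2 + h x2 = g x3 + h x3 \<and> g x1 + h x1 \<noteq> g x3 + h x3"
          then have "g y1 + h y1 \<noteq> g y3 + h y3"
            using nontrivial(1) by blast
          then show False
            using gR[OF nontrivial(1)] hR
            by (cases "g y1"; cases "g y3"; cases "h y1"; cases "h y3") auto
        qed
      qed
      then have "h i = 0" for i
        using h g(2) by metis
      then show "h = (\<lambda>_. 0)"
        by (rule ext)
    next
      show "x u = 0" if "u \<in> U" for u
        using that g by (auto simp: U_def x_def)
      show "int p dvd x a - x b + x e - x d" if r: "(a, b, e, d) \<in> Rel" for a b e d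
      proof -
        have "x a - x b + x e - x d = c a - c b + c e - c d"
          using gR[OF r] S[OF r] by (auto simp: x_def)
        then show ?thesis
          using rel[OF r] by simp
      qed
    qed (rule i0)
    also have "card (- U) \<le> card (S - {s0})"
      by (rule card_mono) (auto simp: U_def)
    then have "(2::nat) ^ card (- U) \<le> 2 ^ (card S - 1)"
      using g(2) by (simp add: power_increasing)
    finally show ?thesis .
  qed
qed

section \<open>Local structure of a diagram\<close>

definition cross :: "plane \<Rightarrow> plane \<Rightarrow> real" where
  "cross u v = fst u * snd v - snd u * fst v"

lemma cross_simps [simp]:
  "cross (u + v) w = cross u w + cross v w" "cross w (u + v) = cross w u + cross w v"
  "cross (c *\<^sub>R u) w = c * cross u w" "cross w (c *\<^sub>R u) = c * cross w u"
  "cross (- u) w = - cross u w" "cross w (- u) = - cross w u"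
  "cross (u - v) w = cross u w - cross v w" "cross w (u - v) = cross w u - cross w v"
  "cross u u = 0" "cross 0 u = 0" "cross u 0 = 0"
  by (simp_all add: cross_def algebra_simps)

lemma cross_swap: "cross u v = - cross v u"
  by (simp add: cross_def)

lemma cross_expand:
  assumes "cross a b \<noteq> 0"
  shows "w = (cross w b / cross a b) *\<^sub>R a + (cross a w / cross a b) *\<^sub>R b"
proof -
  have "cross a b *\<^sub>R w = cross w b *\<^sub>R a + cross a w *\<^sub>R b"
    by (cases w; cases a; cases b) (simp add: cross_def algebra_simps)
  then have "w = (1 / cross a b) *\<^sub>R (cross w b *\<^sub>R a + cross a w *\<^sub>R b)"
    using assms by (metis divide_self_if scaleR_one scaleR_scaleR mult.commute times_divide_eq_left mult_1)
  then show ?thesis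
    by (simp add: scaleR_add_right)
qed

definition rot :: "plane \<Rightarrow> plane" where
  "rot u = (- snd u, fst u)"

lemma cross_rot: "u \<noteq> 0 \<Longrightarrow> cross u (rot u) > 0"
  by (cases u) (auto simp: cross_def rot_def zero_prod_def add_pos_nonneg add_nonneg_pos
      power2_eq_square[symmetric] sum_power2_gt_zero_iff)

lemma rot_scale: "rot (c *\<^sub>R u) = c *\<^sub>R rot u"
  by (simp add: rot_def)

lemma cross_eq_0_parallel:
  assumes "cross w u = 0" "u \<noteq> 0"
  obtains c where "w = c *\<^sub>R u"
  using cross_expand[of u "rot u" w] cross_rot[OF assms(2)] assms(1) cross_swap[of u w]
  by (metis add.right_neutral div_0 minus_zero order_less_irrefl scaleR_zero_left)

text \<open>Tells whether \<open>F\<close> changes across an oriented curve; \<open>rot d\<close>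
  points to the left of \<open>d\<close>. Letting \<open>e\<close> tend to 0 makes it depend only on
  the germ of \<open>F\<close> at \<open>z\<close>.\<close>

definition jump :: "(plane \<Rightarrow> 'a) \<Rightarrow> plane \<Rightarrow> plane \<Rightarrow> bool" where
  "jump F z d \<longleftrightarrow> (\<forall>\<^sub>F e in at_right 0. F (z + e *\<^sub>R rot d) \<noteq> F (z - e *\<^sub>R rot d))"

lemma eventually_small:
  fixes r c :: real
  assumes "r > 0"
  shows "\<forall>\<^sub>F e in at_right 0. \<bar>e * c\<bar> < r"
proof -
  have "((\<lambda>e. \<bar>e * c\<bar>) \<longlongrightarrow> \<bar>0 * c\<bar>) (at_right 0)"
    by (intro tendsto_intros)
  then show ?thesis
    using assms by (simp add: order_tendstoD(2))
qed

text \<open>The normal need not be parallel to \<open>b\<close>. Written as \<open>l\<close> times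
  \<open>a\<close> plus \<open>m\<close> times \<open>b\<close> it has \<open>m \<noteq> 0\<close>,
  so a small step along it stays inside one of the two boxes, and the sign of \<open>m\<close>
  decides which box is on the left. The factor \<open>c\<close> also admits the reversed
  direction.\<close>

lemma jump_iff:
  assumes ab: "cross a b \<noteq> 0"
    and A: "\<And>\<alpha> \<beta>. 0 < \<alpha> \<Longrightarrow> \<alpha> < r \<Longrightarrow> 0 < \<beta> \<Longrightarrow> \<beta> < r \<Longrightarrow> F (z + \<alpha> *\<^sub>R a + \<beta> *\<^sub>R b) = A"
    and B: "\<And>\<alpha> \<beta>. 0 < \<alpha> \<Longrightarrow> \<alpha> < r \<Longrightarrow> 0 < \<beta> \<Longrightarrow> \<beta> < r \<Longrightarrow> F (z + \<alpha> *\<^sub>R a - \<beta> *\<^sub>R b) = B"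
    and \<tau>: "0 < \<tau>" "\<tau> < r" and c: "c \<noteq> 0"
  shows "jump F (z + \<tau> *\<^sub>R a) (c *\<^sub>R a) \<longleftrightarrow> A \<noteq> B"
proof -
  have "a \<noteq> 0"
    using ab by (auto simp: cross_def)
  define l where "l = cross (rot (c *\<^sub>R a)) b / cross a b"
  define m where "m = cross a (rot (c *\<^sub>R a)) / cross a b"
  have n: "rot (c *\<^sub>R a) = l *\<^sub>R a + m *\<^sub>R b"
    unfolding l_def m_def by (rule cross_expand[OF ab])
  have "m \<noteq> 0"
    using cross_rot[OF \<open>a \<noteq> 0\<close>] c ab by (simp add: m_def rot_scale)
  have "\<forall>\<^sub>F e in at_right 0. \<bar>e * l\<bar> < min \<tau> (r - \<tau>)" "\<forall>\<^sub>F e in at_right 0. \<bar>e * m\<bar> < r"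
    using \<tau> by (intro eventually_small; simp)+
  then have ev: "\<forall>\<^sub>F e in at_right 0. (F (z + \<tau> *\<^sub>R a + e *\<^sub>R rot (c *\<^sub>R a)) \<noteq> F (z + \<tau> *\<^sub>R a - e *\<^sub>R rot (c *\<^sub>R a))) = (A \<noteq> B)"
    using eventually_at_right_less[of 0]
  proof eventually_elim
    case (elim e)
    have eq: "z + \<tau> *\<^sub>R a + e *\<^sub>R rot (c *\<^sub>R a) = z + (\<tau> + e * l) *\<^sub>R a + (e * m) *\<^sub>R b"
      "z + \<tau> *\<^sub>R a + e *\<^sub>R rot (c *\<^sub>R a) = z + (\<tau> + e * l) *\<^sub>R a - (- (e * m)) *\<^sub>R b"
      "z + \<tau> *\<^sub>R a - e *\<^sub>R rot (c *\<^sub>R a) = z + (\<tau> - e * l) *\<^sub>R a - (e * m) *\<^sub>R b"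
      "z + \<tau> *\<^sub>R a - e *\<^sub>R rot (c *\<^sub>R a) = z + (\<tau> - e * l) *\<^sub>R a + (- (e * m)) *\<^sub>R b"
      unfolding n by (simp_all add: algebra_simps)
    have pos: "0 < \<tau> + e * l" "\<tau> + e * l < r" "0 < \<tau> - e * l" "\<tau> - e * l < r"
      using elim by (simp_all add: abs_less_iff)
    consider "e * m > 0" "e * m < r" | "- (e * m) > 0" "- (e * m) < r"
      using elim \<open>m \<noteq> 0\<close> by (cases "m > 0") (auto simp: mult_less_0_iff abs_less_iff)
    then show ?case
    proof cases
      case 1
      then show ?thesis
        unfolding eq(1) eq(3) using A[OF pos(1,2) 1] B[OF pos(3,4) 1] by simp
    next
      case 2
      then show ?thesis
        unfolding eq(2) eq(4) using B[OF pos(1,2) 2] A[OF pos(3,4) 2] by auto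
    qed
  qed
  show ?thesis
  proof (cases "A = B")
    case True
    have "\<forall>\<^sub>F e in at_right (0::real). False" if "jump F (z + \<tau> *\<^sub>R a) (c *\<^sub>R a)"
      using that[unfolded jump_def] ev by eventually_elim (use True in simp)
    then show ?thesis
      using True by auto
  next
    case False
    then show ?thesis
      using ev by (simp add: jump_def)
  qed
qed

text \<open>Nearby points have equal local values because some point of \<open>G\<close> is close to
  both. Used for the jump on the parameter half-line, and for \<open>F\<close> on the plane with
  \<open>G\<close> the complement of the shadow.\<close>

lemma connected_generic_value:
  fixes I :: "'a::t1_space set"
  assumes I: "connected I" "open I"
    and dense: "\<And>x. x \<in> I \<Longrightarrow> \<exists>\<^sub>F y in at x. y \<in> G"
    and loc: "\<And>x. x \<in> I \<Longrightarrow> \<forall>\<^sub>F y in at x. y \<in> G \<longrightarrow> J y = j x"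
    and xy: "x \<in> I" "y \<in> I"
  shows "j x = j y"
proof (rule connected_local_const[OF I(1) xy], intro ballI)
  fix x assume x: "x \<in> I"
  obtain S where S: "open S" "x \<in> S" "\<And>y. y \<in> S \<Longrightarrow> y \<noteq> x \<Longrightarrow> y \<in> G \<Longrightarrow> J y = j x"
    using loc[OF x] by (auto simp: eventually_at_topological)
  have "j x = j y" if y: "y \<in> S" "y \<in> I" "y \<noteq> x" for y
  proof -
    have "\<forall>\<^sub>F w in at y. w \<in> S - {x}"
      using S(1) y by (intro eventually_at_in_open') auto
    with loc[OF y(2)] have "\<forall>\<^sub>F w in at y. w \<in> G \<longrightarrow> j x = j y"
      by eventually_elim (use S(3) in auto)
    with dense[OF y(2)] have "\<exists>\<^sub>F w in at y. j x = j y"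
      by (rule frequently_rev_mp)
    then show ?thesis
      by (auto dest: frequently_ex)
  qed
  then show "\<forall>\<^sub>F y in at x within I. j x = j y"
    unfolding eventually_at_topological using S(1,2) by blast
qed

section \<open>The projected polygon and its periodic parametrisation\<close>

locale knot_diagram =
  fixes D :: "space list"
  assumes diagram: "diagram D"
begin

abbreviation shadow :: "plane set" where
  "shadow \<equiv> proj D ` params D"

definition dir :: "nat \<Rightarrow> plane" where
  "dir k = fst (vertex D (Suc k)) - fst (vertex D k)"

text \<open>Parameters are extended periodically from \<open>params D\<close> to all nonnegative
  reals, so that the curve runs along a connected half-line and the closing vertex needs no special
  treatment. This is the matching notion of equal parameters.\<close>

definition same_param :: "real \<Rightarrow> real \<Rightarrow> bool" where
  "same_param s t \<longleftrightarrow> (\<exists>i::int. s - t = of_int i * real (length D))"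

lemma length_ge_3: "3 \<le> length D"
  using diagram by (simp add: diagram_def polygonal_knot_def)

lemma proj_edge:
  assumes "0 \<le> a" "a \<le> 1"
  shows "proj D (real k + a) = fst (vertex D k) + a *\<^sub>R dir k"
proof (cases "a = 1")
  case True
  then have "real k + a = of_int (int (Suc k))"
    by simp
  then show ?thesis
    using True unfolding proj_def point_def by (simp only: frac_of_int floor_of_int nat_int) (simp add: dir_def)
next
  case False
  then have "\<lfloor>real k + a\<rfloor> = int k"
    using assms by (simp add: floor_eq_iff)
  then show ?thesis
    by (simp add: proj_def point_def frac_def dir_def algebra_simps)
qed

lemma direction_edge:
  assumes "0 \<le> a" "a < 1"
  shows "direction D (real k + a) = dir k"
proof -
  have "\<lfloor>real k + a\<rfloor> = int k"
    using assms by (simp add: floor_eq_iff)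
  then show ?thesis
    by (simp add: direction_def dir_def)
qed

lemma nonneg_edge:
  assumes "0 \<le> t"
  obtains k a where "t = real k + a" "0 \<le> a" "a < 1"
proof -
  have "t = real (nat \<lfloor>t\<rfloor>) + frac t"
    using assms by (simp add: frac_def)
  then show ?thesis
    using that frac_ge_0 frac_lt_1 by blast
qed

lemma vertex_periodic: "vertex D (k + m * length D) = vertex D k"
  by (simp add: vertex_def)

lemma dir_periodic: "dir (k + m * length D) = dir k"
  using vertex_periodic[of k m] vertex_periodic[of "Suc k" m] by (simp add: dir_def)

lemma periodic:
  assumes "0 \<le> t"
  shows "proj D (t + real (m * length D)) = proj D t" "direction D (t + real (m * length D)) = direction D t"
proof -
  obtain k a where t: "t = real k + a" "0 \<le> a" "a < 1"
    using nonneg_edge[OF assms] .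
  have t': "t + real (m * length D) = real (k + m * length D) + a"
    using t by simp
  show "proj D (t + real (m * length D)) = proj D t"
    unfolding t' using t by (simp only: proj_edge less_imp_le vertex_periodic dir_periodic)
  show "direction D (t + real (m * length D)) = direction D t"
    unfolding t' using t by (simp only: direction_edge dir_periodic)
qed

lemma param_of:
  assumes "0 \<le> t"
  obtains s m where "s \<in> params D" "t = s + real (m * length D)"
proof -
  define m where "m = nat \<lfloor>t / length D\<rfloor>"
  have N: "real (length D) > 0"
    using length_ge_3 by linarith
  have m: "real m = of_int \<lfloor>t / length D\<rfloor>"
    using assms N by (simp add: m_def)
  have "real m \<le> t / length D" "t / length D < real m + 1"
    unfolding m by linarith+
  then have "t - real (m * length D) \<in> params D"
    using N by (simp add: params_def field_simps)
  then show ?thesis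
    using that[of "t - real (m * length D)" m] by simp
qed

lemma params_nonneg: "t \<in> params D \<Longrightarrow> 0 \<le> t"
  by (simp add: params_def)

lemma proj_in_shadow: "0 \<le> t \<Longrightarrow> proj D t \<in> shadow"
  by (metis image_eqI param_of params_nonneg periodic(1))

lemma same_param_shift:
  assumes "t = s + real (m * length D)" "t' = s' + real (m' * length D)"
  shows "same_param t t' \<longleftrightarrow> same_param s s'"
proof -
  have "t - t' = of_int i * real (length D) \<longleftrightarrow> s - s' = of_int (i - int m + int m') * real (length D)" for i
    using assms by (auto simp: algebra_simps)
  moreover have "s - s' = of_int i * real (length D) \<longleftrightarrow> t - t' = of_int (i + int m - int m') * real (length D)" for i
    using assms by (auto simp: algebra_simps)
  ultimately show ?thesis
    unfolding same_param_def by blast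
qed

lemma same_param_refl: "same_param t t"
  unfolding same_param_def by (intro exI[of _ 0]) simp

lemma Ints_shift: "t = s + real (m * length D) \<Longrightarrow> t \<in> \<int> \<longleftrightarrow> s \<in> \<int>"
  by (metis Ints_add Ints_diff Ints_of_nat add_diff_cancel_right')

lemma double_point:
  assumes "0 \<le> s" "0 \<le> t" "proj D s = proj D t"
  shows "same_param s t \<or> s \<notin> \<int> \<and> t \<notin> \<int> \<and> cross (direction D s) (direction D t) \<noteq> 0"
proof -
  obtain s' m where s: "s' \<in> params D" "s = s' + real (m * length D)"
    using param_of[OF assms(1)] .
  obtain t' n where t: "t' \<in> params D" "t = t' + real (n * length D)"
    using param_of[OF assms(2)] .
  note per = periodic[OF params_nonneg[OF s(1)]] periodic[OF params_nonneg[OF t(1)]]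
  have dirs: "direction D s = direction D s'" "direction D t = direction D t'"
    unfolding s t per by simp_all
  have "proj D s' = proj D t'"
    using assms(3) unfolding s t per .
  then have "s' = t' \<or> s' \<notin> \<int> \<and> t' \<notin> \<int> \<and> cross (direction D s') (direction D t') \<noteq> 0"
    using diagram s(1) t(1) unfolding diagram_def cross_def by auto
  then show ?thesis
    using same_param_shift[OF s(2) t(2)] same_param_refl[of s'] Ints_shift[OF s(2)] Ints_shift[OF t(2)] dirs
    by metis
qed

lemma triple_point:
  assumes "0 \<le> r" "0 \<le> s" "0 \<le> t" "proj D r = proj D s" "proj D s = proj D t"
  shows "same_param r s \<or> same_param s t \<or> same_param r t"
proof -
  obtain r' l where r: "r' \<in> params D" "r = r' + real (l * length D)"
    using param_of[OF assms(1)] .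
  obtain s' m where s: "s' \<in> params D" "s = s' + real (m * length D)"
    using param_of[OF assms(2)] .
  obtain t' n where t: "t' \<in> params D" "t = t' + real (n * length D)"
    using param_of[OF assms(3)] .
  note per = periodic[OF params_nonneg[OF r(1)]] periodic[OF params_nonneg[OF s(1)]]
    periodic[OF params_nonneg[OF t(1)]]
  have "proj D r' = proj D s'" "proj D s' = proj D t'"
    using assms(4,5) unfolding r s t per by auto
  then have "r' = s' \<or> s' = t' \<or> r' = t'"
    using diagram r(1) s(1) t(1) unfolding diagram_def by blast
  then show ?thesis
    using same_param_shift[OF r(2) s(2)] same_param_shift[OF s(2) t(2)] same_param_shift[OF r(2) t(2)]
      same_param_refl by auto
qed

lemma same_param_imp:
  assumes "0 \<le> s" "0 \<le> t" "same_param s t"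
  shows "proj D s = proj D t" "direction D s = direction D t" "s \<in> \<int> \<longleftrightarrow> t \<in> \<int>"
proof -
  obtain i :: int where i: "s - t = of_int i * real (length D)"
    using assms(3) by (auto simp: same_param_def)
  have "proj D s = proj D t \<and> direction D s = direction D t \<and> (s \<in> \<int> \<longleftrightarrow> t \<in> \<int>)"
  proof (cases "i \<ge> 0")
    case True
    then have "s = t + real (nat i * length D)"
      using i by simp
    then show ?thesis
      using periodic[OF assms(2)] Ints_shift by metis
  next
    case False
    then have "t = s + real (nat (- i) * length D)"
      using i by simp
    then show ?thesis
      using periodic[OF assms(1)] Ints_shift by metis
  qed
  then show "proj D s = proj D t" "direction D s = direction D t" "s \<in> \<int> \<longleftrightarrow> t \<in> \<int>"
    by auto
qed

lemma not_same_param: "s \<noteq> t \<Longrightarrow> \<bar>s - t\<bar> < 3 \<Longrightarrow> \<not> same_param s t"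
proof
  assume st: "s \<noteq> t" "\<bar>s - t\<bar> < 3" "same_param s t"
  then obtain i :: int where i: "s - t = of_int i * real (length D)"
    by (auto simp: same_param_def)
  then have "i \<noteq> 0"
    using st(1) by auto
  then have "3 \<le> \<bar>real_of_int i\<bar> * real (length D)"
    using length_ge_3 mult_mono[of 1 "\<bar>real_of_int i\<bar>" 3 "real (length D)"] by simp
  then show False
    using st(2) i by (simp add: abs_mult)
qed

text \<open>An edge projecting to a point would make its initial vertex a multiple point, whereas
  multiple points have noninteger parameters.\<close>

lemma dir_nonzero: "dir k \<noteq> 0"
proof
  assume "dir k = 0"
  then have "proj D (real k + 0) = proj D (real k + 1 / 2)"
    by (simp only: proj_edge) (simp add: proj_edge)
  moreover have "\<not> same_param (real k + 0) (real k + 1 / 2)"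
    by (rule not_same_param) auto
  ultimately show False
    using double_point[of "real k + 0" "real k + 1 / 2"] by auto
qed

text \<open>An edge doubling back on its predecessor would overlap it near the common vertex and
  produce a double point that is not transversal.\<close>

lemma no_backtracking:
  assumes "dir (Suc k) = c *\<^sub>R dir k"
  shows "c > 0"
proof (rule ccontr)
  assume "\<not> c > 0"
  moreover have "c \<noteq> 0"
    using assms dir_nonzero[of "Suc k"] by auto
  ultimately have c: "c < 0"
    by simp
  \<comment> \<open>Chosen so that \<open>e\<close> and \<open>- c * e\<close> are positive with sum
    1; then both parameters lie inside their edges.\<close>
  define e where "e = 1 / (1 - c)"
  have e: "0 < e" "e < 1" "0 < - c * e" "- c * e < 1"
    using c by (auto simp: e_def field_simps mult_less_0_iff)
  have "fst (vertex D (Suc k)) = fst (vertex D k) + dir k"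
    by (simp add: dir_def)
  then have "proj D (real (Suc k) + e) = proj D (real k + (1 + c * e))"
    using e by (simp only: proj_edge less_imp_le) (simp add: proj_edge assms algebra_simps)
  moreover have "\<not> same_param (real (Suc k) + e) (real k + (1 + c * e))"
    using e by (intro not_same_param) auto
  moreover have "cross (direction D (real (Suc k) + e)) (direction D (real k + (1 + c * e))) = 0"
    using e by (simp only: direction_edge) (simp add: direction_edge assms)
  ultimately show False
    using double_point[of "real (Suc k) + e" "real k + (1 + c * e)"] e by auto
qed

text \<open>The edges avoiding \<open>z\<close> form a compact set at positive distance from
  \<open>z\<close>, so near \<open>z\<close> the shadow consists of pieces of edges through
  \<open>z\<close>. For \<open>z\<close> off the shadow there are none, whence the shadow is
  closed.\<close>

lemma shadow_near:
  obtains r where "r > 0"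
    "\<And>w. w \<in> shadow \<Longrightarrow> dist z w < r \<Longrightarrow>
      \<exists>k a b. 0 \<le> a \<and> a \<le> 1 \<and> 0 \<le> b \<and> b \<le> 1 \<and> z = proj D (real k + a) \<and> w = proj D (real k + b)"
proof -
  define seg where "seg k = (\<lambda>a. fst (vertex D k) + a *\<^sub>R dir k) ` {0..1}" for k
  define S where "S = (\<Union>k\<in>{k. k < length D \<and> z \<notin> seg k}. seg k)"
  have "compact (seg k)" for k
    unfolding seg_def by (intro compact_continuous_image continuous_intros) auto
  then have "closed S"
    unfolding S_def by (intro closed_UN) (auto intro: compact_imp_closed)
  moreover have "z \<in> - S"
    by (auto simp: S_def)
  ultimately obtain r where r: "r > 0" "ball z r \<subseteq> - S"
    using open_contains_ball[of "- S"] by (auto simp: closed_def)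
  show ?thesis
  proof (rule that[OF r(1)])
    fix w assume w: "w \<in> shadow" "dist z w < r"
    then obtain t where t: "t \<in> params D" "w = proj D t"
      by auto
    obtain k b where k: "t = real k + b" "0 \<le> b" "b < 1"
      using nonneg_edge[OF params_nonneg[OF t(1)]] .
    have "k < length D"
      using t(1) k by (simp add: params_def)
    moreover have wb: "w = fst (vertex D k) + b *\<^sub>R dir k"
      using t k by (simp add: proj_edge)
    then have "w \<in> seg k"
      unfolding seg_def using k by (intro image_eqI[of _ _ b]) auto
    moreover have "w \<notin> S"
      using r w by auto
    ultimately have "z \<in> seg k"
      by (auto simp: S_def)
    then obtain a where "0 \<le> a" "a \<le> 1" "z = fst (vertex D k) + a *\<^sub>R dir k"
      by (auto simp: seg_def)
    then show "\<exists>k a b. 0 \<le> a \<and> a \<le> 1 \<and> 0 \<le> b \<and> b \<le> 1 \<and> z = proj D (real k + a) \<and> w = proj D (real k + b)"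
      using k wb by (intro exI[of _ k] exI[of _ a] exI[of _ b]) (auto simp: proj_edge)
  qed
qed

lemma closed_shadow: "closed shadow"
proof -
  have "\<exists>r>0. ball z r \<subseteq> - shadow" if z: "z \<notin> shadow" for z
  proof -
    obtain r where r: "r > 0" "\<And>w. w \<in> shadow \<Longrightarrow> dist z w < r \<Longrightarrow>
      \<exists>k a b. 0 \<le> a \<and> a \<le> 1 \<and> 0 \<le> b \<and> b \<le> 1 \<and> z = proj D (real k + a) \<and> w = proj D (real k + b)"
      using shadow_near[of z] by blast
    have "w \<notin> shadow" if "dist z w < r" for w
      using r(2)[of w] that z proj_in_shadow by (metis add_nonneg_nonneg of_nat_0_le_iff)
    then have "ball z r \<subseteq> - shadow"
      unfolding subset_iff mem_ball by blast
    then show ?thesis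
      using r(1) by blast
  qed
  then show ?thesis
    unfolding closed_def open_contains_ball by auto
qed

lemma germ_right:
  assumes "0 \<le> t0"
  shows "\<forall>\<^sub>F t in at_right t0. proj D t = proj D t0 + (t - t0) *\<^sub>R direction D t0 \<and> direction D t = direction D t0"
proof -
  obtain k a where k: "t0 = real k + a" "0 \<le> a" "a < 1"
    using nonneg_edge[OF assms] .
  have "\<forall>\<^sub>F t in at_right t0. t \<in> {t0<..<real k + 1}"
    using k by (intro eventually_at_right_real) auto
  then show ?thesis
  proof eventually_elim
    case (elim t)
    then have "t = real k + (t - real k)" "0 \<le> t - real k" "t - real k < 1"
      using k by auto
    then have "proj D t = fst (vertex D k) + (t - real k) *\<^sub>R dir k" "direction D t = dir k"
      by (metis proj_edge less_imp_le) (metis direction_edge \<open>0 \<le> t - real k\<close> \<open>t = real k + (t - real k)\<close> \<open>t - real k < 1\<close>)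
    moreover have "proj D t0 = fst (vertex D k) + a *\<^sub>R dir k" "direction D t0 = dir k"
      unfolding k(1) using k by (simp_all only: proj_edge less_imp_le direction_edge)
    ultimately show ?case
      using k(1) by (simp add: algebra_simps)
  qed
qed

text \<open>At a vertex \<open>direction\<close> is that of the edge starting there, so the incoming
  edge \<open>k\<close> must be named. The case \<open>a = 0\<close> is the vertex,
  \<open>a > 0\<close> an interior point of edge \<open>k\<close>.\<close>

lemma germ_left:
  assumes "0 \<le> a" "a < 1" "t0 = real (Suc k) - a"
  shows "\<forall>\<^sub>F t in at_left t0. proj D t = proj D t0 + (t - t0) *\<^sub>R dir k \<and> direction D t = dir k"
proof -
  have "\<forall>\<^sub>F t in at_left t0. t \<in> {real k<..<t0}"
    using assms by (intro eventually_at_left_real) auto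
  then show ?thesis
  proof eventually_elim
    case (elim t)
    then have t: "t = real k + (t - real k)" "0 \<le> t - real k" "t - real k < 1"
      using assms by auto
    have t0: "t0 = real k + (1 - a)"
      using assms by simp
    then have p0: "proj D t0 = fst (vertex D k) + (1 - a) *\<^sub>R dir k"
      unfolding t0 using assms by (intro proj_edge) auto
    have p: "proj D t = fst (vertex D k) + (t - real k) *\<^sub>R dir k" "direction D t = dir k"
      using t by (metis proj_edge less_imp_le) (metis direction_edge t)
    have dt: "t - t0 = (t - real k) - (1 - a)"
      using assms(3) by simp
    show ?case
      unfolding dt p0 p by (simp add: algebra_simps)
  qed
qed

end

section \<open>Oblique boxes and the shadow near a crossing\<close>

lemma coordinates_small:
  fixes z a b :: plane
  assumes "0 < r"
  obtains d where "0 < d" "\<And>\<alpha> \<beta>. \<bar>\<alpha>\<bar> < d \<Longrightarrow> \<bar>\<beta>\<bar> < d \<Longrightarrow> dist z (z + \<alpha> *\<^sub>R a + \<beta> *\<^sub>R b) < r"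
proof -
  define d where "d = r / (norm a + norm b + 1)"
  have n: "norm a + norm b + 1 > 0"
    by (simp add: add_nonneg_pos)
  have d: "0 < d"
    using assms n by (simp add: d_def)
  have dist_add: "dist z (z + x) = norm x" for x
    by (simp add: dist_norm)
  have "dist z (z + \<alpha> *\<^sub>R a + \<beta> *\<^sub>R b) < r" if "\<bar>\<alpha>\<bar> < d" "\<bar>\<beta>\<bar> < d" for \<alpha> \<beta>
  proof -
    have "dist z (z + \<alpha> *\<^sub>R a + \<beta> *\<^sub>R b) = norm (\<alpha> *\<^sub>R a + \<beta> *\<^sub>R b)"
      unfolding add.assoc by (rule dist_add)
    also have "\<dots> \<le> \<bar>\<alpha>\<bar> * norm a + \<bar>\<beta>\<bar> * norm b"
      using norm_triangle_ineq[of "\<alpha> *\<^sub>R a" "\<beta> *\<^sub>R b"] by simp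
    also have "\<dots> \<le> d * norm a + d * norm b"
      using that by (intro add_mono mult_right_mono) auto
    also have "\<dots> < d * (norm a + norm b + 1)"
      using d by (simp add: algebra_simps)
    also have "\<dots> = r"
      using n by (simp add: d_def)
    finally show ?thesis .
  qed
  with d show ?thesis
    using that by blast
qed

lemma convex_box:
  fixes z a b :: plane
  assumes "convex X" "convex Y"
  shows "convex {z + \<alpha> *\<^sub>R a + \<beta> *\<^sub>R b | \<alpha> \<beta>. \<alpha> \<in> X \<and> \<beta> \<in> Y}"
proof -
  define f :: "real \<times> real \<Rightarrow> plane" where "f = (\<lambda>x. fst x *\<^sub>R a + snd x *\<^sub>R b)"
  have "linear f"
    by (auto simp: f_def linear_iff algebra_simps)
  then have "convex ((+) z ` f ` (X \<times> Y))"
    using assms by (intro convex_translation convex_linear_image convex_Times)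
  also have "(+) z ` f ` (X \<times> Y) = {z + f (\<alpha>, \<beta>) | \<alpha> \<beta>. \<alpha> \<in> X \<and> \<beta> \<in> Y}"
    by blast
  also have "\<dots> = {z + \<alpha> *\<^sub>R a + \<beta> *\<^sub>R b | \<alpha> \<beta>. \<alpha> \<in> X \<and> \<beta> \<in> Y}"
    by (simp only: f_def fst_conv snd_conv add.assoc)
  finally show ?thesis .
qed

context knot_diagram
begin

lemma same_param_sym: "same_param s t \<Longrightarrow> same_param t s"
  unfolding same_param_def by (metis minus_diff_eq mult_minus_left of_int_minus)

text \<open>Since there are no triple points, an edge through the crossing passes it at the
  parameter \<open>s\<close> or \<open>t\<close>, and not at one of its ends because these
  parameters are not integers. So the nearby shadow lies on two lines, where one of the coordinates
  vanishes.\<close>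

lemma shadow_near_crossing:
  assumes st: "0 \<le> s" "0 \<le> t" "proj D s = proj D t" "\<not> same_param s t"
  obtains r where "0 < r" "\<And>\<alpha> \<beta>. \<bar>\<alpha>\<bar> < r \<Longrightarrow> \<bar>\<beta>\<bar> < r \<Longrightarrow> \<alpha> \<noteq> 0 \<Longrightarrow> \<beta> \<noteq> 0 \<Longrightarrow>
      proj D s + \<alpha> *\<^sub>R direction D s + \<beta> *\<^sub>R direction D t \<notin> shadow"
proof -
  let ?z = "proj D s" and ?u = "direction D s" and ?v = "direction D t"
  have nint: "s \<notin> \<int>" "t \<notin> \<int>" and c: "cross ?u ?v \<noteq> 0"
    using double_point[OF st(1-3)] st(4) by auto
  obtain r0 where r0: "r0 > 0" "\<And>w. w \<in> shadow \<Longrightarrow> dist ?z w < r0 \<Longrightarrow>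
      \<exists>k a b. 0 \<le> a \<and> a \<le> 1 \<and> 0 \<le> b \<and> b \<le> 1 \<and> ?z = proj D (real k + a) \<and> w = proj D (real k + b)"
    using shadow_near[of ?z] by blast
  obtain r where r: "0 < r" "\<And>\<alpha> \<beta>. \<bar>\<alpha>\<bar> < r \<Longrightarrow> \<bar>\<beta>\<bar> < r \<Longrightarrow> dist ?z (?z + \<alpha> *\<^sub>R ?u + \<beta> *\<^sub>R ?v) < r0"
    using coordinates_small[OF r0(1)] by blast
  have "?z + \<alpha> *\<^sub>R ?u + \<beta> *\<^sub>R ?v \<notin> shadow" if small: "\<bar>\<alpha>\<bar> < r" "\<bar>\<beta>\<bar> < r" "\<alpha> \<noteq> 0" "\<beta> \<noteq> 0" for \<alpha> \<beta>
  proof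
    assume w: "?z + \<alpha> *\<^sub>R ?u + \<beta> *\<^sub>R ?v \<in> shadow" (is "?w \<in> _")
    obtain k a b where k: "0 \<le> a" "a \<le> 1" "0 \<le> b" "b \<le> 1" "?z = proj D (real k + a)" "?w = proj D (real k + b)"
      using r0(2)[OF w r(2)[OF small(1,2)]] by blast
    have "0 \<le> real k + a"
      using k by simp
    then have "same_param s (real k + a) \<or> same_param t (real k + a)"
      using triple_point[OF st(1,2), of "real k + a"] st(3,4) k(5) by auto
    then have kd: "real k + a \<notin> \<int>" "direction D (real k + a) = ?u \<or> direction D (real k + a) = ?v"
      using same_param_imp[OF st(1) \<open>0 \<le> real k + a\<close>] same_param_imp[OF st(2) \<open>0 \<le> real k + a\<close>] nint by auto
    then have "a \<noteq> 1"
      by auto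
    then have "dir k = ?u \<or> dir k = ?v"
      using kd k by (simp add: direction_edge)
    moreover have "\<alpha> *\<^sub>R ?u + \<beta> *\<^sub>R ?v = (b - a) *\<^sub>R dir k"
    proof -
      have "?w = fst (vertex D k) + b *\<^sub>R dir k" "?z = fst (vertex D k) + a *\<^sub>R dir k"
        unfolding k(5,6) using k by (simp_all only: proj_edge)
      then show ?thesis
        by (simp add: algebra_simps)
    qed
    ultimately have "cross ?u (\<alpha> *\<^sub>R ?u + \<beta> *\<^sub>R ?v) = 0 \<or> cross (\<alpha> *\<^sub>R ?u + \<beta> *\<^sub>R ?v) ?v = 0"
      by auto
    then show False
      using c small(3,4) by simp
  qed
  from that[OF r(1) this] show ?thesis .
qed

end

section \<open>Two-valued functions off the shadow and their jumps across the curve\<close>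

locale knot_two_coloring = knot_diagram +
  fixes F :: "plane \<Rightarrow> bool"
  assumes F_convex: "convex K \<Longrightarrow> K \<inter> shadow = {} \<Longrightarrow> x \<in> K \<Longrightarrow> y \<in> K \<Longrightarrow> F x = F y"
begin

lemma F_box:
  assumes "convex X" "convex Y" and off_shadow: "\<And>\<alpha> \<beta>. \<alpha> \<in> X \<Longrightarrow> \<beta> \<in> Y \<Longrightarrow> z + \<alpha> *\<^sub>R a + \<beta> *\<^sub>R b \<notin> shadow"
  shows "\<exists>c. \<forall>\<alpha>\<in>X. \<forall>\<beta>\<in>Y. F (z + \<alpha> *\<^sub>R a + \<beta> *\<^sub>R b) = c"
proof -
  define K where "K = {z + \<alpha> *\<^sub>R a + \<beta> *\<^sub>R b | \<alpha> \<beta>. \<alpha> \<in> X \<and> \<beta> \<in> Y}"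
  have K: "convex K"
    unfolding K_def by (rule convex_box[OF assms(1,2)])
  have off: "K \<inter> shadow = {}"
    unfolding K_def using off_shadow by blast
  have mem: "z + \<alpha> *\<^sub>R a + \<beta> *\<^sub>R b \<in> K" if "\<alpha> \<in> X" "\<beta> \<in> Y" for \<alpha> \<beta>
    unfolding K_def using that by blast
  show ?thesis
  proof (cases "\<exists>\<alpha>0 \<beta>0. \<alpha>0 \<in> X \<and> \<beta>0 \<in> Y")
    case True
    then obtain \<alpha>0 \<beta>0 where "\<alpha>0 \<in> X" "\<beta>0 \<in> Y"
      by blast
    then have "\<forall>\<alpha>\<in>X. \<forall>\<beta>\<in>Y. F (z + \<alpha> *\<^sub>R a + \<beta> *\<^sub>R b) = F (z + \<alpha>0 *\<^sub>R a + \<beta>0 *\<^sub>R b)"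
      by (intro ballI F_convex[OF K off] mem)
    then show ?thesis
      by (rule exI)
  qed blast
qed

text \<open>Local picture of \<open>F\<close> at \<open>z\<close> in the oblique coordinates of
  \<open>a\<close> and \<open>b\<close>; the letters give the signs of the two coordinates. The axes
  are left out because they may belong to the curve. The last conjunct provides points off the
  shadow arbitrarily close to \<open>z\<close>.\<close>

definition quadrants ::
    "plane \<Rightarrow> plane \<Rightarrow> plane \<Rightarrow> real \<Rightarrow> bool \<Rightarrow> bool \<Rightarrow> bool \<Rightarrow> bool \<Rightarrow> bool" where
  "quadrants z a b r pp pm mp mm \<longleftrightarrow> cross a b \<noteq> 0 \<and> 0 < r \<and>
     (\<forall>\<alpha> \<beta>. 0 < \<alpha> \<and> \<alpha> < r \<and> 0 < \<beta> \<and> \<beta> < r \<longrightarrow>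
        F (z + \<alpha> *\<^sub>R a + \<beta> *\<^sub>R b) = pp \<and> F (z + \<alpha> *\<^sub>R a - \<beta> *\<^sub>R b) = pm \<and>
        F (z - \<alpha> *\<^sub>R a + \<beta> *\<^sub>R b) = mp \<and> F (z - \<alpha> *\<^sub>R a - \<beta> *\<^sub>R b) = mm \<and>
        z + \<alpha> *\<^sub>R a + \<beta> *\<^sub>R b \<notin> shadow)"

lemma quadrantsI:
  assumes "cross a b \<noteq> 0" "0 < r"
    and off: "\<And>\<alpha> \<beta>. \<bar>\<alpha>\<bar> < r \<Longrightarrow> \<bar>\<beta>\<bar> < r \<Longrightarrow> \<alpha> \<noteq> 0 \<Longrightarrow> \<beta> \<noteq> 0 \<Longrightarrow> z + \<alpha> *\<^sub>R a + \<beta> *\<^sub>R b \<notin> shadow"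
  obtains pp pm mp mm where "quadrants z a b r pp pm mp mm"
proof -
  have off': "z + \<alpha> *\<^sub>R a + \<beta> *\<^sub>R b \<notin> shadow"
    if "\<alpha> \<in> {0<..<r} \<union> {-r<..<0}" "\<beta> \<in> {0<..<r} \<union> {-r<..<0}" for \<alpha> \<beta>
    using that by (intro off) auto
  obtain pp where pp: "\<forall>\<alpha>\<in>{0<..<r}. \<forall>\<beta>\<in>{0<..<r}. F (z + \<alpha> *\<^sub>R a + \<beta> *\<^sub>R b) = pp"
    using F_box[of "{0<..<r}" "{0<..<r}" z a b] off' by auto
  obtain pm where pm: "\<forall>\<alpha>\<in>{0<..<r}. \<forall>\<beta>\<in>{-r<..<0}. F (z + \<alpha> *\<^sub>R a + \<beta> *\<^sub>R b) = pm"
    using F_box[of "{0<..<r}" "{-r<..<0}" z a b] off' by auto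
  obtain mp where mp: "\<forall>\<alpha>\<in>{-r<..<0}. \<forall>\<beta>\<in>{0<..<r}. F (z + \<alpha> *\<^sub>R a + \<beta> *\<^sub>R b) = mp"
    using F_box[of "{-r<..<0}" "{0<..<r}" z a b] off' by auto
  obtain mm where mm: "\<forall>\<alpha>\<in>{-r<..<0}. \<forall>\<beta>\<in>{-r<..<0}. F (z + \<alpha> *\<^sub>R a + \<beta> *\<^sub>R b) = mm"
    using F_box[of "{-r<..<0}" "{-r<..<0}" z a b] off' by auto
  have "quadrants z a b r pp pm mp mm"
    unfolding quadrants_def
  proof (intro conjI allI impI; (elim conjE)?)
    fix \<alpha> \<beta> :: real
    assume ab: "0 < \<alpha>" "\<alpha> < r" "0 < \<beta>" "\<beta> < r"
    show "F (z + \<alpha> *\<^sub>R a + \<beta> *\<^sub>R b) = pp"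
      using pp ab by simp
    show "F (z + \<alpha> *\<^sub>R a - \<beta> *\<^sub>R b) = pm"
      using pm[rule_format, of \<alpha> "- \<beta>"] ab by simp
    show "F (z - \<alpha> *\<^sub>R a + \<beta> *\<^sub>R b) = mp"
      using mp[rule_format, of "- \<alpha>" \<beta>] ab by simp
    show "F (z - \<alpha> *\<^sub>R a - \<beta> *\<^sub>R b) = mm"
      using mm[rule_format, of "- \<alpha>" "- \<beta>"] ab by simp
    show "z + \<alpha> *\<^sub>R a + \<beta> *\<^sub>R b \<notin> shadow"
      using off' ab by simp
  qed (use assms in auto)
  then show ?thesis
    using that by blast
qed

lemma quadrants_D:
  assumes "quadrants z a b r pp pm mp mm" "0 < \<alpha>" "\<alpha> < r" "0 < \<beta>" "\<beta> < r"
  shows "F (z + \<alpha> *\<^sub>R a + \<beta> *\<^sub>R b) = pp" "F (z + \<alpha> *\<^sub>R a - \<beta> *\<^sub>R b) = pm"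
    "F (z - \<alpha> *\<^sub>R a + \<beta> *\<^sub>R b) = mp" "F (z - \<alpha> *\<^sub>R a - \<beta> *\<^sub>R b) = mm"
  using assms unfolding quadrants_def by blast+

lemma quadrants_pos: "quadrants z a b r pp pm mp mm \<Longrightarrow> 0 < r"
  by (simp add: quadrants_def)

lemma jump_right:
  assumes q: "quadrants (proj D t0) (direction D t0) b r pp pm mp mm" and "0 \<le> t0"
  shows "\<forall>\<^sub>F t in at_right t0. jump F (proj D t) (direction D t) = (pp \<noteq> pm)"
proof -
  have "\<forall>\<^sub>F t in at_right t0. t \<in> {t0<..<t0 + r}"
    using quadrants_pos[OF q] by (intro eventually_at_right_real) auto
  with germ_right[OF assms(2)] show ?thesis
  proof eventually_elim
    case (elim t)
    have "jump F (proj D t0 + (t - t0) *\<^sub>R direction D t0) (1 *\<^sub>R direction D t0) = (pp \<noteq> pm)"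
      by (rule jump_iff[where r=r and b=b]) (use q elim quadrants_D[OF q] in \<open>auto simp: quadrants_def\<close>)
    then show ?case
      using elim by simp
  qed
qed

lemma jump_left:
  assumes q: "quadrants (proj D t0) (dir k) b r pp pm mp mm" and a: "0 \<le> a" "a < 1" "t0 = real (Suc k) - a"
  shows "\<forall>\<^sub>F t in at_left t0. jump F (proj D t) (direction D t) = (mp \<noteq> mm)"
proof -
  have "\<forall>\<^sub>F t in at_left t0. t \<in> {t0 - r<..<t0}"
    using quadrants_pos[OF q] by (intro eventually_at_left_real) auto
  with germ_left[OF a] show ?thesis
  proof eventually_elim
    case (elim t)
    \<comment> \<open>Before \<open>t0\<close> the curve lies on the ray opposite to
      \<open>dir k\<close>; the factor \<open>- 1\<close> restores its orientation.\<close>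
    have "jump F (proj D t0 + (t0 - t) *\<^sub>R (- dir k)) ((- 1) *\<^sub>R (- dir k)) = (mp \<noteq> mm)"
      by (rule jump_iff[where r=r and b=b]) (use q elim quadrants_D[OF q] in \<open>auto simp: quadrants_def\<close>)
    moreover have "proj D t0 + (t0 - t) *\<^sub>R (- dir k) = proj D t"
      using elim by (simp add: algebra_simps)
    ultimately have "jump F (proj D t) ((- 1) *\<^sub>R (- dir k)) = (mp \<noteq> mm)"
      by simp
    then show ?case
      using elim by simp
  qed
qed

text \<open>\<open>pp\<close> and \<open>pm\<close> are the two sides of the curve after
  \<open>t0\<close>, \<open>mp\<close> and \<open>mm\<close> those before it. At a crossing,
  \<open>eq\<close> is the colouring relation modulo 2: it says that the jump survives the passage
  through the other strand.\<close>

lemma jump_interior: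
  assumes q: "quadrants (proj D t0) (direction D t0) b r pp pm mp mm"
    and t0: "0 < t0" "t0 \<notin> \<int>" and eq: "(pp \<noteq> pm) = (mp \<noteq> mm)"
  shows "\<forall>\<^sub>F t in at t0. jump F (proj D t) (direction D t) = (pp \<noteq> pm)"
proof -
  obtain k a where k: "t0 = real k + a" "0 \<le> a" "a < 1"
    using nonneg_edge[OF less_imp_le[OF t0(1)]] .
  have "a \<noteq> 0"
    using k t0(2) by auto
  have "direction D t0 = dir k"
    unfolding k(1) using k by (intro direction_edge)
  then have "\<forall>\<^sub>F t in at_left t0. jump F (proj D t) (direction D t) = (mp \<noteq> mm)"
    using q k \<open>a \<noteq> 0\<close> by (intro jump_left[of t0 k b r pp pm mp mm "1 - a"]) auto
  moreover have "\<forall>\<^sub>F t in at_right t0. jump F (proj D t) (direction D t) = (pp \<noteq> pm)"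
    using q t0 by (intro jump_right) auto
  ultimately show ?thesis
    using eq by (simp add: eventually_at_split)
qed

text \<open>The open strips on the two sides of the line are convex and miss the curve, so each
  carries a single value.\<close>

lemma quadrants_line:
  assumes "u \<noteq> 0" "0 < r0"
    and near: "\<And>w. w \<in> shadow \<Longrightarrow> dist z w < r0 \<Longrightarrow> cross (w - z) u = 0"
  obtains r A B where "quadrants z u (rot u) r A B A B"
proof -
  have c: "cross u (rot u) \<noteq> 0"
    using cross_rot[OF assms(1)] by simp
  obtain r where r: "0 < r" "\<And>\<alpha> \<beta>. \<bar>\<alpha>\<bar> < r \<Longrightarrow> \<bar>\<beta>\<bar> < r \<Longrightarrow> dist z (z + \<alpha> *\<^sub>R u + \<beta> *\<^sub>R rot u) < r0"
    using coordinates_small[OF assms(2)] by blast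
  have off: "z + \<alpha> *\<^sub>R u + \<beta> *\<^sub>R rot u \<notin> shadow" if "\<bar>\<alpha>\<bar> < r" "\<bar>\<beta>\<bar> < r" "\<beta> \<noteq> 0" for \<alpha> \<beta>
    using near[of "z + \<alpha> *\<^sub>R u + \<beta> *\<^sub>R rot u"] r(2)[OF that(1,2)] that(3) c cross_swap[of u "rot u"]
    by (auto simp: add.assoc)
  have "\<exists>pp pm mp mm. quadrants z u (rot u) r pp pm mp mm"
    by (rule quadrantsI[OF c r(1) off]) auto
  then obtain pp pm mp mm where q: "quadrants z u (rot u) r pp pm mp mm"
    by auto
  have "\<exists>c. \<forall>\<alpha>\<in>{-r<..<r}. \<forall>\<beta>\<in>{0<..<r}. F (z + \<alpha> *\<^sub>R u + \<beta> *\<^sub>R rot u) = c"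
    by (intro F_box off) auto
  then obtain A where A: "\<forall>\<alpha>\<in>{-r<..<r}. \<forall>\<beta>\<in>{0<..<r}. F (z + \<alpha> *\<^sub>R u + \<beta> *\<^sub>R rot u) = A"
    by auto
  have "\<exists>c. \<forall>\<alpha>\<in>{-r<..<r}. \<forall>\<beta>\<in>{-r<..<0}. F (z + \<alpha> *\<^sub>R u + \<beta> *\<^sub>R rot u) = c"
    by (intro F_box off) auto
  then obtain B where B: "\<forall>\<alpha>\<in>{-r<..<r}. \<forall>\<beta>\<in>{-r<..<0}. F (z + \<alpha> *\<^sub>R u + \<beta> *\<^sub>R rot u) = B"
    by auto
  have r2: "0 < r / 2" "r / 2 < r"
    using r(1) by auto
  have "mp = pp"
    using quadrants_D(1,3)[OF q r2 r2] A[rule_format, of "r / 2" "r / 2"] A[rule_format, of "- (r / 2)" "r / 2"] r(1)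
    by simp
  moreover have "mm = pm"
    using quadrants_D(2,4)[OF q r2 r2] B[rule_format, of "r / 2" "- (r / 2)"]
      B[rule_format, of "- (r / 2)" "- (r / 2)"] r(1)
    by simp
  ultimately show ?thesis
    using q that by simp
qed

text \<open>The curve arrives through the ray of \<open>- u\<close> and leaves along
  \<open>v\<close>, so it misses the rays of \<open>u\<close> and \<open>- v\<close>. Boxes across
  these two rays join three of the quadrants; only \<open>mp\<close>, between \<open>- u\<close> and
  \<open>v\<close>, can differ.\<close>

lemma quadrants_corner:
  assumes c: "cross u v \<noteq> 0" and "0 < r0"
    and near: "\<And>w. w \<in> shadow \<Longrightarrow> dist z w < r0 \<Longrightarrow>
      (\<exists>\<theta>\<ge>0. w - z = - (\<theta> *\<^sub>R u)) \<or> (\<exists>\<theta>\<ge>0. w - z = \<theta> *\<^sub>R v)"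
  obtains r p q where "quadrants z u v r p p q p"
proof -
  obtain r where r: "0 < r" "\<And>\<alpha> \<beta>. \<bar>\<alpha>\<bar> < r \<Longrightarrow> \<bar>\<beta>\<bar> < r \<Longrightarrow> dist z (z + \<alpha> *\<^sub>R u + \<beta> *\<^sub>R v) < r0"
    using coordinates_small[OF assms(2)] by blast
  have off: "z + \<alpha> *\<^sub>R u + \<beta> *\<^sub>R v \<notin> shadow"
    if "\<bar>\<alpha>\<bar> < r" "\<bar>\<beta>\<bar> < r" "\<alpha> > 0 \<or> \<beta> < 0 \<or> \<alpha> \<noteq> 0 \<and> \<beta> \<noteq> 0" for \<alpha> \<beta>
  proof
    assume "z + \<alpha> *\<^sub>R u + \<beta> *\<^sub>R v \<in> shadow"
    from near[OF this r(2)[OF that(1,2)]]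
    obtain \<theta> where \<theta>: "\<theta> \<ge> 0" "\<alpha> *\<^sub>R u + \<beta> *\<^sub>R v = - (\<theta> *\<^sub>R u) \<or> \<alpha> *\<^sub>R u + \<beta> *\<^sub>R v = \<theta> *\<^sub>R v"
      by (auto simp: add.assoc)
    from \<theta>(2) show False
    proof
      assume e: "\<alpha> *\<^sub>R u + \<beta> *\<^sub>R v = - (\<theta> *\<^sub>R u)"
      have "\<beta> * cross u v = 0" "\<alpha> * cross u v = - \<theta> * cross u v"
        using arg_cong[OF e, of "cross u"] arg_cong[OF e, of "\<lambda>w. cross w v"] by auto
      then have "\<beta> = 0" "(\<alpha> + \<theta>) * cross u v = 0"
        using c by (simp_all add: algebra_simps)
      then show False
        using c that(3) \<theta>(1) by auto
    next
      assume e: "\<alpha> *\<^sub>R u + \<beta> *\<^sub>R v = \<theta> *\<^sub>R v"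
      have "\<beta> * cross u v = \<theta> * cross u v" "\<alpha> * cross u v = 0"
        using arg_cong[OF e, of "cross u"] arg_cong[OF e, of "\<lambda>w. cross w v"] by auto
      then show False
        using c that(3) \<theta>(1) by auto
    qed
  qed
  have "\<exists>pp pm mp mm. quadrants z u v r pp pm mp mm"
    by (rule quadrantsI[OF c r(1) off]) auto
  then obtain pp pm mp mm where q: "quadrants z u v r pp pm mp mm"
    by auto
  have "\<exists>c. \<forall>\<alpha>\<in>{0<..<r}. \<forall>\<beta>\<in>{-r<..<r}. F (z + \<alpha> *\<^sub>R u + \<beta> *\<^sub>R v) = c"
    by (intro F_box off) auto
  then obtain A where A: "\<forall>\<alpha>\<in>{0<..<r}. \<forall>\<beta>\<in>{-r<..<r}. F (z + \<alpha> *\<^sub>R u + \<beta> *\<^sub>R v) = A"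
    by auto
  have "\<exists>c. \<forall>\<alpha>\<in>{-r<..<r}. \<forall>\<beta>\<in>{-r<..<0}. F (z + \<alpha> *\<^sub>R u + \<beta> *\<^sub>R v) = c"
    by (intro F_box off) auto
  then obtain B where B: "\<forall>\<alpha>\<in>{-r<..<r}. \<forall>\<beta>\<in>{-r<..<0}. F (z + \<alpha> *\<^sub>R u + \<beta> *\<^sub>R v) = B"
    by auto
  have r2: "0 < r / 2" "r / 2 < r"
    using r(1) by auto
  have "pm = pp"
    using quadrants_D(1,2)[OF q r2 r2] A[rule_format, of "r / 2" "r / 2"] A[rule_format, of "r / 2" "- (r / 2)"] r(1)
    by simp
  moreover have "mm = pm"
    using quadrants_D(2,4)[OF q r2 r2] B[rule_format, of "r / 2" "- (r / 2)"]
      B[rule_format, of "- (r / 2)" "- (r / 2)"] r(1)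
    by simp
  ultimately show ?thesis
    using q that by simp
qed

lemma quadrants_swap:
  assumes q: "quadrants z a b r pp pm mp mm"
  shows "quadrants z b a r pp mp pm mm"
  unfolding quadrants_def
proof (intro conjI allI impI; (elim conjE)?)
  fix \<alpha> \<beta> :: real
  assume ab: "0 < \<alpha>" "\<alpha> < r" "0 < \<beta>" "\<beta> < r"
  have e: "z + \<alpha> *\<^sub>R b + \<beta> *\<^sub>R a = z + \<beta> *\<^sub>R a + \<alpha> *\<^sub>R b" "z + \<alpha> *\<^sub>R b - \<beta> *\<^sub>R a = z - \<beta> *\<^sub>R a + \<alpha> *\<^sub>R b"
    "z - \<alpha> *\<^sub>R b + \<beta> *\<^sub>R a = z + \<beta> *\<^sub>R a - \<alpha> *\<^sub>R b" "z - \<alpha> *\<^sub>R b - \<beta> *\<^sub>R a = z - \<beta> *\<^sub>R a - \<alpha> *\<^sub>R b"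
    by (simp_all add: algebra_simps)
  show "F (z + \<alpha> *\<^sub>R b + \<beta> *\<^sub>R a) = pp" "F (z + \<alpha> *\<^sub>R b - \<beta> *\<^sub>R a) = mp"
    "F (z - \<alpha> *\<^sub>R b + \<beta> *\<^sub>R a) = pm" "F (z - \<alpha> *\<^sub>R b - \<beta> *\<^sub>R a) = mm"
    unfolding e by (rule quadrants_D[OF q ab(3,4,1,2)])+
  show "z + \<alpha> *\<^sub>R b + \<beta> *\<^sub>R a \<notin> shadow"
    unfolding e using q ab unfolding quadrants_def by blast
qed (use q cross_swap[of a b] in \<open>auto simp: quadrants_def\<close>)

lemma quadrants_crossing:
  assumes st: "0 \<le> s" "0 \<le> t" "proj D s = proj D t" "\<not> same_param s t"
  obtains r pp pm mp mm where "quadrants (proj D s) (direction D s) (direction D t) r pp pm mp mm"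
proof -
  obtain r where r: "0 < r" "\<And>\<alpha> \<beta>. \<bar>\<alpha>\<bar> < r \<Longrightarrow> \<bar>\<beta>\<bar> < r \<Longrightarrow> \<alpha> \<noteq> 0 \<Longrightarrow> \<beta> \<noteq> 0 \<Longrightarrow>
      proj D s + \<alpha> *\<^sub>R direction D s + \<beta> *\<^sub>R direction D t \<notin> shadow"
    using shadow_near_crossing[OF st] by blast
  have c: "cross (direction D s) (direction D t) \<noteq> 0"
    using double_point[OF st(1-3)] st(4) by auto
  from quadrantsI[OF c r]
  obtain pp pm mp mm where "quadrants (proj D s) (direction D s) (direction D t) r pp pm mp mm" .
  then show ?thesis
    by (rule that)
qed

text \<open>Away from double points the jump persists for geometric reasons alone, and where there
  is no jump the four quadrants agree. The cases are the interior of an edge, a corner, and a vertex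
  between collinear edges.\<close>

lemma simple_point:
  assumes t0: "0 < t0" and simple: "\<And>s. 0 \<le> s \<Longrightarrow> proj D s = proj D t0 \<Longrightarrow> same_param t0 s"
  obtains a b r pp pm mp mm j where "quadrants (proj D t0) a b r pp pm mp mm"
    "\<forall>\<^sub>F t in at t0. jump F (proj D t) (direction D t) = j" "j \<or> pm = pp \<and> mp = pp \<and> mm = pp"
proof -
  let ?z = "proj D t0"
  obtain r0 where r0: "r0 > 0" "\<And>w. w \<in> shadow \<Longrightarrow> dist ?z w < r0 \<Longrightarrow>
      \<exists>k a b. 0 \<le> a \<and> a \<le> 1 \<and> 0 \<le> b \<and> b \<le> 1 \<and> ?z = proj D (real k + a) \<and> w = proj D (real k + b)"
    using shadow_near[of ?z] by blast
  have near: "\<exists>k a b. 0 \<le> a \<and> a \<le> 1 \<and> 0 \<le> b \<and> b \<le> 1 \<and> same_param t0 (real k + a) \<and> w - ?z = (b - a) *\<^sub>R dir k"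
    if w: "w \<in> shadow" "dist ?z w < r0" for w
  proof -
    obtain k a b where k: "0 \<le> a" "a \<le> 1" "0 \<le> b" "b \<le> 1" "?z = proj D (real k + a)" "w = proj D (real k + b)"
      using r0(2)[OF w] by blast
    have "w = fst (vertex D k) + b *\<^sub>R dir k" "?z = fst (vertex D k) + a *\<^sub>R dir k"
      unfolding k(5,6) using k(1-4) by (simp_all only: proj_edge)
    then have "w - ?z = (b - a) *\<^sub>R dir k"
      by (simp add: algebra_simps)
    moreover have "same_param t0 (real k + a)"
      by (rule simple) (use k(1) in simp, rule k(5)[symmetric])
    ultimately show ?thesis
      using k(1-4) by blast
  qed
  obtain n a0 where n: "t0 = real n + a0" "0 \<le> a0" "a0 < 1"
    using nonneg_edge[OF less_imp_le[OF t0]] .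
  show ?thesis
  proof (cases "t0 \<in> \<int>")
    case False
    have dt: "direction D t0 = dir n"
      unfolding n(1) using n by (intro direction_edge)
    have line: "cross (w - ?z) (direction D t0) = 0" if w: "w \<in> shadow" "dist ?z w < r0" for w
    proof -
      obtain k a b where k: "0 \<le> a" "a \<le> 1" "same_param t0 (real k + a)" "w - ?z = (b - a) *\<^sub>R dir k"
        using near[OF w] by blast
      have k0: "0 \<le> real k + a"
        using k by simp
      have "real k + a \<notin> \<int>"
        using same_param_imp(3)[OF less_imp_le[OF t0] k0 k(3)] False by simp
      then have "a \<noteq> 1"
        by auto
      then have "direction D t0 = dir k"
        using same_param_imp(2)[OF less_imp_le[OF t0] k0 k(3)] k by (simp add: direction_edge)
      then show ?thesis
        unfolding k(4) by simp
    qed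
    have "direction D t0 \<noteq> 0"
      unfolding dt by (rule dir_nonzero)
    from quadrants_line[OF this r0(1) line]
    obtain r A B where q: "quadrants ?z (direction D t0) (rot (direction D t0)) r A B A B" .
    show ?thesis
      by (rule that[OF q jump_interior[OF q t0 False refl]]) auto
  next
    case True
    obtain i :: int where "t0 = of_int i"
      using True by (auto elim: Ints_cases)
    moreover define j where "j = i - int n"
    ultimately have j: "a0 = of_int j"
      using n(1) by simp
    then have "j = 0"
      using n(2,3) by simp
    then have "a0 = 0"
      using j by simp
    then obtain m where m: "n = Suc m" "t0 = real (Suc m)"
      using n t0 by (cases n) auto
    have dt: "direction D t0 = dir (Suc m)"
      using direction_edge[of 0 "Suc m"] m by simp
    have near': "(\<exists>\<theta>\<ge>0. w - ?z = - (\<theta> *\<^sub>R dir m)) \<or> (\<exists>\<theta>\<ge>0. w - ?z = \<theta> *\<^sub>R dir (Suc m))"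
      if w: "w \<in> shadow" "dist ?z w < r0" for w
    proof -
      obtain k a b where k: "0 \<le> a" "a \<le> 1" "0 \<le> b" "b \<le> 1" "same_param t0 (real k + a)" "w - ?z = (b - a) *\<^sub>R dir k"
        using near[OF w] by blast
      have k0: "0 \<le> real k + a"
        using k by simp
      have "real k + a \<in> \<int>"
        using same_param_imp(3)[OF less_imp_le[OF t0] k0 k(5)] True by simp
      then have "real k + a - real k \<in> \<int>"
        by (intro Ints_diff) auto
      then obtain i :: int where "a = of_int i"
        by (auto elim: Ints_cases)
      moreover from this have "i = 0 \<or> i = 1"
        using k(1,2) by auto
      ultimately consider "a = 0" | "a = 1"
        by auto
      then show ?thesis
      proof cases
        case 1
        then have "direction D (real k + a) = dir k"
          using k by (intro direction_edge) auto
        then have "dir k = dir (Suc m)"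
          using same_param_imp(2)[OF less_imp_le[OF t0] k0 k(5)] dt by simp
        then show ?thesis
          using k 1 by auto
      next
        case 2
        obtain i :: int where "t0 - (real k + 1) = of_int i * real (length D)"
          using k(5) 2 by (auto simp: same_param_def)
        \<comment> \<open>The direction at a vertex is that of the following edge, so the edges
          \<open>k\<close> and \<open>m\<close> ending here are compared at their midpoints.\<close>
        then have "real m + 1 / 2 - (real k + 1 / 2) = of_int i * real (length D)"
          using m by simp
        then have "same_param (real m + 1 / 2) (real k + 1 / 2)"
          unfolding same_param_def by blast
        then have "direction D (real m + 1 / 2) = direction D (real k + 1 / 2)"
          by (intro same_param_imp) auto
        then have "dir k = dir m"
          by (simp add: direction_edge)
        moreover have "w - ?z = - ((1 - b) *\<^sub>R dir k)"
          using k(6) 2 by (simp add: algebra_simps)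
        ultimately show ?thesis
          using k(4) by (metis diff_ge_0_iff_ge)
      qed
    qed
    show ?thesis
    proof (cases "cross (dir m) (dir (Suc m)) = 0")
      case False
      from quadrants_corner[OF False r0(1) near']
      obtain r p q where Q: "quadrants ?z (dir m) (dir (Suc m)) r p p q p" .
      have Q': "quadrants ?z (direction D t0) (dir m) r p q p p"
        using quadrants_swap[OF Q] unfolding dt .
      have "\<forall>\<^sub>F t in at_left t0. jump F (proj D t) (direction D t) = (p \<noteq> q)"
        using jump_left[OF Q, of 0] m by (simp add: eq_commute[of p])
      moreover have "\<forall>\<^sub>F t in at_right t0. jump F (proj D t) (direction D t) = (p \<noteq> q)"
        using jump_right[OF Q'] t0 by simp
      ultimately have "\<forall>\<^sub>F t in at t0. jump F (proj D t) (direction D t) = (p \<noteq> q)"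
        by (auto simp: eventually_at_split)
      from that[OF Q this] show ?thesis
        by blast
    next
      case True
      have "cross (dir (Suc m)) (dir m) = 0"
        using True cross_swap[of "dir m" "dir (Suc m)"] by simp
      then obtain c where c: "dir (Suc m) = c *\<^sub>R dir m"
        using cross_eq_0_parallel dir_nonzero by metis
      have "c > 0"
        by (rule no_backtracking[OF c])
      have line: "cross (w - ?z) (dir m) = 0" if w: "w \<in> shadow" "dist ?z w < r0" for w
      proof -
        obtain d where "w - ?z = d *\<^sub>R dir m"
          using near'[OF w] c by (metis scaleR_minus_left scaleR_scaleR)
        then show ?thesis
          by (simp only: cross_simps mult_zero_right)
      qed
      from quadrants_line[OF dir_nonzero r0(1) line]
      obtain r A B where Q: "quadrants ?z (dir m) (rot (dir m)) r A B A B" .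
      \<comment> \<open>The next edge has direction \<open>c\<close> times the previous one. The
        smaller radius ensures that coordinates along it still fall into the box of
        \<open>Q\<close>.\<close>
      define r' where "r' = min r (r / c)"
      have r': "0 < r'" "r' \<le> r" "c * \<alpha> < r" if "\<alpha> < r'" for \<alpha>
        using quadrants_pos[OF Q] \<open>c > 0\<close> that by (auto simp: r'_def field_simps)
      have Q': "quadrants ?z (direction D t0) (rot (dir m)) r' A B A B"
        unfolding quadrants_def
      proof (intro conjI allI impI; (elim conjE)?)
        fix \<alpha> \<beta> :: real
        assume ab: "0 < \<alpha>" "\<alpha> < r'" "0 < \<beta>" "\<beta> < r'"
        have s: "\<alpha> *\<^sub>R direction D t0 = (c * \<alpha>) *\<^sub>R dir m"
          by (simp add: dt c)
        have "0 < c * \<alpha>" "c * \<alpha> < r" "0 < \<beta>" "\<beta> < r"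
          using ab r' \<open>c > 0\<close> by (auto intro: less_le_trans)
        note ca = this
        show "F (?z + \<alpha> *\<^sub>R direction D t0 + \<beta> *\<^sub>R rot (dir m)) = A"
          "F (?z + \<alpha> *\<^sub>R direction D t0 - \<beta> *\<^sub>R rot (dir m)) = B"
          "F (?z - \<alpha> *\<^sub>R direction D t0 + \<beta> *\<^sub>R rot (dir m)) = A"
          "F (?z - \<alpha> *\<^sub>R direction D t0 - \<beta> *\<^sub>R rot (dir m)) = B"
          unfolding s by (rule quadrants_D[OF Q ca])+
        show "?z + \<alpha> *\<^sub>R direction D t0 + \<beta> *\<^sub>R rot (dir m) \<notin> shadow"
          unfolding s using Q ca unfolding quadrants_def by blast
      qed (use r'(1)[of "r' - 1"] Q \<open>c > 0\<close> in \<open>auto simp: dt c quadrants_def\<close>)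
      have "\<forall>\<^sub>F t in at_left t0. jump F (proj D t) (direction D t) = (A \<noteq> B)"
        using jump_left[OF Q, of 0] m by simp
      moreover have "\<forall>\<^sub>F t in at_right t0. jump F (proj D t) (direction D t) = (A \<noteq> B)"
        using jump_right[OF Q'] t0 by simp
      ultimately have "\<forall>\<^sub>F t in at t0. jump F (proj D t) (direction D t) = (A \<noteq> B)"
        by (auto simp: eventually_at_split)
      from that[OF Q this] show ?thesis
        by blast
    qed
  qed
qed

end

context knot_two_coloring
begin

text \<open>A point off the shadow may lie on an axis, where \<open>quadrants\<close> says nothing.
  It is pushed slightly along \<open>a + b\<close> within a ball missing the shadow, which preserves
  \<open>F\<close> and leads into an open quadrant.\<close>

lemma quadrants_equal:
  assumes q: "quadrants z a b r c c c c"
  shows "\<forall>\<^sub>F w in at z. w \<in> - shadow \<longrightarrow> F w = c"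
proof -
  have ab: "cross a b \<noteq> 0" and r: "0 < r"
    using q by (auto simp: quadrants_def)
  have cont: "((\<lambda>w. \<bar>cross (w - z) b / cross a b\<bar>) \<longlongrightarrow> \<bar>cross (z - z) b / cross a b\<bar>) (at z)"
    "((\<lambda>w. \<bar>cross a (w - z) / cross a b\<bar>) \<longlongrightarrow> \<bar>cross a (z - z) / cross a b\<bar>) (at z)"
    using ab unfolding cross_def by (intro tendsto_intros; simp)+
  have "\<forall>\<^sub>F w in at z. \<bar>cross (w - z) b / cross a b\<bar> < r"
    by (rule order_tendstoD(2)[OF cont(1)]) (use r in simp)
  moreover have "\<forall>\<^sub>F w in at z. \<bar>cross a (w - z) / cross a b\<bar> < r"
    by (rule order_tendstoD(2)[OF cont(2)]) (use r in simp)
  ultimately show ?thesis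
  proof eventually_elim
    case (elim w)
    show ?case
    proof
      assume "w \<in> - shadow"
      then obtain e where e: "0 < e" "ball w e \<subseteq> - shadow"
        using closed_shadow unfolding closed_def open_contains_ball by blast
      obtain d where d: "0 < d" "\<And>\<alpha> \<beta>. \<bar>\<alpha>\<bar> < d \<Longrightarrow> \<bar>\<beta>\<bar> < d \<Longrightarrow> dist w (w + \<alpha> *\<^sub>R a + \<beta> *\<^sub>R b) < e"
        using coordinates_small[OF e(1)] by blast
      define \<alpha> where "\<alpha> = cross (w - z) b / cross a b"
      define \<beta> where "\<beta> = cross a (w - z) / cross a b"
      have w: "w = z + \<alpha> *\<^sub>R a + \<beta> *\<^sub>R b"
        using cross_expand[OF ab, of "w - z"] unfolding \<alpha>_def \<beta>_def by (simp add: algebra_simps)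
      have small: "\<bar>\<alpha>\<bar> < r" "\<bar>\<beta>\<bar> < r"
        using elim by (simp_all only: \<alpha>_def \<beta>_def)
      \<comment> \<open>Bounds for the push that keep a nonzero coordinate from reaching 0; a zero
        coordinate imposes no bound and gets the dummy value 1.\<close>
      define x where "x = (if \<alpha> = 0 then 1 else \<bar>\<alpha>\<bar>)"
      define y where "y = (if \<beta> = 0 then 1 else \<bar>\<beta>\<bar>)"
      have P: "\<forall>\<^sub>F e in at_right 0. e \<in> {0<..<t}" if "t > 0" for t :: real
        using that by (rule eventually_at_right_real)
      have "x > 0" "y > 0"
        by (auto simp: x_def y_def)
      from P[OF this(1)] P[OF this(2)]
      have "\<forall>\<^sub>F e in at_right 0. e \<in> {0<..<d} \<and> e \<in> {0<..<r - \<bar>\<alpha>\<bar>} \<and> e \<in> {0<..<r - \<bar>\<beta>\<bar>} \<and> e \<in> {0<..<x} \<and> e \<in> {0<..<y}"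
        using P[of d] P[of "r - \<bar>\<alpha>\<bar>"] P[of "r - \<bar>\<beta>\<bar>"] d(1) small by (intro eventually_conj) auto
      then obtain \<epsilon> where \<epsilon>: "0 < \<epsilon>" "\<epsilon> < d" "\<epsilon> < r - \<bar>\<alpha>\<bar>" "\<epsilon> < r - \<bar>\<beta>\<bar>" "\<epsilon> < x" "\<epsilon> < y"
        by (auto dest!: eventually_happens)
      have nz: "\<alpha> + \<epsilon> \<noteq> 0" "\<beta> + \<epsilon> \<noteq> 0" "\<bar>\<alpha> + \<epsilon>\<bar> < r" "\<bar>\<beta> + \<epsilon>\<bar> < r"
        using \<epsilon> unfolding x_def y_def by (auto split: if_splits)
      define w' where "w' = z + (\<alpha> + \<epsilon>) *\<^sub>R a + (\<beta> + \<epsilon>) *\<^sub>R b"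
      have "w' = w + \<epsilon> *\<^sub>R a + \<epsilon> *\<^sub>R b"
        unfolding w w'_def by (simp add: algebra_simps)
      then have "w' \<in> ball w e"
        using d(2)[of \<epsilon> \<epsilon>] \<epsilon> by simp
      then have "F w = F w'"
        using e by (intro F_convex[of "ball w e"]) auto
      also have "F w' = c"
      proof -
        have s: "(\<alpha> + \<epsilon>) *\<^sub>R a = - ((- (\<alpha> + \<epsilon>)) *\<^sub>R a)" "(\<beta> + \<epsilon>) *\<^sub>R b = - ((- (\<beta> + \<epsilon>)) *\<^sub>R b)"
          by (simp_all only: scaleR_minus_left minus_minus)
        consider "\<alpha> + \<epsilon> > 0" "\<beta> + \<epsilon> > 0" | "\<alpha> + \<epsilon> > 0" "\<beta> + \<epsilon> < 0" | "\<alpha> + \<epsilon> < 0" "\<beta> + \<epsilon> > 0"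
          | "\<alpha> + \<epsilon> < 0" "\<beta> + \<epsilon> < 0"
          using nz by linarith
        then show ?thesis
        proof cases
          case 1
          then show ?thesis
            unfolding w'_def using nz by (intro quadrants_D(1)[OF q]) auto
        next
          case 2
          then show ?thesis
            unfolding w'_def s(2) add_uminus_conv_diff using nz by (intro quadrants_D(2)[OF q]) auto
        next
          case 3
          then show ?thesis
            unfolding w'_def s(1) add_uminus_conv_diff using nz by (intro quadrants_D(3)[OF q]) auto
        next
          case 4
          then show ?thesis
            unfolding w'_def s add_uminus_conv_diff using nz by (intro quadrants_D(4)[OF q]) auto
        qed
      qed
      finally show "F w = c" .
    qed
  qed
qed

text \<open>The diagonal of the first quadrant tends to \<open>z\<close> and avoids the shadow. This
  is the density required by \<open>connected_generic_value\<close>.\<close>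

lemma quadrants_frequently:
  assumes q: "quadrants z a b r pp pm mp mm"
  shows "\<exists>\<^sub>F w in at z. w \<in> - shadow"
proof (rule ccontr)
  assume "\<not> (\<exists>\<^sub>F w in at z. w \<in> - shadow)"
  then have "\<forall>\<^sub>F w in at z. \<not> w \<in> - shadow"
    by (simp only: not_frequently)
  moreover have ab: "cross a b \<noteq> 0" and r: "0 < r"
    using q by (auto simp: quadrants_def)
  moreover have "filterlim (\<lambda>e. z + e *\<^sub>R a + e *\<^sub>R b) (at z) (at_right 0)"
  proof (rule filterlim_atI)
    show "((\<lambda>e. z + e *\<^sub>R a + e *\<^sub>R b) \<longlongrightarrow> z) (at_right 0)"
    proof -
      have "((\<lambda>e. z + e *\<^sub>R a + e *\<^sub>R b) \<longlongrightarrow> z + 0 *\<^sub>R a + 0 *\<^sub>R b) (at_right 0)"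
        by (intro tendsto_intros)
      then show ?thesis
        by simp
    qed
    show "\<forall>\<^sub>F e in at_right 0. z + e *\<^sub>R a + e *\<^sub>R b \<noteq> z"
      using eventually_at_right_less[of "0::real"]
    proof eventually_elim
      case (elim e)
      have "cross a (e *\<^sub>R a + e *\<^sub>R b) \<noteq> 0"
        using elim ab by simp
      then have "e *\<^sub>R a + e *\<^sub>R b \<noteq> 0"
        by (metis cross_simps(11))
      then show ?case
        by (simp add: add.assoc)
    qed
  qed
  ultimately have "\<forall>\<^sub>F e in at_right 0. \<not> z + e *\<^sub>R a + e *\<^sub>R b \<in> - shadow"
    by (auto simp: filterlim_iff)
  moreover have "\<forall>\<^sub>F e in at_right 0. e \<in> {0<..<r}"
    using r by (intro eventually_at_right_real) auto
  ultimately have "\<forall>\<^sub>F e in at_right (0::real). False"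
    by eventually_elim (use q in \<open>auto simp: quadrants_def\<close>)
  then show False
    by simp
qed

text \<open>The jump along the curve is one truth value. If it is true, both strands at a crossing
  separate different values, which is a checkerboard there. If it is false, \<open>F\<close> extends
  over the curve to a locally constant function on the plane and is constant off the shadow.\<close>

lemma two_coloring_dichotomy:
  assumes even: "\<And>s t r pp pm mp mm. 0 \<le> s \<Longrightarrow> 0 \<le> t \<Longrightarrow> proj D s = proj D t \<Longrightarrow> \<not> same_param s t \<Longrightarrow>
      quadrants (proj D s) (direction D s) (direction D t) r pp pm mp mm \<Longrightarrow> (pp \<noteq> pm) = (mp \<noteq> mm)"
  shows "(\<forall>x y. x \<notin> shadow \<longrightarrow> y \<notin> shadow \<longrightarrow> F x = F y) \<or>
    (\<forall>s t r pp pm mp mm. 0 \<le> s \<longrightarrow> 0 \<le> t \<longrightarrow> proj D s = proj D t \<longrightarrow> \<not> same_param s t \<longrightarrow>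
      quadrants (proj D s) (direction D s) (direction D t) r pp pm mp mm \<longrightarrow> pp = mm \<and> pm = mp \<and> pp \<noteq> pm)"
proof -
  define J where "J t = jump F (proj D t) (direction D t)" for t
  have crossing: "\<forall>\<^sub>F t' in at s. J t' = (pp \<noteq> pm)"
    if "0 \<le> s" "0 \<le> t" "proj D s = proj D t" "\<not> same_param s t"
      "quadrants (proj D s) (direction D s) (direction D t) r pp pm mp mm" for s t r pp pm mp mm
  proof -
    have "s \<notin> \<int>"
      using double_point[OF that(1-3)] that(4) by auto
    moreover from this have "s > 0"
      using that(1) by (cases "s = 0") auto
    ultimately show ?thesis
      unfolding J_def using jump_interior[OF that(5)] even[OF that] by blast
  qed
  have local: "\<exists>a b r pp pm mp mm j. quadrants (proj D t) a b r pp pm mp mm \<and> (\<forall>\<^sub>F t' in at t. J t' = j) \<and>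
      (j \<or> pm = pp \<and> mp = pp \<and> mm = pp \<or> (\<exists>s\<ge>0. proj D t = proj D s \<and> \<not> same_param t s \<and>
        a = direction D t \<and> b = direction D s \<and> j = (pp \<noteq> pm)))"
    if t: "t > 0" for t
  proof (cases "\<exists>s\<ge>0. proj D t = proj D s \<and> \<not> same_param t s")
    case True
    then obtain s where s: "0 \<le> s" "proj D t = proj D s" "\<not> same_param t s"
      by blast
    obtain r pp pm mp mm where q: "quadrants (proj D t) (direction D t) (direction D s) r pp pm mp mm"
      using quadrants_crossing[OF less_imp_le[OF t] s] .
    show ?thesis
      using q s crossing[OF less_imp_le[OF t] s q] by blast
  next
    case False
    then have "\<And>s. 0 \<le> s \<Longrightarrow> proj D s = proj D t \<Longrightarrow> same_param t s"
      by metis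
    from simple_point[OF t this] obtain a b r pp pm mp mm j where
      "quadrants (proj D t) a b r pp pm mp mm" "\<forall>\<^sub>F t' in at t. J t' = j" "j \<or> pm = pp \<and> mp = pp \<and> mm = pp"
      unfolding J_def .
    then show ?thesis
      by blast
  qed
  \<comment> \<open>A value on punctured neighbourhoods: at a corner or a crossing
    \<open>J t\<close> itself carries no information, only \<open>J\<close> around \<open>t\<close>
    does.\<close>
  define j where "j t = (SOME b. \<forall>\<^sub>F t' in at t. J t' = b)" for t
  have j: "\<forall>\<^sub>F t' in at t. J t' = j t" if "t > 0" for t
  proof -
    have "\<exists>b. \<forall>\<^sub>F t' in at t. J t' = b"
      using local[OF that] by blast
    then show ?thesis
      unfolding j_def by (rule someI_ex)
  qed
  have j_unique: "b = j t" if "t > 0" "\<forall>\<^sub>F t' in at t. J t' = b" for t b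
  proof -
    have "\<forall>\<^sub>F t' in at t. b = j t"
      using that(2) j[OF that(1)] by eventually_elim simp
    then show ?thesis
      by simp
  qed
  \<comment> \<open>This is where the curve must have one component: a single half-line of
    parameters reaches all of it.\<close>
  have j_const: "j s = j t" if "s > 0" "t > 0" for s t
  proof (rule connected_generic_value[of "{0<..}" UNIV J])
    show "\<exists>\<^sub>F y in at x. y \<in> UNIV" for x :: real
      by simp
  qed (use that j in auto)
  \<comment> \<open>The first equation follows the strand of \<open>s\<close> and the second that of
    \<open>t\<close>, obtained by exchanging the two coordinates.\<close>
  have crossing_j: "(pp \<noteq> pm) = j 1" "(pp \<noteq> mp) = j 1" "(pp \<noteq> pm) = (mp \<noteq> mm)"
    if "0 \<le> s" "0 \<le> t" "proj D s = proj D t" "\<not> same_param s t"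
      "quadrants (proj D s) (direction D s) (direction D t) r pp pm mp mm" for s t r pp pm mp mm
  proof -
    have "s \<notin> \<int>" "t \<notin> \<int>"
      using double_point[OF that(1-3)] that(4) by auto
    then have pos: "s > 0" "t > 0"
      using that(1,2) by (cases "s = 0"; cases "t = 0"; auto)+
    show "(pp \<noteq> pm) = j 1"
      using j_unique[OF pos(1) crossing[OF that]] j_const[OF pos(1), of 1] by simp
    have "\<not> same_param t s"
      using same_param_sym that(4) by blast
    moreover have "quadrants (proj D t) (direction D t) (direction D s) r pp mp pm mm"
      using quadrants_swap[OF that(5)] that(3) by simp
    ultimately have "\<forall>\<^sub>F t' in at t. J t' = (pp \<noteq> mp)"
      using that by (intro crossing[of t s]) auto
    then show "(pp \<noteq> mp) = j 1"
      using j_unique[OF pos(2)] j_const[OF pos(2), of 1] by simp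
    show "(pp \<noteq> pm) = (mp \<noteq> mm)"
      by (rule even[OF that])
  qed
  show ?thesis
  proof (cases "j 1")
    case True
    show ?thesis
    proof (intro disjI2 allI impI)
      fix s t r pp pm mp mm
      assume "0 \<le> s" "0 \<le> t" "proj D s = proj D t" "\<not> same_param s t"
        "quadrants (proj D s) (direction D s) (direction D t) r pp pm mp mm"
      from crossing_j[OF this] True show "pp = mm \<and> pm = mp \<and> pp \<noteq> pm"
        by blast
    qed
  next
    case False
    have on: "\<exists>a b r c. quadrants z a b r c c c c" if z: "z \<in> shadow" for z
    proof -
      \<comment> \<open>Adding one period makes the parameter positive, so that it has neighbours on
        both sides.\<close>
      obtain t where t: "t > 0" "z = proj D t"
      proof -
        obtain s where s: "s \<in> params D" "z = proj D s"
          using z by auto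
        have "proj D (s + real (1 * length D)) = z"
          using periodic(1)[OF params_nonneg[OF s(1)]] s(2) by metis
        moreover have "s + real (1 * length D) > 0"
          using params_nonneg[OF s(1)] length_ge_3 by simp
        ultimately show ?thesis
          using that by metis
      qed
      obtain a b r pp pm mp mm i where q: "quadrants (proj D t) a b r pp pm mp mm"
        and i: "\<forall>\<^sub>F t' in at t. J t' = i"
        and c: "i \<or> pm = pp \<and> mp = pp \<and> mm = pp \<or> (\<exists>s\<ge>0. proj D t = proj D s \<and> \<not> same_param t s \<and>
        a = direction D t \<and> b = direction D s \<and> i = (pp \<noteq> pm))"
        using local[OF t(1)] by blast
      have "\<not> i"
        using j_unique[OF t(1) i] j_const[OF t(1), of 1] False by simp
      have "pm = pp \<and> mp = pp \<and> mm = pp"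
        using c
      proof (elim disjE exE conjE)
        fix s
        assume s: "0 \<le> s" "proj D t = proj D s" "\<not> same_param t s" "a = direction D t" "b = direction D s"
        show ?thesis
          using crossing_j[OF less_imp_le[OF t(1)] s(1-3) q[unfolded s(4,5)]] False by blast
      qed (use \<open>\<not> i\<close> in auto)
      then show ?thesis
        using q t(2) by blast
    qed
    have off: "\<forall>\<^sub>F w in at z. w \<in> - shadow \<longrightarrow> F w = F z" "\<forall>\<^sub>F w in at z. w \<in> - shadow" if z: "z \<in> - shadow" for z
    proof -
      obtain e where e: "0 < e" "ball z e \<subseteq> - shadow"
        using closed_shadow z unfolding closed_def open_contains_ball by blast
      have "\<forall>\<^sub>F w in at z. w \<in> ball z e"
        using e(1) by (intro eventually_at_in_open') auto
      then show "\<forall>\<^sub>F w in at z. w \<in> - shadow \<longrightarrow> F w = F z"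
      proof eventually_elim
        case (elim w)
        have "F w = F z"
          by (rule F_convex[of "ball z e"]) (use elim e in \<open>auto simp del: mem_ball\<close>)
        then show ?case
          by blast
      qed
      show "\<forall>\<^sub>F w in at z. w \<in> - shadow"
        using \<open>\<forall>\<^sub>F w in at z. w \<in> ball z e\<close> by eventually_elim (use e in auto)
    qed
    have ex: "\<exists>c. \<forall>\<^sub>F w in at z. w \<in> - shadow \<longrightarrow> F w = c" for z
    proof (cases "z \<in> shadow")
      case True
      then show ?thesis
        using on[of z] quadrants_equal by blast
    next
      case False
      then show ?thesis
        using off(1)[of z] by blast
    qed
    have dense: "\<exists>\<^sub>F w in at z. w \<in> - shadow" for z
    proof (cases "z \<in> shadow")
      case True
      then show ?thesis
        using on quadrants_frequently by blast
    next
      case False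
      then show ?thesis
        using off(2)[of z] by (intro eventually_frequently) auto
    qed
    \<comment> \<open>\<open>c\<close> extends \<open>F\<close> over the shadow; connectedness of
      the plane makes it constant.\<close>
    define c where "c z = (SOME c. \<forall>\<^sub>F w in at z. w \<in> - shadow \<longrightarrow> F w = c)" for z
    have c: "\<forall>\<^sub>F w in at z. w \<in> - shadow \<longrightarrow> F w = c z" for z
      unfolding c_def using ex[of z] by (rule someI_ex)
    have c_const: "c x = c y" for x y
      by (rule connected_generic_value[of UNIV "- shadow" F]) (use c dense in auto)
    have Fc: "F x = c x" if x: "x \<in> - shadow" for x
    proof -
      have "\<forall>\<^sub>F w in at x. F x = c x"
        using off[OF x] c[of x] by eventually_elim simp
      then show ?thesis
        by simp
    qed
    show ?thesis
      using Fc c_const by (metis ComplI)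
  qed
qed

end

section \<open>Regions of a diagram and two-valued functions on them\<close>

context knot_diagram
begin

definition region :: "plane \<Rightarrow> plane set" where
  "region x = connected_component_set (- shadow) x"

lemma region_in_regions: "x \<notin> shadow \<Longrightarrow> region x \<in> regions D"
  unfolding region_def regions_def by (intro componentsI) simp

lemma region_unique: "X \<in> regions D \<Longrightarrow> x \<in> X \<Longrightarrow> region x = X"
  unfolding region_def regions_def by (metis components_iff connected_component_eq)

lemma mem_region: "x \<notin> shadow \<Longrightarrow> x \<in> region x"
  unfolding region_def by simp

lemma regions_off_shadow: "X \<in> regions D \<Longrightarrow> x \<in> X \<Longrightarrow> x \<notin> shadow"
  unfolding regions_def using in_components_subset by blast

lemma regions_cases:
  assumes "X \<in> regions D"
  obtains x where "x \<notin> shadow" "X = region x"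
  using assms in_components_nonempty region_unique regions_off_shadow unfolding regions_def
  by (metis ex_in_conv)

lemma region_connected:
  assumes "connected K" "K \<inter> shadow = {}" "x \<in> K" "y \<in> K"
  shows "region x = region y"
proof -
  have "connected_component (- shadow) x y"
    unfolding connected_component_def using assms by blast
  then show ?thesis
    unfolding region_def by (rule connected_component_eq[OF CollectI, symmetric])
qed

lemma same_param_params: "s \<in> params D \<Longrightarrow> t \<in> params D \<Longrightarrow> same_param s t \<Longrightarrow> s = t"
proof -
  assume st: "s \<in> params D" "t \<in> params D" "same_param s t"
  then obtain i :: int where i: "s - t = of_int i * real (length D)"
    by (auto simp: same_param_def)
  have "\<bar>s - t\<bar> < real (length D)"
    using st by (auto simp: params_def)
  moreover have "0 < real (length D)"
    using length_ge_3 by linarith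
  ultimately have "\<bar>real_of_int i\<bar> < 1"
    using i mult_less_cancel_right_pos[of "real (length D)" "\<bar>real_of_int i\<bar>" 1] by (simp add: abs_mult)
  then have "i = 0"
    by simp
  then show "s = t"
    using i by simp
qed

lemma crossingsD:
  assumes "(s, t) \<in> crossings D"
  shows "s \<in> params D" "t \<in> params D" "0 \<le> s" "0 \<le> t" "proj D s = proj D t" "\<not> same_param s t"
  using assms same_param_params by (auto simp: crossings_def params_nonneg)

text \<open>Relations and triviality quantify over surrounding regions, so they carry information
  only where such regions exist. Each quadrant near the crossing is a box missing the curve and
  hence lies in one region.\<close>

lemma surrounding_exists:
  assumes c: "(s, t) \<in> crossings D"
  obtains x1 x2 x3 x4 where "surrounding D (s, t) x1 x2 x3 x4"
proof -
  let ?q = "proj D s" and ?u = "direction D s" and ?v = "direction D t"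
  obtain r where r: "0 < r" "\<And>\<alpha> \<beta>. \<bar>\<alpha>\<bar> < r \<Longrightarrow> \<bar>\<beta>\<bar> < r \<Longrightarrow> \<alpha> \<noteq> 0 \<Longrightarrow> \<beta> \<noteq> 0 \<Longrightarrow>
      ?q + \<alpha> *\<^sub>R ?u + \<beta> *\<^sub>R ?v \<notin> shadow"
    using shadow_near_crossing[OF crossingsD(3-6)[OF c]] by blast
  have side: "\<exists>X\<in>regions D. \<forall>\<^sub>F e in at_right 0. ?q + e *\<^sub>R (\<sigma> *\<^sub>R ?u + \<tau> *\<^sub>R ?v) \<in> X"
    if \<sigma>\<tau>: "\<sigma> \<in> {1, -1}" "\<tau> \<in> {1, -1}" for \<sigma> \<tau>
  proof -
    define K where "K = {?q + \<alpha> *\<^sub>R (\<sigma> *\<^sub>R ?u) + \<beta> *\<^sub>R (\<tau> *\<^sub>R ?v) | \<alpha> \<beta>. \<alpha> \<in> {0<..<r} \<and> \<beta> \<in> {0<..<r}}"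
    have K: "connected K"
      unfolding K_def by (intro convex_connected convex_box) auto
    have off: "K \<inter> shadow = {}"
    proof -
      have "?q + \<alpha> *\<^sub>R (\<sigma> *\<^sub>R ?u) + \<beta> *\<^sub>R (\<tau> *\<^sub>R ?v) \<notin> shadow" if "\<alpha> \<in> {0<..<r}" "\<beta> \<in> {0<..<r}" for \<alpha> \<beta>
        using r(2)[of "\<alpha> * \<sigma>" "\<beta> * \<tau>"] that \<sigma>\<tau> by (auto simp: abs_mult)
      then show ?thesis
        unfolding K_def by blast
    qed
    have mem: "?q + e *\<^sub>R (\<sigma> *\<^sub>R ?u + \<tau> *\<^sub>R ?v) \<in> K" if "e \<in> {0<..<r}" for e
    proof -
      have "?q + e *\<^sub>R (\<sigma> *\<^sub>R ?u + \<tau> *\<^sub>R ?v) = ?q + e *\<^sub>R (\<sigma> *\<^sub>R ?u) + e *\<^sub>R (\<tau> *\<^sub>R ?v)"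
        by (simp add: scaleR_add_right add.assoc)
      then show ?thesis
        unfolding K_def using that by blast
    qed
    define x where "x = ?q + (r / 2) *\<^sub>R (\<sigma> *\<^sub>R ?u + \<tau> *\<^sub>R ?v)"
    have x: "x \<in> K"
      unfolding x_def by (rule mem) (use r(1) in auto)
    have "\<forall>\<^sub>F e in at_right 0. e \<in> {0<..<r}"
      using r(1) by (rule eventually_at_right_real)
    then have "\<forall>\<^sub>F e in at_right 0. ?q + e *\<^sub>R (\<sigma> *\<^sub>R ?u + \<tau> *\<^sub>R ?v) \<in> region x"
    proof eventually_elim
      case (elim e)
      have "region x = region (?q + e *\<^sub>R (\<sigma> *\<^sub>R ?u + \<tau> *\<^sub>R ?v))"
        by (rule region_connected[OF K off x mem[OF elim]])
      then show ?case
        using mem[OF elim] off by (auto intro!: mem_region)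
    qed
    moreover have "x \<notin> shadow"
      using x off by blast
    ultimately show ?thesis
      using region_in_regions by blast
  qed
  obtain x1 where "x1 \<in> regions D" "\<forall>\<^sub>F e in at_right 0. ?q + e *\<^sub>R (?u + ?v) \<in> x1"
    using side[of 1 1] by auto
  moreover obtain x2 where "x2 \<in> regions D" "\<forall>\<^sub>F e in at_right 0. ?q + e *\<^sub>R (- ?u + ?v) \<in> x2"
    using side[of "-1" 1] by auto
  moreover obtain x3 where "x3 \<in> regions D" "\<forall>\<^sub>F e in at_right 0. ?q + e *\<^sub>R (?u - ?v) \<in> x3"
    using side[of 1 "-1"] by auto
  moreover obtain x4 where "x4 \<in> regions D" "\<forall>\<^sub>F e in at_right 0. ?q + e *\<^sub>R (- ?u - ?v) \<in> x4"
    using side[of "-1" "-1"] by auto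
  ultimately have "surrounding D (s, t) x1 x2 x3 x4"
    unfolding surrounding_def Let_def fst_conv snd_conv by (simp add: eventually_conj_iff)
  then show ?thesis
    by (rule that)
qed

lemma surrounding_points:
  assumes "surrounding D (s, t) x1 x2 x3 x4" "0 < r"
  obtains e where "0 < e" "e < r" "region (proj D s + e *\<^sub>R (direction D s + direction D t)) = x1"
    "region (proj D s + e *\<^sub>R (- direction D s + direction D t)) = x2"
    "region (proj D s + e *\<^sub>R (direction D s - direction D t)) = x3"
    "region (proj D s + e *\<^sub>R (- direction D s - direction D t)) = x4"
    "x1 \<in> regions D" "x2 \<in> regions D" "x3 \<in> regions D" "x4 \<in> regions D"
proof -
  have reg: "x1 \<in> regions D" "x2 \<in> regions D" "x3 \<in> regions D" "x4 \<in> regions D"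
    and ev: "\<forall>\<^sub>F e in at_right 0. proj D s + e *\<^sub>R (direction D s + direction D t) \<in> x1 \<and>
      proj D s + e *\<^sub>R (- direction D s + direction D t) \<in> x2 \<and>
      proj D s + e *\<^sub>R (direction D s - direction D t) \<in> x3 \<and>
      proj D s + e *\<^sub>R (- direction D s - direction D t) \<in> x4"
    using assms(1) by (auto simp: surrounding_def Let_def)
  have "\<forall>\<^sub>F e in at_right 0. e \<in> {0<..<r}"
    using assms(2) by (rule eventually_at_right_real)
  from eventually_happens[OF eventually_conj[OF this ev]]
  obtain e where e: "e \<in> {0<..<r}" "proj D s + e *\<^sub>R (direction D s + direction D t) \<in> x1"
      "proj D s + e *\<^sub>R (- direction D s + direction D t) \<in> x2"
      "proj D s + e *\<^sub>R (direction D s - direction D t) \<in> x3"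
      "proj D s + e *\<^sub>R (- direction D s - direction D t) \<in> x4"
    by auto
  show ?thesis
    by (rule that[of e]) (use e reg region_unique in auto)
qed

text \<open>The dichotomy is applied to \<open>f\<close> composed with \<open>region\<close>. It
  treats both strands alike, whereas \<open>surrounding\<close> starts from the over-strand; a
  double point met in the order under, over is therefore read with the quadrants \<open>pm\<close>
  and \<open>mp\<close> exchanged.\<close>

lemma region_two_coloring:
  assumes even: "\<And>c x1 x2 x3 x4. c \<in> crossings D \<Longrightarrow> surrounding D c x1 x2 x3 x4 \<Longrightarrow>
    (f x1 \<noteq> f x3) = (f x2 \<noteq> f x4)"
  shows "(\<forall>X\<in>regions D. \<forall>Y\<in>regions D. f X = (f Y :: bool)) \<or>
    (\<forall>c\<in>crossings D. \<forall>x1 x2 x3 x4. surrounding D c x1 x2 x3 x4 \<longrightarrow> f x1 = f x4 \<and> f x2 = f x3 \<and> f x1 \<noteq> f x3)"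
proof -
  interpret knot_two_coloring D "\<lambda>x. f (region x)"
    by unfold_locales (use region_connected convex_connected in metis)
  have link: "pp = f x1 \<and> mp = f x2 \<and> pm = f x3 \<and> mm = f x4"
    if q: "quadrants (proj D s) (direction D s) (direction D t) r pp pm mp mm"
      and sur: "surrounding D (s, t) x1 x2 x3 x4" for s t r pp pm mp mm x1 x2 x3 x4
  proof -
    obtain e where e: "0 < e" "e < r" "region (proj D s + e *\<^sub>R (direction D s + direction D t)) = x1"
      "region (proj D s + e *\<^sub>R (- direction D s + direction D t)) = x2"
      "region (proj D s + e *\<^sub>R (direction D s - direction D t)) = x3"
      "region (proj D s + e *\<^sub>R (- direction D s - direction D t)) = x4"
      using surrounding_points[OF sur quadrants_pos[OF q]] by metis
    have eq: "proj D s + e *\<^sub>R (direction D s + direction D t) = proj D s + e *\<^sub>R direction D s + e *\<^sub>R direction D t"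
      "proj D s + e *\<^sub>R (- direction D s + direction D t) = proj D s - e *\<^sub>R direction D s + e *\<^sub>R direction D t"
      "proj D s + e *\<^sub>R (direction D s - direction D t) = proj D s + e *\<^sub>R direction D s - e *\<^sub>R direction D t"
      "proj D s + e *\<^sub>R (- direction D s - direction D t) = proj D s - e *\<^sub>R direction D s - e *\<^sub>R direction D t"
      by (simp_all add: algebra_simps)
    show ?thesis
      using quadrants_D[OF q e(1,2) e(1,2)] e(3-6) unfolding eq by simp
  qed
  have quad_even: "(pp \<noteq> pm) = (mp \<noteq> mm)"
    if st: "0 \<le> s" "0 \<le> t" "proj D s = proj D t" "\<not> same_param s t"
      and q: "quadrants (proj D s) (direction D s) (direction D t) r pp pm mp mm" for s t r pp pm mp mm
  proof -
    obtain s' m where s: "s' \<in> params D" "s = s' + real (m * length D)"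
      using param_of[OF st(1)] .
    obtain t' n where t: "t' \<in> params D" "t = t' + real (n * length D)"
      using param_of[OF st(2)] .
    note per = periodic[OF params_nonneg[OF s(1)]] periodic[OF params_nonneg[OF t(1)]]
    have eqs: "proj D s = proj D s'" "direction D s = direction D s'" "proj D t = proj D t'"
      "direction D t = direction D t'"
      unfolding s(2) t(2) per by simp_all
    have "s' \<noteq> t'"
      using st(4) same_param_shift[OF s(2) t(2)] same_param_refl by auto
    then have "point D s' \<noteq> point D t'"
      using diagram s(1) t(1) unfolding diagram_def polygonal_knot_def inj_on_def by blast
    moreover have "fst (point D s') = fst (point D t')"
      using st(3) eqs by (simp add: proj_def)
    ultimately consider "(s', t') \<in> crossings D" | "(t', s') \<in> crossings D"
      using s(1) t(1) by (auto simp: crossings_def proj_def prod_eq_iff linorder_neq_iff)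
    then show ?thesis
    proof cases
      case 1
      obtain x1 x2 x3 x4 where sur: "surrounding D (s', t') x1 x2 x3 x4"
        using surrounding_exists[OF 1] .
      show ?thesis
        using link[OF q[unfolded eqs] sur] even[OF 1 sur] by simp
    next
      case 2
      obtain x1 x2 x3 x4 where sur: "surrounding D (t', s') x1 x2 x3 x4"
        using surrounding_exists[OF 2] .
      have "quadrants (proj D t') (direction D t') (direction D s') r pp mp pm mm"
        using quadrants_swap[OF q] st(3) eqs by metis
      from link[OF this sur] even[OF 2 sur] show ?thesis
        by blast
    qed
  qed
  have "(\<forall>x y. x \<notin> shadow \<longrightarrow> y \<notin> shadow \<longrightarrow> f (region x) = f (region y)) \<or>
    (\<forall>s t r pp pm mp mm. 0 \<le> s \<longrightarrow> 0 \<le> t \<longrightarrow> proj D s = proj D t \<longrightarrow> \<not> same_param s t \<longrightarrow>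
      quadrants (proj D s) (direction D s) (direction D t) r pp pm mp mm \<longrightarrow> pp = mm \<and> pm = mp \<and> pp \<noteq> pm)"
    by (rule two_coloring_dichotomy) (rule quad_even)
  then show ?thesis
  proof (elim disjE)
    assume const: "\<forall>x y. x \<notin> shadow \<longrightarrow> y \<notin> shadow \<longrightarrow> f (region x) = f (region y)"
    have "f X = f Y" if "X \<in> regions D" "Y \<in> regions D" for X Y
      using that const by (elim regions_cases) blast
    then show ?thesis
      by blast
  next
    assume alt: "\<forall>s t r pp pm mp mm. 0 \<le> s \<longrightarrow> 0 \<le> t \<longrightarrow> proj D s = proj D t \<longrightarrow> \<not> same_param s t \<longrightarrow>
      quadrants (proj D s) (direction D s) (direction D t) r pp pm mp mm \<longrightarrow> pp = mm \<and> pm = mp \<and> pp \<noteq> pm"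
    have "f x1 = f x4 \<and> f x2 = f x3 \<and> f x1 \<noteq> f x3"
      if c: "(s, t) \<in> crossings D" and sur: "surrounding D (s, t) x1 x2 x3 x4" for s t x1 x2 x3 x4
    proof -
      note st = crossingsD(3-6)[OF c]
      obtain r pp pm mp mm where q: "quadrants (proj D s) (direction D s) (direction D t) r pp pm mp mm"
        using quadrants_crossing[OF st] .
      have "pp = mm \<and> pm = mp \<and> pp \<noteq> pm"
        using alt st q by blast
      then show ?thesis
        using link[OF q sur] by metis
    qed
    note checkerboard = this
    show ?thesis
    proof (intro disjI2 ballI allI impI)
      fix c x1 x2 x3 x4
      assume "c \<in> crossings D" "surrounding D c x1 x2 x3 x4"
      then show "f x1 = f x4 \<and> f x2 = f x3 \<and> f x1 \<noteq> f x3"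
        using checkerboard[of "fst c" "snd c" x1 x2 x3 x4] unfolding prod.collapse by blast
    qed
  qed
qed

end

section \<open>The lower bound\<close>

lemma bit_sum_parity:
  fixes a b c d :: bit
  assumes "a + b + c + d = 0"
  shows "((a = 1) \<noteq> (c = 1)) = ((b = 1) \<noteq> (d = 1))"
  using assms by (cases a; cases b; cases c; cases d) simp_all

text \<open>A function on the colours that satisfies all relations modulo 2 becomes, composed with
  the colouring, a two-valued function on regions. The dichotomy for regions then yields the
  hypothesis \<open>mod2\<close> of the algebraic bound.\<close>

theorem prime_le_two_power_colors:
  assumes col: "nontrivially_colored_diagram p D C" and p: "prime p" "p \<le> 32"
  shows "p \<le> 2 ^ (card (colors D C) - 1)"
proof -
  have diag: "diagram D" and dehn: "dehn_coloring p D C" and nontriv: "\<not> trivial_coloring D C"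
    using col by (auto simp: nontrivially_colored_diagram_def)
  interpret knot_diagram D
    by unfold_locales (rule diag)
  define S where "S = colors D C"
  have S: "S \<subseteq> {0..<int p}"
    using dehn by (simp add: S_def colors_def dehn_coloring_def)
  then have finS: "finite S"
    by (rule finite_subset) simp
  have "card S \<le> p"
    using card_mono[OF _ S] by simp
  then have "card S \<le> CARD(32)"
    using p by simp
  \<comment> \<open>Matrices are indexed by a type, so the colours are renamed by elements of the
    type \<open>32\<close>, which has room for them since there are at most \<open>p\<close> colours
    and \<open>p \<le> 32\<close>.\<close>
  then obtain \<phi> :: "int \<Rightarrow> 32" where \<phi>: "inj_on \<phi> S"
    using card_le_inj[OF finS, of "UNIV :: 32 set"] by auto
  define c where "c = inv_into S \<phi>"
  have c: "c (\<phi> x) = x" if "x \<in> S" for x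
    using that \<phi> by (simp add: c_def)
  have CS: "C X \<in> S" if "X \<in> regions D" for X
    using that by (simp add: S_def colors_def)
  define Rel where "Rel = {(\<phi> (C x1), \<phi> (C x2), \<phi> (C x3), \<phi> (C x4)) | x1 x2 x3 x4.
    \<exists>k\<in>crossings D. surrounding D k x1 x2 x3 x4}"
  have reg: "x1 \<in> regions D" "x2 \<in> regions D" "x3 \<in> regions D" "x4 \<in> regions D"
    if "surrounding D k x1 x2 x3 x4" for k x1 x2 x3 x4
    using that by (auto simp: surrounding_def Let_def)
  have RelE: "\<exists>k x1 x2 x3 x4. k \<in> crossings D \<and> surrounding D k x1 x2 x3 x4 \<and>
      z1 = \<phi> (C x1) \<and> z2 = \<phi> (C x2) \<and> z3 = \<phi> (C x3) \<and> z4 = \<phi> (C x4)"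
    if "(z1, z2, z3, z4) \<in> Rel" for z1 z2 z3 z4
    using that unfolding Rel_def by blast
  have RelI: "(\<phi> (C x1), \<phi> (C x2), \<phi> (C x3), \<phi> (C x4)) \<in> Rel"
    if "k \<in> crossings D" "surrounding D k x1 x2 x3 x4" for k x1 x2 x3 x4
    using that unfolding Rel_def by blast
  obtain k y1 y2 y3 y4 where y: "k \<in> crossings D" "surrounding D k y1 y2 y3 y4"
    "\<not> (C y1 = C y4 \<and> C y3 = C y2)"
    using nontriv unfolding trivial_coloring_def trivially_colored_def by blast
  have "p \<le> 2 ^ (card (\<phi> ` S) - 1)"
  proof (rule prime_le_of_coloring[OF p(1)])
    show "{z1, z2, z3, z4} \<subseteq> \<phi> ` S" if z: "(z1, z2, z3, z4) \<in> Rel" for z1 z2 z3 z4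
    proof -
      obtain k x1 x2 x3 x4 where x: "surrounding D k x1 x2 x3 x4"
        "z1 = \<phi> (C x1)" "z2 = \<phi> (C x2)" "z3 = \<phi> (C x3)" "z4 = \<phi> (C x4)"
        using RelE[OF z] by blast
      show ?thesis
        unfolding x(2-5) using reg[OF x(1)] by (simp add: CS)
    qed
    show "int p dvd c z1 - c z2 + c z3 - c z4" if z: "(z1, z2, z3, z4) \<in> Rel" for z1 z2 z3 z4
    proof -
      obtain k x1 x2 x3 x4 where x: "k \<in> crossings D" "surrounding D k x1 x2 x3 x4"
        "z1 = \<phi> (C x1)" "z2 = \<phi> (C x2)" "z3 = \<phi> (C x3)" "z4 = \<phi> (C x4)"
        using RelE[OF z] by blast
      have "[C x1 + C x3 = C x2 + C x4] (mod int p)"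
        using dehn x unfolding dehn_coloring_def by blast
      then have "int p dvd (C x1 + C x3) - (C x2 + C x4)"
        by (simp add: cong_iff_dvd_diff)
      then show ?thesis
        using x reg[OF x(2)] by (simp add: c CS algebra_simps)
    qed
    show "a = b" if ab: "a \<in> \<phi> ` S" "b \<in> \<phi> ` S" "int p dvd c a - c b" for a b
    proof -
      obtain x y where xy: "x \<in> S" "y \<in> S" "a = \<phi> x" "b = \<phi> y"
        using ab by blast
      then have "int p dvd x - y"
        using ab(3) by (simp add: c)
      moreover have "\<bar>x - y\<bar> < int p"
        using subsetD[OF S xy(1)] subsetD[OF S xy(2)] by auto
      ultimately have "x = y"
        using zdvd_imp_le[of "int p" "\<bar>x - y\<bar>"] by fastforce
      then show ?thesis
        using xy by simp
    qed
    show "(\<phi> (C y1), \<phi> (C y2), \<phi> (C y3), \<phi> (C y4)) \<in> Rel"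
      by (rule RelI[OF y(1,2)])
    show "\<not> (\<phi> (C y1) = \<phi> (C y4) \<and> \<phi> (C y3) = \<phi> (C y2))"
      using y(3) reg[OF y(2)] CS inj_on_eq_iff[OF \<phi>] by auto
    fix g :: "32 \<Rightarrow> bit"
    assume even: "\<And>x1 x2 x3 x4. (x1, x2, x3, x4) \<in> Rel \<Longrightarrow> g x1 + g x2 + g x3 + g x4 = 0"
    define f where "f X \<longleftrightarrow> g (\<phi> (C X)) = 1" for X
    have feq: "f X = f Y \<longleftrightarrow> g (\<phi> (C X)) = g (\<phi> (C Y))" for X Y
      unfolding f_def by (metis (full_types) bit_not_one_iff)
    have "(\<forall>X\<in>regions D. \<forall>Y\<in>regions D. f X = f Y) \<or>
      (\<forall>c\<in>crossings D. \<forall>x1 x2 x3 x4. surrounding D c x1 x2 x3 x4 \<longrightarrow> f x1 = f x4 \<and> f x2 = f x3 \<and> f x1 \<noteq> f x3)"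
    proof (rule region_two_coloring)
      fix k x1 x2 x3 x4
      assume "k \<in> crossings D" "surrounding D k x1 x2 x3 x4"
      then have "(\<phi> (C x1), \<phi> (C x2), \<phi> (C x3), \<phi> (C x4)) \<in> Rel"
        by (rule RelI)
      from bit_sum_parity[OF even[OF this]] show "(f x1 \<noteq> f x3) = (f x2 \<noteq> f x4)"
        unfolding f_def .
    qed
    then show "(\<forall>x\<in>\<phi> ` S. \<forall>y\<in>\<phi> ` S. g x = g y) \<or>
      (\<forall>x1 x2 x3 x4. (x1, x2, x3, x4) \<in> Rel \<longrightarrow> g x1 = g x4 \<and> g x2 = g x3 \<and> g x1 \<noteq> g x3)"
    proof (elim disjE)
      assume "\<forall>X\<in>regions D. \<forall>Y\<in>regions D. f X = f Y"
      then show ?thesis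
        unfolding feq S_def colors_def by blast
    next
      assume alt: "\<forall>c\<in>crossings D. \<forall>x1 x2 x3 x4. surrounding D c x1 x2 x3 x4 \<longrightarrow> f x1 = f x4 \<and> f x2 = f x3 \<and> f x1 \<noteq> f x3"
      have "g z1 = g z4 \<and> g z2 = g z3 \<and> g z1 \<noteq> g z3" if z: "(z1, z2, z3, z4) \<in> Rel" for z1 z2 z3 z4
      proof -
        obtain k x1 x2 x3 x4 where x: "k \<in> crossings D" "surrounding D k x1 x2 x3 x4"
          "z1 = \<phi> (C x1)" "z2 = \<phi> (C x2)" "z3 = \<phi> (C x3)" "z4 = \<phi> (C x4)"
          using RelE[OF z] by blast
        show ?thesis
          using alt x(1,2) unfolding x(3-6) feq by blast
      qed
      then show ?thesis
        by blast
    qed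
  qed
  also have "card (\<phi> ` S) = card S"
    by (rule card_image[OF \<phi>])
  finally show ?thesis
    by (simp add: S_def)
qed

section \<open>Coloured lattice polygons\<close>

type_synonym lattice_edge = "(int \<times> int \<times> int) \<times> (int \<times> int \<times> int)"

abbreviation sx :: "lattice_edge \<Rightarrow> int" where "sx e \<equiv> fst (fst e)"
abbreviation sy :: "lattice_edge \<Rightarrow> int" where "sy e \<equiv> fst (snd (fst e))"
abbreviation sz :: "lattice_edge \<Rightarrow> int" where "sz e \<equiv> snd (snd (fst e))"
abbreviation tx :: "lattice_edge \<Rightarrow> int" where "tx e \<equiv> fst (snd e)"
abbreviation ty :: "lattice_edge \<Rightarrow> int" where "ty e \<equiv> fst (snd (snd e))"
abbreviation tz :: "lattice_edge \<Rightarrow> int" where "tz e \<equiv> snd (snd (snd e))"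

definition edges :: "(int \<times> int \<times> int) list \<Rightarrow> lattice_edge list" where
  "edges vs = zip vs (rotate1 vs)"

definition polygon :: "(int \<times> int \<times> int) list \<Rightarrow> space list" where
  "polygon vs = map (\<lambda>(x, y, z). ((of_int x, of_int y), of_int z)) vs"

definition axis_parallel :: "lattice_edge \<Rightarrow> bool" where
  "axis_parallel e \<longleftrightarrow> (sx e = tx e) \<noteq> (sy e = ty e)"

text \<open>The end vertex of an edge is not counted as one of its points, so the inequalities need
  to be strict only between the two initial vertices.\<close>

definition separated :: "lattice_edge \<Rightarrow> lattice_edge \<Rightarrow> bool" where
  "separated e f \<longleftrightarrow>
     sx e < sx f \<and> tx e \<le> sx f \<and> sx e \<le> tx f \<and> tx e \<le> tx f \<or>
     sx f < sx e \<and> sx f \<le> tx e \<and> tx f \<le> sx e \<and> tx f \<le> tx e \<or>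
     sy e < sy f \<and> ty e \<le> sy f \<and> sy e \<le> ty f \<and> ty e \<le> ty f \<or>
     sy f < sy e \<and> sy f \<le> ty e \<and> ty f \<le> sy e \<and> ty f \<le> ty e"

definition crosses :: "lattice_edge \<Rightarrow> lattice_edge \<Rightarrow> bool" where
  "crosses e f \<longleftrightarrow> sy e = ty e \<and> sx f = tx f \<and> min (sx e) (tx e) < sx f \<and> sx f < max (sx e) (tx e) \<and>
     min (sy f) (ty f) < sy e \<and> sy e < max (sy f) (ty f)"

definition above :: "lattice_edge \<Rightarrow> lattice_edge \<Rightarrow> bool" where
  "above e f \<longleftrightarrow> max (sz f) (tz f) < min (sz e) (tz e)"

text \<open>A column lists pairs \<open>(b, c)\<close>: the unit cells below height \<open>b\<close>, and not below an
  earlier entry, have colour \<open>c\<close>; all cells above the last entry have colour \<open>0\<close>.\<close>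

fun shade :: "(int \<times> int) list \<Rightarrow> int \<Rightarrow> int" where
  "shade [] j = 0"
| "shade ((b, c) # l) j = (if j < b then c else shade l j)"

fun column_at :: "(int \<times> int) list list \<Rightarrow> int \<Rightarrow> (int \<times> int) list" where
  "column_at [] i = []"
| "column_at (l # ls) i = (if i = 0 then l else column_at ls (i - 1))"

definition cell :: "(int \<times> int) list list \<Rightarrow> int \<Rightarrow> int \<Rightarrow> int" where
  "cell cols i j = shade (column_at cols i) j"

text \<open>The four cells are the corners around the crossing. If the horizontal edge
  \<open>e\<close> is on top, cells adjacent across the over-arc are vertical neighbours, so the
  right and the left pair must have equal sums; if \<open>f\<close> is on top, the upper and the
  lower pair.\<close>

definition legal_crossing :: "int \<Rightarrow> (int \<times> int) list list \<Rightarrow> lattice_edge \<Rightarrow> lattice_edge \<Rightarrow> bool" where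
  "legal_crossing p cols e f \<longleftrightarrow> crosses e f \<and>
     (let i = sx f; j = sy e; ne = cell cols i j; nw = cell cols (i - 1) j;
          se = cell cols i (j - 1); sw = cell cols (i - 1) (j - 1)
      in above e f \<and> (ne + se) mod p = (nw + sw) mod p \<or> above f e \<and> (ne + nw) mod p = (se + sw) mod p)"

definition compatible :: "int \<Rightarrow> (int \<times> int) list list \<Rightarrow> lattice_edge \<Rightarrow> lattice_edge \<Rightarrow> bool" where
  "compatible p cols e f \<longleftrightarrow> separated e f \<or> legal_crossing p cols e f \<or> legal_crossing p cols f e"

definition nontrivial_crossing :: "(int \<times> int) list list \<Rightarrow> lattice_edge \<Rightarrow> lattice_edge \<Rightarrow> bool" where
  "nontrivial_crossing cols e f \<longleftrightarrow> crosses e f \<and>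
     (let i = sx f; j = sy e in cell cols i j \<noteq> cell cols (i - 1) (j - 1) \<or>
        cell cols (i - 1) j \<noteq> cell cols i (j - 1))"

definition vertical_cover :: "lattice_edge list \<Rightarrow> int \<Rightarrow> int \<Rightarrow> bool" where
  "vertical_cover es i j \<longleftrightarrow>
     list_ex (\<lambda>e. sx e = i \<and> tx e = i \<and> min (sy e) (ty e) \<le> j \<and> j + 1 \<le> max (sy e) (ty e)) es"

definition horizontal_cover :: "lattice_edge list \<Rightarrow> int \<Rightarrow> int \<Rightarrow> bool" where
  "horizontal_cover es i j \<longleftrightarrow>
     list_ex (\<lambda>e. sy e = j \<and> ty e = j \<and> min (sx e) (tx e) \<le> i \<and> i + 1 \<le> max (sx e) (tx e)) es"

text \<open>Colour changes must lie on the polygon, but not conversely: an edge may separate cells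
  of equal colour, and then the columns need no entry for it.\<close>

fun horizontal_check :: "lattice_edge list \<Rightarrow> int \<Rightarrow> (int \<times> int) list list \<Rightarrow> bool" where
  "horizontal_check es i [] = True"
| "horizontal_check es i (l # ls) =
    (list_all (\<lambda>(b, c). horizontal_cover es i b) l \<and> horizontal_check es (i + 1) ls)"

definition columns_match :: "lattice_edge list \<Rightarrow> int \<Rightarrow> int \<Rightarrow> (int \<times> int) list \<Rightarrow> (int \<times> int) list \<Rightarrow> bool" where
  "columns_match es h i l l' \<longleftrightarrow> list_all (\<lambda>j. shade l j = shade l' j \<or> vertical_cover es i j) [0..h]"

fun vertical_check ::
    "lattice_edge list \<Rightarrow> int \<Rightarrow> int \<Rightarrow> (int \<times> int) list \<Rightarrow> (int \<times> int) list list \<Rightarrow> bool" where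
  "vertical_check es h i l [] = columns_match es h i l []"
| "vertical_check es h i l (l' # ls) = (columns_match es h i l l' \<and> vertical_check es h (i + 1) l' ls)"

text \<open>Forces colour 0 outside the rows 0 to \<open>h\<close>, so that columns need to be
  compared in these rows only. The first entry also colours all cells below the diagram, hence its
  colour 0; a column whose bottom cell is not 0 starts with \<open>(0, 0)\<close>.\<close>

definition bounded_column :: "int \<Rightarrow> int list \<Rightarrow> (int \<times> int) list \<Rightarrow> bool" where
  "bounded_column h S l \<longleftrightarrow> (l = [] \<or> snd (hd l) = 0) \<and> list_all (\<lambda>(b, c). 0 \<le> b \<and> b \<le> h + 1 \<and> c \<in> set S) l"

text \<open>A certificate that can be evaluated: it speaks only of integer coordinates and finite
  lists. \<open>compatible\<close> is symmetric, so \<open>sorted_wrt\<close> covers all pairs of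
  edges.\<close>

definition colored_polygon ::
    "nat \<Rightarrow> int \<Rightarrow> int list \<Rightarrow> (int \<times> int \<times> int) list \<Rightarrow> (int \<times> int) list list \<Rightarrow> bool" where
  "colored_polygon p h S vs cols \<longleftrightarrow> (let es = edges vs in
     3 \<le> length vs \<and> list_all axis_parallel es \<and> sorted_wrt (compatible (int p) cols) es \<and>
     list_ex (\<lambda>e. list_ex (nontrivial_crossing cols e) es) es \<and>
     0 \<in> set S \<and> list_all (\<lambda>c. 0 \<le> c \<and> c < int p) S \<and> list_all (bounded_column h S) cols \<and>
     horizontal_check es 0 cols \<and> vertical_check es h 0 [] cols)"

lemma shade_below: "bounded_column h S l \<Longrightarrow> j < 0 \<Longrightarrow> shade l j = 0"
  by (cases l) (auto simp: bounded_column_def)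

lemma shade_above: "list_all (\<lambda>(b, c). b \<le> h + 1) l \<Longrightarrow> h < j \<Longrightarrow> shade l j = 0"
  by (induction l j rule: shade.induct) auto

lemma shade_in: "0 \<in> set S \<Longrightarrow> list_all (\<lambda>(b, c). c \<in> set S) l \<Longrightarrow> shade l j \<in> set S"
  by (induction l j rule: shade.induct) auto

lemma shade_jump: "shade l (j - 1) \<noteq> shade l j \<Longrightarrow> \<exists>c. (j, c) \<in> set l"
  by (induction l j rule: shade.induct) (auto split: if_splits)

lemma column_at_cases: "column_at cols i = [] \<or> column_at cols i \<in> set cols"
  by (induction cols i rule: column_at.induct) auto

lemma column_at_negative: "i < 0 \<Longrightarrow> column_at cols i = []"
  by (induction cols i rule: column_at.induct) auto

lemma horizontal_check_cover:
  assumes "horizontal_check es i0 cols" "(j, c) \<in> set (column_at cols i)"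
  shows "horizontal_cover es (i0 + i) j"
  using assms
proof (induction cols arbitrary: i0 i)
  case (Cons l cols)
  show ?case
  proof (cases "i = 0")
    case True
    then show ?thesis
      using Cons.prems by (auto simp: list_all_iff)
  next
    case False
    then have "horizontal_cover es ((i0 + 1) + (i - 1)) j"
      using Cons.prems by (intro Cons.IH) auto
    then show ?thesis
      by simp
  qed
qed simp

lemma vertical_check_match:
  assumes "vertical_check es h i0 l cols" "0 \<le> i"
  shows "columns_match es h (i0 + i) (column_at (l # cols) i) (column_at cols i)"
  using assms
proof (induction cols arbitrary: i0 l i)
  case Nil
  then show ?case
    by (cases "i = 0") (auto simp: columns_match_def list_all_iff)
next
  case (Cons l' cols)
  show ?case
  proof (cases "i = 0")
    case True
    then show ?thesis
      using Cons.prems by simp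
  next
    case False
    have "columns_match es h ((i0 + 1) + (i - 1)) (column_at (l' # cols) (i - 1)) (column_at cols (i - 1))"
      using Cons.prems False by (intro Cons.IH) auto
    then show ?thesis
      using False by simp
  qed
qed

section \<open>Points of lattice edges: separation, crossing and height\<close>

definition edge_point :: "lattice_edge \<Rightarrow> real \<Rightarrow> space" where
  "edge_point e a = ((of_int (sx e) + a * of_int (tx e - sx e), of_int (sy e) + a * of_int (ty e - sy e)),
     of_int (sz e) + a * of_int (tz e - sz e))"

text \<open>The difference of the two sides is a nonnegative combination of the four differences
  between end values. Only the weight \<open>(1 - a) * (1 - b)\<close> of the two initial values is
  certainly positive, so strictness is required for these alone.\<close>

lemma convex_less:
  fixes x x' u u' a b :: real
  assumes "x < u" "x' \<le> u" "x \<le> u'" "x' \<le> u'" "0 \<le> a" "a < 1" "0 \<le> b" "b < 1"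
  shows "x + a * (x' - x) < u + b * (u' - u)"
proof -
  have "0 < (1 - a) * (1 - b) * (u - x)"
    using assms by simp
  moreover have "0 \<le> a * (1 - b) * (u - x')" "0 \<le> (1 - a) * b * (u' - x)" "0 \<le> a * b * (u' - x')"
    using assms by simp_all
  moreover have "u + b * (u' - u) - (x + a * (x' - x)) =
      (1 - a) * (1 - b) * (u - x) + a * (1 - b) * (u - x') + (1 - a) * b * (u' - x) + a * b * (u' - x')"
    by (simp add: algebra_simps)
  ultimately show ?thesis
    by linarith
qed

lemma convex_bounds:
  fixes x x' a :: real
  assumes "0 \<le> a" "a < 1"
  shows "min x x' \<le> x + a * (x' - x)" "x + a * (x' - x) \<le> max x x'"
proof -
  have eq: "x + a * (x' - x) = (1 - a) * x + a * x'"
    by (simp add: algebra_simps)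
  have "(1 - a) * min x x' + a * min x x' \<le> (1 - a) * x + a * x'"
    using assms by (intro add_mono mult_left_mono) auto
  then show "min x x' \<le> x + a * (x' - x)"
    unfolding eq by (simp add: algebra_simps)
  have "(1 - a) * x + a * x' \<le> (1 - a) * max x x' + a * max x x'"
    using assms by (intro add_mono mult_left_mono) auto
  then show "x + a * (x' - x) \<le> max x x'"
    unfolding eq by (simp add: algebra_simps)
qed

lemma separated_points:
  assumes "separated e f" "0 \<le> a" "a < 1" "0 \<le> b" "b < 1"
  shows "fst (edge_point e a) \<noteq> fst (edge_point f b)"
proof -
  consider "sx e < sx f" "tx e \<le> sx f" "sx e \<le> tx f" "tx e \<le> tx f"
    | "sx f < sx e" "tx f \<le> sx e" "sx f \<le> tx e" "tx f \<le> tx e"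
    | "sy e < sy f" "ty e \<le> sy f" "sy e \<le> ty f" "ty e \<le> ty f"
    | "sy f < sy e" "ty f \<le> sy e" "sy f \<le> ty e" "ty f \<le> ty e"
    using assms(1) unfolding separated_def by blast
  then show ?thesis
  proof cases
    case 1
    then show ?thesis
      using convex_less[of "of_int (sx e)" "of_int (sx f)" "of_int (tx e)" "of_int (tx f)" a b] assms(2-5)
      by (simp add: edge_point_def)
  next
    case 2
    then show ?thesis
      using convex_less[of "of_int (sx f)" "of_int (sx e)" "of_int (tx f)" "of_int (tx e)" b a] assms(2-5)
      by (simp add: edge_point_def)
  next
    case 3
    then show ?thesis
      using convex_less[of "of_int (sy e)" "of_int (sy f)" "of_int (ty e)" "of_int (ty f)" a b] assms(2-5)
      by (simp add: edge_point_def)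
  next
    case 4
    then show ?thesis
      using convex_less[of "of_int (sy f)" "of_int (sy e)" "of_int (ty f)" "of_int (ty e)" b a] assms(2-5)
      by (simp add: edge_point_def)
  qed
qed

lemma crossing_point:
  assumes c: "crosses e f" and eq: "fst (edge_point e a) = fst (edge_point f b)"
  shows "a \<noteq> 0" "b \<noteq> 0" "fst (edge_point e a) = (of_int (sx f), of_int (sy e))"
proof -
  have c': "sy e = ty e" "sx f = tx f" "sx e \<noteq> sx f" "sy f \<noteq> sy e"
    using c by (auto simp: crosses_def)
  show "fst (edge_point e a) = (of_int (sx f), of_int (sy e))"
    using eq c' by (simp add: edge_point_def)
  show "a \<noteq> 0" "b \<noteq> 0"
    using eq c' by (auto simp: edge_point_def)
qed

lemma above_points:
  assumes "above e f" "0 \<le> a" "a < 1" "0 \<le> b" "b < 1"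
  shows "snd (edge_point f b) < snd (edge_point e a)"
proof -
  have "snd (edge_point f b) \<le> max (of_int (sz f)) (of_int (tz f))"
    using convex_bounds(2)[OF assms(4,5), of "of_int (sz f)" "of_int (tz f)"] by (simp add: edge_point_def)
  also have "\<dots> = of_int (max (sz f) (tz f))"
    by simp
  also have "\<dots> < real_of_int (min (sz e) (tz e))"
    using assms(1) unfolding above_def of_int_less_iff .
  also have "\<dots> = min (of_int (sz e)) (of_int (tz e))"
    by simp
  also have "\<dots> \<le> snd (edge_point e a)"
    using convex_bounds(1)[OF assms(2,3), of "of_int (sz e)" "of_int (tz e)"] by (simp add: edge_point_def)
  finally show ?thesis .
qed

lemma crosses_meet:
  assumes "crosses e f"
  obtains a b where "0 \<le> a" "a < 1" "0 \<le> b" "b < 1" "fst (edge_point e a) = fst (edge_point f b)"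
proof -
  have c: "sy e = ty e" "sx f = tx f" "min (sx e) (tx e) < sx f" "sx f < max (sx e) (tx e)"
    "min (sy f) (ty f) < sy e" "sy e < max (sy f) (ty f)"
    using assms by (auto simp: crosses_def)
  have between: "0 \<le> real_of_int (m - k) / of_int (l - k) \<and> real_of_int (m - k) / of_int (l - k) < 1 \<and> k \<noteq> l"
    if "min k l < m" "m < max k l" for k l m :: int
  proof (cases "k < l")
    case True
    then show ?thesis
      using that by (simp add: divide_simps)
  next
    case False
    then show ?thesis
      using that by (simp add: divide_simps)
  qed
  define a where "a = real_of_int (sx f - sx e) / of_int (tx e - sx e)"
  define b where "b = real_of_int (sy e - sy f) / of_int (ty f - sy f)"
  have "0 \<le> a" "a < 1" "a * of_int (tx e - sx e) = of_int (sx f - sx e)"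
    using between[OF c(3,4)] by (auto simp: a_def)
  moreover have "0 \<le> b" "b < 1" "b * of_int (ty f - sy f) = of_int (sy e - sy f)"
    using between[OF c(5,6)] by (auto simp: b_def)
  ultimately show ?thesis
    using c(1,2) by (intro that[of a b]) (simp_all add: edge_point_def)
qed

section \<open>From a certified polygon to a knot diagram\<close>

locale lattice_diagram =
  fixes p :: nat and h :: int and S :: "int list" and vs :: "(int \<times> int \<times> int) list"
    and cols :: "(int \<times> int) list list"
  assumes valid: "colored_polygon p h S vs cols"
begin

abbreviation "es \<equiv> edges vs"
abbreviation "D \<equiv> polygon vs"

lemma length_vs: "3 \<le> length vs"
  using valid by (simp add: colored_polygon_def Let_def)

lemma length_es: "length es = length vs"
  by (simp add: edges_def)

lemma length_D: "length D = length vs"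
  by (simp add: polygon_def)

lemma edge_nth: "i < length vs \<Longrightarrow> es ! i = (vs ! i, vs ! (Suc i mod length vs))"
  by (simp add: edges_def nth_rotate1)

lemma edge_axis_parallel: "i < length vs \<Longrightarrow> axis_parallel (es ! i)"
  using valid length_es by (simp add: colored_polygon_def Let_def list_all_length)

lemma vertex_eq: "i < length vs \<Longrightarrow> vertex D i = edge_point (es ! i) 0"
  by (simp add: vertex_def length_D edge_nth edge_point_def) (simp add: polygon_def split: prod.split)

lemma vertex_Suc_eq: "i < length vs \<Longrightarrow> vertex D (Suc i) = edge_point (es ! i) 1"
proof -
  assume i: "i < length vs"
  then have "Suc i mod length vs < length vs"
    by (intro mod_less_divisor) linarith
  with i show ?thesis
    by (simp add: vertex_def length_D edge_nth edge_point_def) (simp add: polygon_def split: prod.split)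
qed

lemma params_edge:
  assumes "t \<in> params D"
  obtains i a where "i < length vs" "0 \<le> a" "a < 1" "t = real i + a" "point D t = edge_point (es ! i) a"
    "direction D t = (of_int (tx (es ! i) - sx (es ! i)), of_int (ty (es ! i) - sy (es ! i)))"
proof -
  define i where "i = nat \<lfloor>t\<rfloor>"
  have t: "0 \<le> t" "t < real (length vs)"
    using assms by (auto simp: params_def length_D)
  then have i: "i < length vs" "t = real i + frac t"
    by (simp_all add: i_def frac_def floor_less_iff nat_less_iff)
  have "point D t = edge_point (es ! i) (frac t)"
    unfolding point_def i_def[symmetric] vertex_eq[OF i(1)] vertex_Suc_eq[OF i(1)]
    by (simp add: edge_point_def algebra_simps)
  moreover have "direction D t = (of_int (tx (es ! i) - sx (es ! i)), of_int (ty (es ! i) - sy (es ! i)))"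
    unfolding direction_def i_def[symmetric] vertex_eq[OF i(1)] vertex_Suc_eq[OF i(1)]
    by (simp add: edge_point_def)
  ultimately show ?thesis
    using that[OF i(1) frac_ge_0 frac_lt_1 i(2)] by blast
qed

lemma edge_param:
  assumes "i < length vs" "0 \<le> a" "a < 1"
  shows "real i + a \<in> params D" "point D (real i + a) = edge_point (es ! i) a"
proof -
  show "real i + a \<in> params D"
    using assms by (simp add: params_def length_D)
  then obtain j b where j: "j < length vs" "0 \<le> b" "b < 1" "real i + a = real j + b"
    "point D (real i + a) = edge_point (es ! j) b"
    by (rule params_edge)
  have "\<lfloor>real i + a\<rfloor> = int i"
    using assms(2,3) by (simp add: floor_eq_iff)
  moreover have "\<lfloor>real j + b\<rfloor> = int j"
    using j(2,3) by (simp add: floor_eq_iff)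
  ultimately have "i = j"
    using j(4) by linarith
  then show "point D (real i + a) = edge_point (es ! i) a"
    using j(4,5) by simp
qed

lemma same_edge: "i < length vs \<Longrightarrow> fst (edge_point (es ! i) a) = fst (edge_point (es ! i) b) \<Longrightarrow> a = b"
  using edge_axis_parallel[of i] by (auto simp: axis_parallel_def edge_point_def)

lemma edges_compatible:
  assumes "i < length vs" "j < length vs" "i \<noteq> j"
  shows "compatible (int p) cols (es ! i) (es ! j)"
proof -
  have sw: "sorted_wrt (compatible (int p) cols) es"
    using valid by (simp add: colored_polygon_def Let_def)
  have sym: "compatible (int p) cols e f" if "compatible (int p) cols f e" for e f
    using that unfolding compatible_def separated_def by blast
  show ?thesis
    using assms sw sym length_es sorted_wrt_iff_nth_less[of "compatible (int p) cols" es]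
    by (metis linorder_neqE_nat)
qed

lemma edges_meet:
  assumes "i < length vs" "j < length vs" "i \<noteq> j" "0 \<le> a" "a < 1" "0 \<le> b" "b < 1"
    and "fst (edge_point (es ! i) a) = fst (edge_point (es ! j) b)"
  shows "legal_crossing (int p) cols (es ! i) (es ! j) \<or> legal_crossing (int p) cols (es ! j) (es ! i)"
  using edges_compatible[OF assms(1-3)] separated_points[of "es ! i" "es ! j" a b] assms(4-8)
  by (auto simp: compatible_def)

lemma legal_crossing_heights:
  assumes "legal_crossing q cols e f" "0 \<le> a" "a < 1" "0 \<le> b" "b < 1"
  shows "snd (edge_point e a) \<noteq> snd (edge_point f b)"
proof -
  have "above e f \<or> above f e"
    using assms(1) unfolding legal_crossing_def Let_def by blast
  then show ?thesis
    using above_points[of e f a b] above_points[of f e b a] assms(2-5) by auto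
qed

lemma double_points:
  assumes "s \<in> params D" "t \<in> params D" "s \<noteq> t" "proj D s = proj D t"
  obtains i j a b where "i < length vs" "j < length vs" "i \<noteq> j" "0 \<le> a" "a < 1" "0 \<le> b" "b < 1"
    "s = real i + a" "t = real j + b" "point D s = edge_point (es ! i) a" "point D t = edge_point (es ! j) b"
    "direction D s = (of_int (tx (es ! i) - sx (es ! i)), of_int (ty (es ! i) - sy (es ! i)))"
    "direction D t = (of_int (tx (es ! j) - sx (es ! j)), of_int (ty (es ! j) - sy (es ! j)))"
    "legal_crossing (int p) cols (es ! i) (es ! j) \<or> legal_crossing (int p) cols (es ! j) (es ! i)"
proof -
  obtain i a where i: "i < length vs" "0 \<le> a" "a < 1" "s = real i + a" "point D s = edge_point (es ! i) a"
    "direction D s = (of_int (tx (es ! i) - sx (es ! i)), of_int (ty (es ! i) - sy (es ! i)))"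
    using params_edge[OF assms(1)] .
  obtain j b where j: "j < length vs" "0 \<le> b" "b < 1" "t = real j + b" "point D t = edge_point (es ! j) b"
    "direction D t = (of_int (tx (es ! j) - sx (es ! j)), of_int (ty (es ! j) - sy (es ! j)))"
    using params_edge[OF assms(2)] .
  have eq: "fst (edge_point (es ! i) a) = fst (edge_point (es ! j) b)"
    using assms(4) i(5) j(5) by (simp add: proj_def)
  have ij: "i \<noteq> j"
    using same_edge[OF i(1)] eq assms(3) i(4) j(4) by auto
  show ?thesis
    by (rule that[OF i(1) j(1) ij i(2,3) j(2,3) i(4) j(4) i(5) j(5) i(6) j(6)
          edges_meet[OF i(1) j(1) ij i(2,3) j(2,3) eq]])
qed

text \<open>Two edges either have disjoint projections or cross perpendicularly in their interiors
  at different heights; this gives injectivity and transversality. Three edges through one point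
  would be pairwise perpendicular, which two axis directions do not allow.\<close>

lemma diagram_D: "diagram D"
  unfolding diagram_def
proof (intro conjI ballI impI)
  show "polygonal_knot D"
    unfolding polygonal_knot_def
  proof (intro conjI inj_onI)
    show "3 \<le> length D"
      using length_vs by (simp add: length_D)
    fix s t
    assume st: "s \<in> params D" "t \<in> params D" "point D s = point D t"
    show "s = t"
    proof (rule ccontr)
      assume "s \<noteq> t"
      moreover have "proj D s = proj D t"
        using st(3) by (simp add: proj_def)
      ultimately obtain i j a b where ij: "0 \<le> a" "a < 1" "0 \<le> b" "b < 1"
        "point D s = edge_point (es ! i) a" "point D t = edge_point (es ! j) b"
        "legal_crossing (int p) cols (es ! i) (es ! j) \<or> legal_crossing (int p) cols (es ! j) (es ! i)"
        using double_points[OF st(1,2)] by metis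
      then show False
        using legal_crossing_heights[of "int p" "es ! i" "es ! j" a b]
          legal_crossing_heights[of "int p" "es ! j" "es ! i" b a] st(3) by auto
    qed
  qed
next
  fix s t
  assume st: "s \<in> params D" "t \<in> params D" "s \<noteq> t \<and> proj D s = proj D t"
  obtain i j a b where ij: "i < length vs" "j < length vs" "i \<noteq> j" "0 \<le> a" "a < 1" "0 \<le> b" "b < 1"
    "s = real i + a" "t = real j + b" "point D s = edge_point (es ! i) a" "point D t = edge_point (es ! j) b"
    "direction D s = (of_int (tx (es ! i) - sx (es ! i)), of_int (ty (es ! i) - sy (es ! i)))"
    "direction D t = (of_int (tx (es ! j) - sx (es ! j)), of_int (ty (es ! j) - sy (es ! j)))"
    "legal_crossing (int p) cols (es ! i) (es ! j) \<or> legal_crossing (int p) cols (es ! j) (es ! i)"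
    using double_points[OF st(1,2)] st(3) by blast
  have eq: "fst (edge_point (es ! i) a) = fst (edge_point (es ! j) b)"
    using st(3) ij(10,11) by (simp add: proj_def)
  have cr: "crosses (es ! i) (es ! j) \<or> crosses (es ! j) (es ! i)"
    using ij(14) by (auto simp: legal_crossing_def)
  then have "a \<noteq> 0 \<and> b \<noteq> 0"
    using crossing_point[OF _ eq] crossing_point[OF _ eq[symmetric]] by blast
  moreover have "x = 0" if "real k + x \<in> \<int>" "0 \<le> x" "x < 1" for k x
  proof -
    have "real k + x - real k \<in> \<int>"
      using that(1) by (intro Ints_diff) auto
    then obtain d :: int where "x = of_int d"
      by (auto elim: Ints_cases)
    then show ?thesis
      using that(2,3) by auto
  qed
  ultimately show "s \<notin> \<int>" "t \<notin> \<int>"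
    using ij by blast+
  show "fst (direction D s) * snd (direction D t) \<noteq> snd (direction D s) * fst (direction D t)"
    unfolding ij(12,13) using cr by (auto simp: crosses_def)
next
  fix r s t
  assume rst: "r \<in> params D" "s \<in> params D" "t \<in> params D" "proj D r = proj D s \<and> proj D s = proj D t"
  have edge: "\<exists>k<length vs. \<exists>x. 0 \<le> x \<and> x < 1 \<and> u = real k + x \<and> point D u = edge_point (es ! k) x" if "u \<in> params D" for u
    using params_edge[OF that] by metis
  obtain k x where k: "k < length vs" "0 \<le> x" "x < 1" "r = real k + x" "point D r = edge_point (es ! k) x"
    using edge[OF rst(1)] by blast
  obtain i a where i: "i < length vs" "0 \<le> a" "a < 1" "s = real i + a" "point D s = edge_point (es ! i) a"
    using edge[OF rst(2)] by blast
  obtain j b where j: "j < length vs" "0 \<le> b" "b < 1" "t = real j + b" "point D t = edge_point (es ! j) b"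
    using edge[OF rst(3)] by blast
  have eqs: "fst (edge_point (es ! k) x) = fst (edge_point (es ! i) a)"
    "fst (edge_point (es ! i) a) = fst (edge_point (es ! j) b)"
    "fst (edge_point (es ! k) x) = fst (edge_point (es ! j) b)"
    using rst(4) k(5) i(5) j(5) by (auto simp: proj_def)
  show "r = s \<or> s = t \<or> r = t"
  proof (cases "k = i \<or> i = j \<or> k = j")
    case True
    then show ?thesis
      using same_edge[OF k(1)] same_edge[OF i(1)] eqs k(4) i(4) j(4) by auto
  next
    case False
    define hor where "hor l \<longleftrightarrow> sy (es ! l) = ty (es ! l)" for l
    have perp: "hor l \<noteq> hor m"
      if "l < length vs" "m < length vs"
        "legal_crossing (int p) cols (es ! l) (es ! m) \<or> legal_crossing (int p) cols (es ! m) (es ! l)" for l m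
      using that edge_axis_parallel[of l] edge_axis_parallel[of m]
      by (auto simp: hor_def legal_crossing_def crosses_def axis_parallel_def)
    have "hor k \<noteq> hor i"
      using False k i eqs by (intro perp edges_meet[of k i x a]) auto
    moreover have "hor i \<noteq> hor j"
      using False i j eqs by (intro perp edges_meet[of i j a b]) auto
    moreover have "hor k \<noteq> hor j"
      using False k j eqs by (intro perp edges_meet[of k j x b]) auto
    ultimately show ?thesis
      by blast
  qed
qed

sublocale knot_diagram D
  by unfold_locales (rule diagram_D)

lemma edge_in_shadow:
  assumes "e \<in> set es" "0 \<le> a" "a \<le> 1"
  shows "fst (edge_point e a) \<in> shadow"
proof -
  obtain i where i: "i < length vs" "e = es ! i"
    using assms(1) length_es by (auto simp: in_set_conv_nth)
  have "proj D (real i + a) = fst (edge_point e a)"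
    unfolding proj_edge[OF assms(2,3)] dir_def vertex_eq[OF i(1)] vertex_Suc_eq[OF i(1)] i(2)
    by (simp add: edge_point_def)
  then show ?thesis
    using proj_in_shadow[of "real i + a"] assms(2) by simp
qed

lemma convex_param:
  fixes u v y :: real
  assumes "min u v \<le> y" "y \<le> max u v" "u \<noteq> v"
  obtains a where "0 \<le> a" "a \<le> 1" "u + a * (v - u) = y"
proof (rule that)
  show "u + (y - u) / (v - u) * (v - u) = y"
    using assms(3) by simp
  show "0 \<le> (y - u) / (v - u)" "(y - u) / (v - u) \<le> 1"
    using assms by (cases "u < v"; simp add: divide_simps)+
qed

lemma vertical_cover_shadow:
  assumes "vertical_cover es i j" "of_int j \<le> y" "y \<le> of_int j + 1"
  shows "(of_int i, y) \<in> shadow"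
proof -
  obtain e where e: "e \<in> set es" "sx e = i" "tx e = i" "min (sy e) (ty e) \<le> j" "j + 1 \<le> max (sy e) (ty e)"
    using assms(1) by (auto simp: vertical_cover_def list_ex_iff)
  have bounds: "min (real_of_int (sy e)) (of_int (ty e)) \<le> of_int j"
    "of_int j + 1 \<le> max (real_of_int (sy e)) (of_int (ty e))"
    using e(4,5) by linarith+
  have "real_of_int (sy e) \<noteq> of_int (ty e)"
    using bounds by auto
  from convex_param[OF order_trans[OF bounds(1) assms(2)] order_trans[OF assms(3) bounds(2)] this]
  obtain a where "0 \<le> a" "a \<le> 1" "real_of_int (sy e) + a * (of_int (ty e) - of_int (sy e)) = y" .
  then show ?thesis
    using edge_in_shadow[OF e(1), of a] e(2,3) by (simp add: edge_point_def)
qed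

lemma horizontal_cover_shadow:
  assumes "horizontal_cover es i j" "of_int i \<le> x" "x \<le> of_int i + 1"
  shows "(x, of_int j) \<in> shadow"
proof -
  obtain e where e: "e \<in> set es" "sy e = j" "ty e = j" "min (sx e) (tx e) \<le> i" "i + 1 \<le> max (sx e) (tx e)"
    using assms(1) by (auto simp: horizontal_cover_def list_ex_iff)
  have bounds: "min (real_of_int (sx e)) (of_int (tx e)) \<le> of_int i"
    "of_int i + 1 \<le> max (real_of_int (sx e)) (of_int (tx e))"
    using e(4,5) by linarith+
  have "real_of_int (sx e) \<noteq> of_int (tx e)"
    using bounds by auto
  from convex_param[OF order_trans[OF bounds(1) assms(2)] order_trans[OF assms(3) bounds(2)] this]
  obtain a where "0 \<le> a" "a \<le> 1" "real_of_int (sx e) + a * (of_int (tx e) - of_int (sx e)) = x" .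
  then show ?thesis
    using edge_in_shadow[OF e(1), of a] e(2,3) by (simp add: edge_point_def)
qed

lemma bounded_column_at: "bounded_column h S (column_at cols i)"
  using column_at_cases[of cols i] valid
  by (auto simp: colored_polygon_def Let_def list_all_iff bounded_column_def)

text \<open>Cells beyond the listed columns, and above or below the rows 0 to \<open>h\<close>, have
  colour 0. A change can thus occur only where \<open>vertical_check\<close> looks, which includes
  the borders to the empty columns on both sides.\<close>

lemma cell_vertical_jump:
  assumes "cell cols (i - 1) j \<noteq> cell cols i j"
  shows "vertical_cover es i j"
proof -
  have i: "0 \<le> i"
  proof (rule ccontr)
    assume "\<not> 0 \<le> i"
    then show False
      using assms by (simp add: cell_def column_at_negative)
  qed
  have zero: "shade (column_at cols k) j = 0" if "j < 0 \<or> h < j" for k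
    using that
  proof
    assume "h < j"
    moreover have "list_all (\<lambda>(b, c). b \<le> h + 1) (column_at cols k)"
      using bounded_column_at[of k] by (auto simp: bounded_column_def list_all_iff)
    ultimately show ?thesis
      by (intro shade_above)
  qed (rule shade_below[OF bounded_column_at])
  have j: "j \<in> set [0..h]"
  proof (rule ccontr)
    assume "j \<notin> set [0..h]"
    then have "j < 0 \<or> h < j"
      by auto
    then show False
      using assms zero unfolding cell_def by metis
  qed
  have "vertical_check es h 0 [] cols"
    using valid by (simp add: colored_polygon_def Let_def)
  from vertical_check_match[OF this i]
  have "columns_match es h i (column_at ([] # cols) i) (column_at cols i)"
    by simp
  moreover have "column_at ([] # cols) i = column_at cols (i - 1)"
    using i by (simp add: column_at_negative)
  ultimately show ?thesis
    using assms j by (auto simp: columns_match_def list_all_iff cell_def)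
qed

lemma cell_horizontal_jump:
  assumes "cell cols i (j - 1) \<noteq> cell cols i j"
  shows "horizontal_cover es i j"
proof -
  have "horizontal_check es 0 cols"
    using valid by (simp add: colored_polygon_def Let_def)
  moreover obtain c where "(j, c) \<in> set (column_at cols i)"
    using shade_jump assms unfolding cell_def by blast
  ultimately show ?thesis
    using horizontal_check_cover by fastforce
qed

section \<open>The Dehn colouring induced by the cells\<close>

definition color :: "plane \<Rightarrow> int" where
  "color z = cell cols \<lfloor>fst z\<rfloor> \<lfloor>snd z\<rfloor>"

text \<open>A small neighbourhood of \<open>z\<close> meets several cells only if \<open>z\<close>
  has an integer coordinate. The unit grid segments containing \<open>z\<close> are then not covered
  by the polygon, so the cells on both sides of each of them agree.\<close>

lemma color_locally_constant:
  assumes "z \<notin> shadow"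
  shows "\<forall>\<^sub>F w in nhds z. color w = color z"
proof -
  define i where "i = \<lfloor>fst z\<rfloor>"
  define j where "j = \<lfloor>snd z\<rfloor>"
  define U where "U = {(if fst z = of_int i then of_int i - 1 else of_int i) <..< real_of_int i + 1}"
  define V where "V = {(if snd z = of_int j then of_int j - 1 else of_int j) <..< real_of_int j + 1}"
  have ij: "of_int i \<le> fst z" "fst z < of_int i + 1" "of_int j \<le> snd z" "snd z < of_int j + 1"
    by (auto simp: i_def j_def)
  have "z \<in> U \<times> V"
    using ij by (cases z) (auto simp: U_def V_def)
  moreover have "open (U \<times> V)"
    by (simp add: U_def V_def open_Times)
  ultimately have "\<forall>\<^sub>F w in nhds z. w \<in> U \<times> V"
    by (rule eventually_nhds_in_open[rotated])
  then show ?thesis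
  proof eventually_elim
    case (elim w)
    have x: "\<lfloor>fst w\<rfloor> = i \<or> \<lfloor>fst w\<rfloor> = i - 1 \<and> fst z = of_int i"
      using elim by (cases w) (auto simp: U_def floor_eq_iff split: if_splits)
    have y: "\<lfloor>snd w\<rfloor> = j \<or> \<lfloor>snd w\<rfloor> = j - 1 \<and> snd z = of_int j"
      using elim by (cases w) (auto simp: V_def floor_eq_iff split: if_splits)
    have left: "cell cols (i - 1) k = cell cols i k" if "fst z = of_int i" "of_int k \<le> snd z" "snd z \<le> of_int k + 1" for k
    proof (rule ccontr)
      assume "cell cols (i - 1) k \<noteq> cell cols i k"
      from vertical_cover_shadow[OF cell_vertical_jump[OF this] that(2,3)]
      show False
        using assms that(1) by (metis prod.collapse)
    qed
    have down: "cell cols k (j - 1) = cell cols k j" if "snd z = of_int j" "of_int k \<le> fst z" "fst z \<le> of_int k + 1" for k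
    proof (rule ccontr)
      assume "cell cols k (j - 1) \<noteq> cell cols k j"
      from horizontal_cover_shadow[OF cell_horizontal_jump[OF this] that(2,3)]
      show False
        using assms that(1) by (metis prod.collapse)
    qed
    \<comment> \<open>At a lattice point four cells meet: the column is changed to \<open>i\<close>
      within the row of \<open>w\<close>, and the row to \<open>j\<close> within column
      \<open>i\<close>.\<close>
    have "cell cols \<lfloor>fst w\<rfloor> \<lfloor>snd w\<rfloor> = cell cols i \<lfloor>snd w\<rfloor>"
      using x left[of "\<lfloor>snd w\<rfloor>"] y ij by auto
    also have "\<dots> = cell cols i j"
      using y down[of i] ij by auto
    finally show ?case
      by (simp add: color_def i_def j_def)
  qed
qed

lemma color_region:
  assumes "x \<notin> shadow" "y \<notin> shadow" "region x = region y"
  shows "color x = color y"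
proof (rule connected_local_const[of "region x"])
  show "connected (region x)"
    unfolding region_def by simp
  show "x \<in> region x"
    by (rule mem_region[OF assms(1)])
  show "y \<in> region x"
    unfolding assms(3) by (rule mem_region[OF assms(2)])
  show "\<forall>a\<in>region x. \<forall>\<^sub>F b in at a within region x. color a = color b"
  proof
    fix a
    assume "a \<in> region x"
    then have "a \<notin> shadow"
      using regions_off_shadow region_in_regions[OF assms(1)] by blast
    from color_locally_constant[OF this]
    have "\<forall>\<^sub>F b in at a within region x. color b = color a"
      unfolding eventually_at_filter by eventually_elim simp
    then show "\<forall>\<^sub>F b in at a within region x. color a = color b"
      by eventually_elim simp
  qed
qed

text \<open>The choice of the point is immaterial on regions because \<open>color\<close> is
  constant on each of them.\<close>

definition coloring :: "plane set \<Rightarrow> int" where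
  "coloring X = color (SOME x. x \<in> X)"

lemma coloring_region: "x \<notin> shadow \<Longrightarrow> coloring (region x) = color x"
  unfolding coloring_def
  by (metis color_region mem_region region_in_regions region_unique regions_off_shadow someI)

lemma coloring_in: "coloring ` regions D \<subseteq> set S"
proof -
  have "cell cols i j \<in> set S" for i j
    unfolding cell_def using valid bounded_column_at[of i]
    by (intro shade_in) (auto simp: colored_polygon_def Let_def bounded_column_def list_all_iff)
  then show ?thesis
    by (auto simp: coloring_def color_def)
qed

text \<open>Index of the cell entered when leaving the grid line at \<open>k\<close> in a direction
  whose coordinate is the nonzero number \<open>c\<close>.\<close>

definition side :: "int \<Rightarrow> int \<Rightarrow> int" where
  "side k c = (if 0 < c then k else k - 1)"

lemma floor_add_small:
  assumes "e * real_of_int \<bar>c\<bar> < 1" "0 < e" "c \<noteq> 0"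
  shows "\<lfloor>of_int k + e * real_of_int c\<rfloor> = side k c"
proof (cases "0 < c")
  case True
  then show ?thesis
    using assms by (simp add: floor_eq_iff side_def)
next
  case False
  then have "0 < e * real_of_int (- c)"
    using assms by (intro mult_pos_pos) auto
  then show ?thesis
    using assms False by (simp add: floor_eq_iff side_def)
qed

text \<open>At a crossing of perpendicular axis-parallel edges all sums and differences of the
  directions have nonzero coordinates, as \<open>nz\<close> demands. A step of factor less than
  \<open>1 / m\<close> changes each coordinate by less than 1 and so ends in an adjacent
  cell.\<close>

lemma surrounding_cells:
  assumes sur: "surrounding D (s, t) x1 x2 x3 x4"
    and q: "proj D s = (of_int k, of_int l)"
    and dirs: "direction D s = (of_int a1, of_int a2)" "direction D t = (of_int b1, of_int b2)"
    and nz: "a1 + b1 \<noteq> 0" "a2 + b2 \<noteq> 0" "a1 - b1 \<noteq> 0" "a2 - b2 \<noteq> 0"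
  shows "coloring x1 = cell cols (side k (a1 + b1)) (side l (a2 + b2))"
    "coloring x2 = cell cols (side k (- a1 + b1)) (side l (- a2 + b2))"
    "coloring x3 = cell cols (side k (a1 - b1)) (side l (a2 - b2))"
    "coloring x4 = cell cols (side k (- a1 - b1)) (side l (- a2 - b2))"
proof -
  define m where "m = \<bar>a1\<bar> + \<bar>a2\<bar> + \<bar>b1\<bar> + \<bar>b2\<bar>"
  have m: "0 < m"
    using nz unfolding m_def by linarith
  then have "0 < 1 / real_of_int m"
    by simp
  from surrounding_points[OF sur this]
  obtain e where e: "0 < e" "e < 1 / real_of_int m"
    "region (proj D s + e *\<^sub>R (direction D s + direction D t)) = x1"
    "region (proj D s + e *\<^sub>R (- direction D s + direction D t)) = x2"
    "region (proj D s + e *\<^sub>R (direction D s - direction D t)) = x3"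
    "region (proj D s + e *\<^sub>R (- direction D s - direction D t)) = x4"
    "x1 \<in> regions D" "x2 \<in> regions D" "x3 \<in> regions D" "x4 \<in> regions D" .
  have em: "e * real_of_int m < 1"
    using e(2) m by (simp add: pos_less_divide_eq)
  have val: "coloring X = cell cols (side k c) (side l d)"
    if X: "X \<in> regions D" "X = region (of_int k + e * real_of_int c, of_int l + e * real_of_int d)"
      and cd: "c \<noteq> 0" "d \<noteq> 0" "\<bar>c\<bar> \<le> m" "\<bar>d\<bar> \<le> m" for X c d
  proof -
    let ?z = "(of_int k + e * real_of_int c, of_int l + e * real_of_int d)"
    have z: "?z \<notin> shadow"
    proof
      assume "?z \<in> shadow"
      then have "X = {}"
        unfolding X(2) region_def connected_component_eq_empty by simp
      then show False
        using X(1) in_components_nonempty by (auto simp: regions_def)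
    qed
    have small: "e * real_of_int \<bar>c\<bar> < 1" "e * real_of_int \<bar>d\<bar> < 1"
      using em cd(3,4) e(1) by (meson le_less_trans mult_left_mono of_int_le_iff less_imp_le)+
    show ?thesis
      unfolding X(2) coloring_region[OF z] color_def fst_conv snd_conv
        floor_add_small[OF small(1) e(1) cd(1)] floor_add_small[OF small(2) e(1) cd(2)] ..
  qed
  have b: "\<bar>a1 + b1\<bar> \<le> m" "\<bar>a2 + b2\<bar> \<le> m" "\<bar>- a1 + b1\<bar> \<le> m" "\<bar>- a2 + b2\<bar> \<le> m"
    "\<bar>a1 - b1\<bar> \<le> m" "\<bar>a2 - b2\<bar> \<le> m" "\<bar>- a1 - b1\<bar> \<le> m" "\<bar>- a2 - b2\<bar> \<le> m"
    unfolding m_def by linarith+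
  have pts: "x1 = region (of_int k + e * real_of_int (a1 + b1), of_int l + e * real_of_int (a2 + b2))"
    "x2 = region (of_int k + e * real_of_int (- a1 + b1), of_int l + e * real_of_int (- a2 + b2))"
    "x3 = region (of_int k + e * real_of_int (a1 - b1), of_int l + e * real_of_int (a2 - b2))"
    "x4 = region (of_int k + e * real_of_int (- a1 - b1), of_int l + e * real_of_int (- a2 - b2))"
    using e(3-6) by (simp_all add: q dirs)
  show "coloring x1 = cell cols (side k (a1 + b1)) (side l (a2 + b2))"
    "coloring x2 = cell cols (side k (- a1 + b1)) (side l (- a2 + b2))"
    "coloring x3 = cell cols (side k (a1 - b1)) (side l (a2 - b2))"
    "coloring x4 = cell cols (side k (- a1 - b1)) (side l (- a2 - b2))"
    by (rule val[OF e(7) pts(1)] val[OF e(8) pts(2)] val[OF e(9) pts(3)] val[OF e(10) pts(4)];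
        use nz b in \<open>simp; fail | linarith\<close>)+
qed

text \<open>The relation at a crossing is symmetric under reversing either strand, so only the
  over-strand matters and not the directions.\<close>

lemma crossing_colors:
  assumes c: "(s, t) \<in> crossings D" and sur: "surrounding D (s, t) x1 x2 x3 x4"
  obtains k l where "proj D s = (of_int k, of_int l)"
    "[coloring x1 + coloring x3 = coloring x2 + coloring x4] (mod int p)"
    "coloring x1 = coloring x4 \<and> coloring x3 = coloring x2 \<Longrightarrow>
      cell cols k l = cell cols (k - 1) (l - 1) \<and> cell cols (k - 1) l = cell cols k (l - 1)"
proof -
  have st: "s \<in> params D" "t \<in> params D" "s \<noteq> t" "proj D s = proj D t"
    using crossingsD[OF c] same_param_refl by auto
  have hgt: "snd (point D t) < snd (point D s)"
    using c by (auto simp: crossings_def)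
  obtain i j a b where ij: "i < length vs" "j < length vs" "i \<noteq> j" "0 \<le> a" "a < 1" "0 \<le> b" "b < 1"
    "s = real i + a" "t = real j + b" "point D s = edge_point (es ! i) a" "point D t = edge_point (es ! j) b"
    "direction D s = (of_int (tx (es ! i) - sx (es ! i)), of_int (ty (es ! i) - sy (es ! i)))"
    "direction D t = (of_int (tx (es ! j) - sx (es ! j)), of_int (ty (es ! j) - sy (es ! j)))"
    "legal_crossing (int p) cols (es ! i) (es ! j) \<or> legal_crossing (int p) cols (es ! j) (es ! i)"
    using double_points[OF st] by blast
  have eq: "fst (edge_point (es ! i) a) = fst (edge_point (es ! j) b)"
    using st(4) ij(10,11) by (simp add: proj_def)
  \<comment> \<open>\<open>s\<close> is the over-point, and this selects the matching alternative of
    \<open>legal_crossing\<close>.\<close>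
  have not_above: "\<not> above (es ! j) (es ! i)"
    using above_points[of "es ! j" "es ! i" b a] ij(4-7) hgt ij(10,11) by auto
  show ?thesis
  proof (cases "legal_crossing (int p) cols (es ! i) (es ! j)")
    case True
    let ?e = "es ! i" and ?f = "es ! j"
    have cr: "crosses ?e ?f"
      using True by (simp add: legal_crossing_def)
    then have cd: "tx ?e - sx ?e \<noteq> 0" "ty ?f - sy ?f \<noteq> 0" "ty ?e - sy ?e = 0" "tx ?f - sx ?f = 0"
      by (auto simp: crosses_def)
    have q: "proj D s = (of_int (sx ?f), of_int (sy ?e))"
      using crossing_point(3)[OF cr eq] ij(10) by (simp add: proj_def)
    note C = surrounding_cells[OF sur q ij(12,13), unfolded cd(3,4)]
    show ?thesis
    proof (rule that[OF q])
      show "[coloring x1 + coloring x3 = coloring x2 + coloring x4] (mod int p)"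
        using True not_above cd(1,2)
        by (auto simp: C side_def legal_crossing_def Let_def cong_def add.commute)
      show "cell cols (sx ?f) (sy ?e) = cell cols (sx ?f - 1) (sy ?e - 1) \<and>
          cell cols (sx ?f - 1) (sy ?e) = cell cols (sx ?f) (sy ?e - 1)"
        if "coloring x1 = coloring x4 \<and> coloring x3 = coloring x2"
        using that cd(1,2) by (auto simp: C side_def split: if_splits)
    qed
  next
    case False
    let ?e = "es ! j" and ?f = "es ! i"
    have legal: "legal_crossing (int p) cols ?e ?f"
      using False ij(14) by blast
    then have cr: "crosses ?e ?f"
      by (simp add: legal_crossing_def)
    then have cd: "tx ?e - sx ?e \<noteq> 0" "ty ?f - sy ?f \<noteq> 0" "ty ?e - sy ?e = 0" "tx ?f - sx ?f = 0"
      by (auto simp: crosses_def)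
    have q: "proj D s = (of_int (sx ?f), of_int (sy ?e))"
      using crossing_point(3)[OF cr eq[symmetric]] ij(11) st(4) by (simp add: proj_def)
    note C = surrounding_cells[OF sur q ij(12,13), unfolded cd(3,4)]
    show ?thesis
    proof (rule that[OF q])
      show "[coloring x1 + coloring x3 = coloring x2 + coloring x4] (mod int p)"
        using legal not_above cd(1,2)
        by (auto simp: C side_def legal_crossing_def Let_def cong_def add.commute)
      show "cell cols (sx ?f) (sy ?e) = cell cols (sx ?f - 1) (sy ?e - 1) \<and>
          cell cols (sx ?f - 1) (sy ?e) = cell cols (sx ?f) (sy ?e - 1)"
        if "coloring x1 = coloring x4 \<and> coloring x3 = coloring x2"
        using that cd(1,2) by (auto simp: C side_def split: if_splits)
    qed
  qed
qed

text \<open>The nontrivial crossing of the certificate is given by a horizontal and a vertical edge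
  without saying which is on top, so its double point is used in whichever order forms a
  crossing.\<close>

theorem coloring_nontrivial: "nontrivially_colored_diagram p D coloring"
  unfolding nontrivially_colored_diagram_def
proof (intro conjI)
  show "diagram D"
    by (rule diagram_D)
  have "set S \<subseteq> {0..<int p}"
    using valid by (auto simp: colored_polygon_def Let_def list_all_iff)
  then show "dehn_coloring p D coloring"
    unfolding dehn_coloring_def using coloring_in crossing_colors by (metis order_trans prod.collapse)
  have "list_ex (\<lambda>e. list_ex (nontrivial_crossing cols e) es) es"
    using valid by (simp add: colored_polygon_def Let_def)
  then obtain i j where ij: "i < length vs" "j < length vs" "nontrivial_crossing cols (es ! i) (es ! j)"
    by (auto simp: list_ex_length length_es)
  then have cr: "crosses (es ! i) (es ! j)"
    by (simp add: nontrivial_crossing_def)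
  then obtain a b where ab: "0 \<le> a" "a < 1" "0 \<le> b" "b < 1"
    and eq: "fst (edge_point (es ! i) a) = fst (edge_point (es ! j) b)"
    by (rule crosses_meet)
  have "i \<noteq> j"
    using cr by (auto simp: crosses_def)
  define s where "s = real i + a"
  define t where "t = real j + b"
  have s: "s \<in> params D" "point D s = edge_point (es ! i) a"
    unfolding s_def using edge_param[OF ij(1) ab(1,2)] by auto
  have t: "t \<in> params D" "point D t = edge_point (es ! j) b"
    unfolding t_def using edge_param[OF ij(2) ab(3,4)] by auto
  have "snd (point D s) \<noteq> snd (point D t)"
    using edges_meet[OF ij(1,2) \<open>i \<noteq> j\<close> ab eq] legal_crossing_heights[OF _ ab]
      legal_crossing_heights[OF _ ab(3,4,1,2)] unfolding s t by metis
  then have cases: "snd (point D t) < snd (point D s) \<or> snd (point D s) < snd (point D t)"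
    by linarith
  have st: "proj D s = proj D t" "proj D s = (of_int (sx (es ! j)), of_int (sy (es ! i)))"
    using eq crossing_point(3)[OF cr eq] by (simp_all add: proj_def s t)
  have "(s, t) \<in> crossings D \<or> (t, s) \<in> crossings D"
    using s(1) t(1) st(1) cases by (simp add: crossings_def)
  then obtain s' t' where c: "(s', t') \<in> crossings D" "proj D s' = proj D s"
    using st(1) by metis
  obtain x1 x2 x3 x4 where sur: "surrounding D (s', t') x1 x2 x3 x4"
    using surrounding_exists[OF c(1)] .
  have "\<not> (coloring x1 = coloring x4 \<and> coloring x3 = coloring x2)"
  proof
    assume triv: "coloring x1 = coloring x4 \<and> coloring x3 = coloring x2"
    obtain k l where "proj D s' = (of_int k, of_int l)"
      "cell cols k l = cell cols (k - 1) (l - 1) \<and> cell cols (k - 1) l = cell cols k (l - 1)"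
      using crossing_colors[OF c(1) sur] triv by metis
    then show False
      using ij(3) c(2) st(2) by (simp add: nontrivial_crossing_def Let_def)
  qed
  then show "\<not> trivial_coloring D coloring"
    unfolding trivial_coloring_def trivially_colored_def using c(1) sur by blast
qed

lemma card_colors_le: "card (colors D coloring) \<le> length S"
  unfolding colors_def using coloring_in card_length by (meson List.finite_set card_mono order_trans)

end

section \<open>The minimum attained by a certified polygon\<close>

lemma ambient_isotopic_refl: "ambient_isotopic K K"
  unfolding ambient_isotopic_def
proof (intro exI conjI)
  show "continuous_on ({0..1} \<times> UNIV) (\<lambda>(t :: real, x :: space). x)"
    unfolding case_prod_unfold by (intro continuous_intros)
  show "\<forall>t\<in>{0..1 :: real}. \<exists>g. homeomorphism UNIV UNIV (\<lambda>x :: space. x) g"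
    using homeomorphism_ident by blast
qed auto

text \<open>The length of \<open>S\<close> bounds the number of colours of the polygon from above
  and the general estimate bounds it from below by the same number, so the colours that occur need
  no separate count.\<close>

lemma mincol_of_colored_polygon:
  assumes p: "prime p" "2 ^ m < p" "p < 2 ^ Suc m" "p \<le> 32"
    and S: "length S = m + 2" and col: "\<exists>vs cols. colored_polygon p h S vs cols"
  shows "\<exists>K. knot K \<and> dehn_colorable p K \<and> int (mincol_dehn p K) = \<lfloor>log 2 (real p)\<rfloor> + 2"
proof -
  obtain vs cols where "colored_polygon p h S vs cols"
    using col by blast
  then interpret lattice_diagram p h S vs cols
    by unfold_locales
  let ?K = "curve D"
  have diag: "diagram_of D ?K"
    unfolding diagram_of_def using diagram_D ambient_isotopic_refl by blast
  have lower: "m + 2 \<le> card (colors D' C)" if "nontrivially_colored_diagram p D' C" for D' C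
  proof -
    have "2 ^ m < (2::nat) ^ (card (colors D' C) - 1)"
      using prime_le_two_power_colors[OF that p(1,4)] p(2) by linarith
    then show ?thesis
      by simp
  qed
  have card: "card (colors D coloring) = m + 2"
    using lower[OF coloring_nontrivial] card_colors_le S by simp
  have "mincol_dehn p ?K = m + 2"
    unfolding mincol_dehn_def
  proof (rule Least_equality)
    show "\<exists>D' C. diagram_of D' ?K \<and> nontrivially_colored_diagram p D' C \<and> card (colors D' C) = m + 2"
      using diag coloring_nontrivial card by blast
  qed (use lower in blast)
  moreover have "\<lfloor>log 2 (real p)\<rfloor> = int m"
  proof (rule floor_unique)
    have "real (2 ^ m) \<le> real p" "real p < real (2 ^ Suc m)"
      using p(2,3) by (simp_all only: of_nat_le_iff of_nat_less_iff)
    then have le: "2 ^ m \<le> real p" and less: "real p < 2 ^ Suc m"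
      by simp_all
    show "of_int (int m) \<le> log 2 (real p)"
      using le_log_of_power[OF le] by simp
    show "log 2 (real p) < of_int (int m) + 1"
      using log_of_power_less[OF less] prime_gt_0_nat[OF p(1)] by simp
  qed
  moreover have "knot ?K"
    using diagram_D ambient_isotopic_refl unfolding knot_def diagram_def by blast
  moreover have "dehn_colorable p ?K"
    unfolding dehn_colorable_def using diag coloring_nontrivial by blast
  ultimately show ?thesis
    by auto
qed

section \<open>Certificates for the eight primes\<close>

lemma colored_polygon_3:
  "\<exists>vs cols. colored_polygon 3 3 [0, 1, 2] vs cols"
proof (intro exI)
  \<comment> \<open>A trefoil: the long arcs at heights 3 and 4 close up a two-strand braid with
    three crossings, where a strand at height 1 is met by the vertical edges at 2, 3 and 4. The
    number \<open>h\<close> is the index of the top row of cells.\<close>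
  show "colored_polygon 3 3 [0, 1, 2]
    [(2, 0, 2), (2, 2, 2), (3, 2, 0), (3, 0, 0), (4, 0, 2), (4, 2, 2), (5, 2, 0), (5, 3, 0),
     (1, 3, 0), (1, 1, 1), (6, 1, 1), (6, 4, 0), (0, 4, 0), (0, 0, 0)]
    [[], [(1, 0), (3, 1)], [(1, 0), (2, 2), (3, 1)], [(0, 0), (3, 1)], [(2, 0), (3, 1)], []]"
    by code_simp
qed

lemma colored_polygon_5:
  "\<exists>vs cols. colored_polygon 5 6 [0, 1, 2, 3] vs cols"
proof (intro exI)
  show "colored_polygon 5 6 [0, 1, 2, 3]
    [(3, 0, 0), (3, 3, 1), (8, 3, 1), (8, 6, 0), (1, 6, 0), (1, 1, 2), (6, 1, 2), (6, 4, 2),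
     (7, 4, 0), (7, 5, 0), (2, 5, 0), (2, 4, 0), (4, 4, 0), (4, 2, 0), (5, 2, 3), (5, 0, 3),
     (9, 0, 0), (9, 7, 0), (0, 7, 0), (0, 0, 0)]
    [[], [(1, 0), (6, 2)], [(1, 0), (4, 2), (5, 1), (6, 2)], [(1, 0), (4, 2), (5, 1), (6, 2)],
     [(1, 0), (2, 2), (3, 3), (5, 1), (6, 2)], [(1, 0), (3, 3), (5, 1), (6, 2)], [(3, 0),
     (4, 2), (5, 1), (6, 2)], [(3, 0), (6, 2)], []]"
    by code_simp
qed

lemma colored_polygon_7:
  "\<exists>vs cols. colored_polygon 7 9 [0, 1, 3, 6] vs cols"
proof (intro exI)
  show "colored_polygon 7 9 [0, 1, 3, 6]
    [(6, 0, 4), (6, 2, 4), (7, 2, 0), (7, 5, 1), (14, 5, 1), (14, 8, 0), (2, 8, 0), (2, 3, 2),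
     (12, 3, 2), (12, 6, 2), (13, 6, 0), (13, 7, 0), (3, 7, 0), (3, 6, 0), (10, 6, 0),
     (10, 4, 0), (11, 4, 3), (11, 1, 3), (15, 1, 0), (15, 9, 0), (1, 9, 0), (1, 1, 0),
     (4, 1, 0), (4, 4, 0), (5, 4, 3), (5, 1, 3), (8, 1, 3), (8, 4, 3), (9, 4, 0), (9, 0, 0),
     (16, 0, 0), (16, 10, 0), (0, 10, 0), (0, 0, 0)]
    [[], [(1, 0), (9, 6)], [(1, 0), (3, 6), (8, 1), (9, 6)], [(1, 0), (3, 6), (8, 1), (9, 6)],
     [(4, 0), (8, 1), (9, 6)], [(1, 0), (8, 1), (9, 6)], [(1, 0), (2, 6), (8, 1), (9, 6)],
     [(1, 0), (3, 6), (5, 3), (8, 1), (9, 6)], [(3, 0), (5, 3), (8, 1), (9, 6)], [(3, 0),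
     (5, 3), (8, 1), (9, 6)], [(3, 0), (5, 3), (8, 1), (9, 6)], [(1, 0), (3, 6), (5, 3), (8, 1),
     (9, 6)], [(1, 0), (5, 6), (8, 1), (9, 6)], [(1, 0), (5, 6), (8, 1), (9, 6)], [(1, 0),
     (9, 6)], []]"
    by code_simp
qed

text \<open>Besides 0 and 10 the colours are 1, 2, 5, the proper leading parts of the binary
  expansion 1011 of 11. Each is twice the previous one or one more, which are the relations
  \<open>a + a = 2 * a + 0\<close> and \<open>a + a = (2 * a + 1) + (- 1)\<close> with -1 standing
  for 10. The same pattern gives 1, 3 for 7, then 1, 2, 5, 11 for 23, and 1, 3, 7, 15 for
  31.\<close>

lemma colored_polygon_11:
  "\<exists>vs cols. colored_polygon 11 9 [0, 1, 2, 5, 10] vs cols"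
proof (intro exI)
  show "colored_polygon 11 9 [0, 1, 2, 5, 10]
    [(4, 0, 7), (4, 2, 7), (5, 2, 0), (5, 4, 4), (11, 4, 4), (11, 1, 1), (15, 1, 1), (15, 3, 0),
     (16, 3, 4), (16, 6, 4), (17, 6, 0), (17, 7, 0), (3, 7, 0), (3, 6, 0), (14, 6, 0),
     (14, 2, 2), (19, 2, 2), (19, 9, 0), (1, 9, 0), (1, 1, 0), (9, 1, 6), (9, 3, 6), (10, 3, 0),
     (10, 5, 3), (18, 5, 3), (18, 8, 0), (2, 8, 0), (2, 3, 5), (6, 3, 5), (7, 3, 0), (7, 5, 0),
     (8, 5, 5), (8, 2, 5), (12, 2, 5), (13, 2, 0), (13, 0, 0), (20, 0, 0), (20, 10, 0),
     (0, 10, 0), (0, 0, 0)]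
    [[], [(1, 0), (9, 10)], [(1, 0), (3, 10), (8, 2), (9, 10)], [(1, 0), (3, 10), (8, 2),
     (9, 10)], [(1, 0), (2, 1), (3, 10), (8, 2), (9, 10)], [(1, 0), (3, 1), (4, 0), (8, 2),
     (9, 10)], [(1, 0), (3, 1), (4, 0), (8, 2), (9, 10)], [(1, 0), (5, 1), (8, 2), (9, 10)],
     [(1, 0), (2, 1), (8, 2), (9, 10)], [(2, 0), (3, 10), (8, 2), (9, 10)], [(2, 0), (4, 10),
     (5, 5), (8, 2), (9, 10)], [(1, 0), (5, 5), (8, 2), (9, 10)], [(1, 0), (5, 5), (8, 2),
     (9, 10)], [(1, 0), (5, 5), (8, 2), (9, 10)], [(1, 0), (5, 5), (8, 2), (9, 10)], [(2, 0),
     (3, 10), (5, 5), (8, 2), (9, 10)], [(2, 0), (5, 10), (8, 2), (9, 10)], [(2, 0), (5, 10),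
     (8, 2), (9, 10)], [(2, 0), (9, 10)], []]"
    by code_simp
qed

lemma colored_polygon_17:
  "\<exists>vs cols. colored_polygon 17 9 [0, 2, 3, 7, 15, 16] vs cols"
proof (intro exI)
  show "colored_polygon 17 9 [0, 2, 3, 7, 15, 16]
    [(4, 0, 2), (4, 2, 2), (5, 2, 3), (5, 4, 3), (6, 4, 0), (6, 6, 0), (10, 6, 0), (10, 4, 0),
     (11, 4, 3), (11, 1, 3), (14, 1, 1), (14, 3, 1), (16, 3, 0), (16, 8, 0), (2, 8, 0),
     (2, 3, 2), (12, 3, 2), (12, 6, 2), (13, 6, 0), (13, 2, 0), (17, 2, 0), (17, 9, 0),
     (1, 9, 0), (1, 1, 1), (9, 1, 1), (9, 5, 1), (15, 5, 1), (15, 7, 0), (3, 7, 0), (3, 5, 1),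
     (7, 5, 3), (7, 2, 3), (8, 2, 0), (8, 0, 0), (18, 0, 0), (18, 10, 0), (0, 10, 0), (0, 0, 0)]
    [[(0, 0), (10, 15)], [(0, 0), (10, 15)], [(0, 0), (3, 15), (8, 16), (10, 15)], [(0, 0),
     (3, 15), (5, 16), (7, 3), (8, 16), (10, 15)], [(2, 0), (3, 15), (5, 16), (7, 3), (8, 16),
     (10, 15)], [(3, 0), (5, 16), (7, 3), (8, 16), (10, 15)], [(3, 0), (5, 16), (7, 3), (8, 16),
     (10, 15)], [(2, 0), (3, 2), (7, 3), (8, 16), (10, 15)], [(0, 0), (1, 15), (3, 2), (7, 3),
     (8, 16), (10, 15)], [(0, 0), (3, 15), (5, 7), (7, 3), (8, 16), (10, 15)], [(0, 0), (3, 15),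
     (5, 7), (7, 3), (8, 16), (10, 15)], [(0, 0), (1, 15), (3, 16), (5, 7), (7, 3), (8, 16),
     (10, 15)], [(0, 0), (1, 15), (5, 16), (7, 3), (8, 16), (10, 15)], [(0, 0), (1, 15),
     (5, 16), (7, 3), (8, 16), (10, 15)], [(0, 0), (3, 15), (5, 16), (7, 3), (8, 16), (10, 15)],
     [(0, 0), (3, 15), (8, 16), (10, 15)], [(0, 0), (10, 15)], [(0, 0), (10, 15)]]"
    by code_simp
qed

lemma colored_polygon_19:
  "\<exists>vs cols. colored_polygon 19 9 [0, 1, 2, 5, 13, 18] vs cols"
proof (intro exI)
  show "colored_polygon 19 9 [0, 1, 2, 5, 13, 18]
    [(7, 3, 3), (7, 1, 3), (8, 1, 0), (8, 5, 0), (10, 5, 6), (10, 3, 6), (11, 3, 0), (11, 1, 1),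
     (18, 1, 1), (18, 3, 0), (19, 3, 4), (19, 5, 4), (20, 5, 0), (20, 7, 0), (3, 7, 0),
     (3, 6, 0), (15, 6, 0), (15, 4, 3), (21, 4, 3), (21, 8, 0), (2, 8, 0), (2, 5, 0), (5, 5, 2),
     (5, 2, 2), (12, 2, 2), (12, 5, 4), (16, 5, 4), (17, 5, 0), (17, 2, 2), (22, 2, 2),
     (22, 9, 0), (1, 9, 0), (1, 4, 0), (4, 4, 0), (4, 0, 0), (9, 0, 3), (9, 4, 5), (13, 4, 5),
     (14, 4, 0), (14, 0, 0), (23, 0, 0), (23, 10, 0), (0, 10, 0), (0, 3, 1), (6, 3, 1)]
    [[], [(4, 0), (9, 18)], [(4, 0), (5, 18), (8, 2), (9, 18)], [(4, 0), (5, 18), (8, 2),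
     (9, 18)], [(0, 0), (3, 1), (5, 18), (8, 2), (9, 18)], [(0, 0), (2, 1), (3, 0), (8, 2),
     (9, 18)], [(0, 0), (2, 1), (3, 0), (8, 2), (9, 18)], [(0, 0), (2, 1), (8, 2), (9, 18)],
     [(0, 0), (2, 1), (8, 2), (9, 18)], [(2, 0), (4, 18), (8, 2), (9, 18)], [(2, 0), (3, 18),
     (4, 5), (8, 2), (9, 18)], [(1, 0), (2, 13), (4, 5), (8, 2), (9, 18)], [(1, 0), (5, 13),
     (8, 2), (9, 18)], [(1, 0), (5, 13), (8, 2), (9, 18)], [(1, 0), (5, 13), (8, 2), (9, 18)],
     [(1, 0), (5, 13), (8, 2), (9, 18)], [(1, 0), (5, 13), (8, 2), (9, 18)], [(1, 0), (2, 13),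
     (4, 5), (8, 2), (9, 18)], [(2, 0), (3, 18), (4, 5), (8, 2), (9, 18)], [(2, 0), (4, 18),
     (8, 2), (9, 18)], [(2, 0), (4, 18), (8, 2), (9, 18)], [(2, 0), (9, 18)], []]"
    by code_simp
qed

lemma colored_polygon_23:
  "\<exists>vs cols. colored_polygon 23 9 [0, 1, 2, 5, 11, 22] vs cols"
proof (intro exI)
  show "colored_polygon 23 9 [0, 1, 2, 5, 11, 22]
    [(4, 0, 5), (4, 2, 5), (5, 2, 0), (5, 0, 0), (6, 0, 5), (6, 3, 5), (8, 3, 1), (8, 6, 0),
     (9, 6, 3), (9, 3, 3), (11, 3, 5), (11, 0, 5), (12, 0, 0), (12, 3, 3), (22, 3, 3),
     (22, 8, 0), (2, 8, 0), (2, 4, 0), (7, 4, 0), (7, 2, 0), (10, 2, 6), (10, 4, 6), (13, 4, 0),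
     (13, 6, 0), (18, 6, 0), (18, 4, 0), (19, 4, 5), (19, 6, 5), (21, 6, 0), (21, 7, 0),
     (3, 7, 0), (3, 5, 2), (14, 5, 2), (14, 2, 0), (15, 2, 5), (15, 0, 5), (16, 0, 0),
     (16, 2, 0), (17, 2, 4), (17, 5, 4), (20, 5, 1), (20, 2, 0), (23, 2, 0), (23, 9, 0),
     (1, 9, 0), (1, 1, 4), (24, 1, 4), (24, 10, 0), (0, 10, 0), (0, 0, 0)]
    [[(0, 0), (10, 22)], [(0, 0), (10, 22)], [(0, 0), (10, 22)], [(0, 0), (5, 22), (7, 5),
     (10, 22)], [(2, 0), (5, 22), (7, 5), (10, 22)], [(0, 0), (1, 1), (5, 22), (7, 5),
     (10, 22)], [(1, 0), (3, 2), (5, 22), (7, 5), (10, 22)], [(1, 0), (3, 2), (5, 22), (7, 5),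
     (10, 22)], [(1, 0), (6, 2), (7, 5), (10, 22)], [(1, 0), (3, 2), (7, 5), (10, 22)], [(1, 0),
     (3, 2), (4, 22), (7, 5), (10, 22)], [(0, 0), (1, 1), (4, 22), (7, 5), (10, 22)], [(3, 0),
     (4, 22), (7, 5), (10, 22)], [(3, 0), (5, 22), (6, 11), (7, 5), (10, 22)], [(2, 0), (6, 11),
     (7, 5), (10, 22)], [(0, 0), (6, 11), (7, 5), (10, 22)], [(1, 0), (2, 22), (6, 11), (7, 5),
     (10, 22)], [(1, 0), (5, 22), (6, 11), (7, 5), (10, 22)], [(1, 0), (4, 22), (7, 5),
     (10, 22)], [(1, 0), (6, 22), (7, 5), (10, 22)], [(1, 0), (6, 22), (7, 5), (10, 22)],
     [(1, 0), (10, 22)], [(1, 0), (10, 22)], [(1, 0), (10, 22)]]"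
    by code_simp
qed

text \<open>Six colours bound the odd determinant by \<open>2 ^ 5\<close>, and 31 is the largest odd
  number within this bound.\<close>

lemma colored_polygon_31:
  "\<exists>vs cols. colored_polygon 31 10 [0, 1, 3, 7, 15, 30] vs cols"
proof (intro exI)
  show "colored_polygon 31 10 [0, 1, 3, 7, 15, 30]
    [(4, 0, 4), (4, 2, 4), (5, 2, 0), (5, 0, 0), (10, 0, 0), (10, 3, 0), (11, 3, 2), (11, 1, 2),
     (18, 1, 1), (18, 4, 2), (26, 4, 2), (26, 2, 0), (27, 2, 0), (27, 0, 0), (33, 0, 0),
     (33, 2, 0), (34, 2, 3), (34, 6, 3), (35, 6, 0), (35, 2, 0), (40, 2, 0), (40, 10, 0),
     (1, 10, 0), (1, 1, 1), (6, 1, 3), (6, 5, 3), (7, 5, 0), (7, 7, 0), (8, 7, 2), (8, 5, 2),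
     (9, 5, 0), (9, 2, 1), (12, 2, 1), (12, 5, 0), (13, 5, 3), (13, 3, 3), (19, 3, 3),
     (20, 3, 0), (20, 6, 1), (23, 6, 1), (23, 1, 1), (28, 1, 1), (28, 5, 2), (39, 5, 2),
     (39, 9, 0), (2, 9, 0), (2, 4, 2), (14, 4, 2), (14, 7, 2), (21, 7, 0), (21, 5, 0),
     (22, 5, 2), (22, 7, 2), (29, 7, 3), (29, 4, 3), (30, 4, 0), (30, 7, 0), (36, 7, 0),
     (36, 3, 0), (37, 3, 3), (37, 6, 3), (38, 6, 0), (38, 8, 0), (3, 8, 0), (3, 6, 1),
     (15, 6, 1), (16, 6, 4), (16, 2, 4), (17, 2, 0), (17, 0, 0), (24, 0, 0), (24, 3, 0),
     (25, 3, 3), (31, 3, 3), (31, 6, 3), (32, 6, 0), (32, 1, 1), (41, 1, 1), (41, 11, 0),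
     (0, 11, 0), (0, 0, 0)]
    [[(0, 0), (11, 30)], [(0, 0), (11, 30)], [(0, 0), (11, 30)], [(0, 0), (6, 30), (8, 3),
     (11, 30)], [(2, 0), (6, 30), (8, 3), (11, 30)], [(0, 0), (1, 1), (6, 30), (8, 3),
     (11, 30)], [(0, 0), (5, 1), (6, 30), (8, 3), (11, 30)], [(0, 0), (7, 1), (8, 3), (11, 30)],
     [(0, 0), (5, 1), (8, 3), (11, 30)], [(0, 0), (2, 1), (4, 30), (8, 3), (11, 30)], [(3, 0),
     (4, 30), (8, 3), (11, 30)], [(1, 0), (4, 30), (8, 3), (11, 30)], [(1, 0), (4, 30), (8, 3),
     (11, 30)], [(1, 0), (3, 30), (4, 7), (8, 3), (11, 30)], [(1, 0), (3, 30), (7, 7), (8, 3),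
     (11, 30)], [(1, 0), (3, 30), (7, 7), (8, 3), (11, 30)], [(1, 0), (2, 30), (3, 15), (7, 7),
     (8, 3), (11, 30)], [(0, 0), (3, 15), (7, 7), (8, 3), (11, 30)], [(0, 0), (3, 15), (7, 7),
     (8, 3), (11, 30)], [(0, 0), (3, 15), (7, 7), (8, 3), (11, 30)], [(0, 0), (4, 15), (6, 30),
     (7, 7), (8, 3), (11, 30)], [(0, 0), (4, 15), (5, 30), (8, 3), (11, 30)], [(0, 0), (4, 15),
     (7, 30), (8, 3), (11, 30)], [(0, 0), (4, 15), (7, 30), (8, 3), (11, 30)], [(1, 0), (3, 30),
     (4, 15), (7, 30), (8, 3), (11, 30)], [(1, 0), (3, 30), (4, 15), (7, 30), (8, 3), (11, 30)],
     [(1, 0), (2, 30), (3, 15), (7, 30), (8, 3), (11, 30)], [(0, 0), (3, 15), (7, 30), (8, 3),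
     (11, 30)], [(0, 0), (3, 15), (7, 30), (8, 3), (11, 30)], [(0, 0), (3, 15), (4, 30), (8, 3),
     (11, 30)], [(0, 0), (3, 15), (5, 30), (7, 7), (8, 3), (11, 30)], [(0, 0), (5, 15), (7, 7),
     (8, 3), (11, 30)], [(0, 0), (5, 15), (7, 7), (8, 3), (11, 30)], [(1, 0), (2, 30), (5, 15),
     (7, 7), (8, 3), (11, 30)], [(1, 0), (5, 30), (7, 7), (8, 3), (11, 30)], [(1, 0), (5, 30),
     (7, 7), (8, 3), (11, 30)], [(1, 0), (3, 30), (8, 3), (11, 30)], [(1, 0), (6, 30), (8, 3),
     (11, 30)], [(1, 0), (11, 30)], [(1, 0), (11, 30)], [(1, 0), (11, 30)]]"
    by code_simp
qed

theorem proposition5p4: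
  fixes p :: nat
  assumes "prime p" and "odd p" and "p < 2 ^ 5" and "p \<notin> {13, 29}"
  shows "\<exists>K. knot K \<and> dehn_colorable p K \<and>
           int (mincol_dehn p K) = \<lfloor>log 2 (real p)\<rfloor> + 2"
proof -
  have "p \<in> {3, 5, 7, 11, 17, 19, 23, 31}"
  proof (rule ccontr)
    assume "p \<notin> {3, 5, 7, 11, 17, 19, 23, 31}"
    moreover have "p < 32" "2 < p"
      using assms(1-3) prime_ge_2_nat[of p] by (auto simp: order_le_less)
    \<comment> \<open>What remains of the odd numbers from 3 to 31 after removing 13, 29 and the
      eight listed primes; all five are composite.\<close>
    ultimately have "p = 9 \<or> p = 15 \<or> p = 21 \<or> p = 25 \<or> p = 27"
      using assms(2,4) by simp presburger
    then show False
      using assms(1) by auto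
  qed
  \<comment> \<open>In each instance \<open>m\<close> is the exponent of the largest power of 2
    below \<open>p\<close>.\<close>
  then show ?thesis
    using assms(1)
      mincol_of_colored_polygon[OF _ _ _ _ _ colored_polygon_3, of 1]
      mincol_of_colored_polygon[OF _ _ _ _ _ colored_polygon_5, of 2]
      mincol_of_colored_polygon[OF _ _ _ _ _ colored_polygon_7, of 2]
      mincol_of_colored_polygon[OF _ _ _ _ _ colored_polygon_11, of 3]
      mincol_of_colored_polygon[OF _ _ _ _ _ colored_polygon_17, of 4]
      mincol_of_colored_polygon[OF _ _ _ _ _ colored_polygon_19, of 4]
      mincol_of_colored_polygon[OF _ _ _ _ _ colored_polygon_23, of 4]
      mincol_of_colored_polygon[OF _ _ _ _ _ colored_polygon_31, of 4]
    by auto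
qed

end
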